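(* Let $p\ge3$ and $p'$ be coprime positive integers, $t=p'/p$, $1\le r\le p-1$, $1\le s\le p'-1$, and $\delta(z_2/z_1)=\sum_{n\in\mathbb Z}z_1^{-n}z_2^n$. The following identities of formal series of operators acting on $M_{r,s}$ hold. (i) $$\sum_{\sigma=\pm}f^\sigma_{r,s}(z_1,z_2)\phi^{-\sigma}(z_1)\phi^\sigma(z_2)+\sum_{\sigma=\pm}f^\sigma_{r,s}(z_2,z_1)\phi^{-\sigma}(z_2)\phi^\sigma(z_1)=z_1^{-1}\delta(z_2/z_1)\times\begin{cases}1&(2\le r\le p-2),\\ z_1^{s-1}&(r=1),\\ z_1^{p'-s-1}&(r=p-1).\end{cases}$$ (ii) If $2\le r\le p-2$, $$\sum_{\sigma=\pm}g^\sigma_{r,s}(z_1,z_2)\phi^{-\sigma}(z_1)\phi^\sigma(z_2)+\sum_{\sigma=\pm}g^\sigma_{r,s}(z_2,z_1)\phi^{-\sigma}(z_2)\phi^\sigma(z_1)=(-2\Delta_{2,1})\,\delta(z_2/z_1).$$ (iii) For $\sigma=\pm$ with $1\le r+2\sigma\le p-1$, $$h^\sigma_{r,s}(z_1,z_2)\phi^\sigma(z_1)\phi^\sigma(z_2)=h^\sigma_{r,s}(z_2,z_1)\phi^\sigma(z_2)\phi^\sigma(z_1).$$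
   Context: **Virasoro modules.** The Virasoro algebra has basis $L_n$ $(n\in\mathbb Z)$ and central $c$, with $[L_m,L_n]=(m-n)L_{m+n}+\frac{c}{12}m(m^2-1)\delta_{m+n,0}$. $M_{r,s}$ is the irreducible highest weight module with $c=13-6(t+1/t)$ and highest weight vector $|r,s\rangle$, $L_n|r,s\rangle=0$ $(n>0)$, $L_0|r,s\rangle=\Delta_{r,s}|r,s\rangle$, $\Delta_{r,s}=\frac{(rt-s)^2-(t-1)^2}{4t}$; it is graded by $L_0$-eigenspaces $(M_{r,s})_d$. **(2,1)-primary field.** For $1\le r,r\pm1\le p-1$ let $\phi^\pm(z)=\sum_{n\in\mathbb Z+\Delta_{r,s}-\Delta_{r\pm1,s}}\phi^\pm_nz^{-n-\Delta_{2,1}}$, $\Delta_{2,1}=(3t-2)/4$, be the series of operators $\phi_n^\pm:M_{r,s}\to M_{r\pm1,s}$ (index $(r,s)$ suppressed) determined by $[L_n,\phi^\pm(z)]=z^n(z\partial+(n+1)\Delta_{2,1})\phi^\pm(z)$, $\phi_n^\pm(M_{r,s})_d\subset(M_{r\pm1,s})_{d-n}$ and $\phi^\pm_{\Delta_{r,s}-\Delta_{r\pm1,s}}|r,s\rangle=|r\pm1,s\rangle$. (Such operators exist and are unique.) In products the rightmost operator acts first, on $M_{r,s}$; in the sums over $\sigma$, terms with $r+\sigma\notin\{1,\dots,p-1\}$ are absent (their coefficient is $0$). **Coefficient functions.** Each of $f,g,h(z_1,z_2)$ below has the form $z_1^\alpha z_2^\beta\psi(z_2/z_1)$ with $\alpha,\beta\in\mathbb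 Q$ and $\psi$ a power series in $z_2/z_1$ convergent for $|z_2/z_1|<1$; $f(z_2,z_1)$ etc. are obtained by exchanging $z_1,z_2$ (so they are expanded in $z_1/z_2$). $F(a,b,c;z)$ is the Gauss hypergeometric function. For $2\le r\le p-2$ put $\rho=rt-s$, $\lambda_\pm=\frac t4\pm\frac\rho2$, $$\check y^\pm_{r,s}(z)=\frac{\rho\pm(t-1)}{2\rho}\,z^{-\lambda_\pm}(1-z)^{\frac{3t}2-1}F(t-1,\,t-1\mp\rho,\,1\mp\rho;z),$$ $$f^\pm_{r,s}(z_1,z_2)=(z_1z_2)^{\Delta_{2,1}}z_1^{-1}(1-z_2/z_1)^{-1}\check y^\pm_{r,s}(z_2/z_1),\qquad g^\pm_{r,s}(z_1,z_2)=(z_1z_2)^{\Delta_{2,1}}\Bigl(z\tfrac{d}{dz}\check y^\pm_{r,s}\Bigr)(z_2/z_1).$$ For $r=1$ or $r=p-1$, all $f^\sigma_{r,s},g^\sigma_{r,s}$ are $0$ except $$f^+_{1,s}(z_1,z_2)=K_{1-t,s-1}z_1^{3(t-1)/2+s/2-1}z_2^{(s-1)/2}(1-z_2/z_1)^{-2+3t/2},$$ $$f^-_{p-1,s}(z_1,z_2)=K_{1-t,p'-s-1}z_1^{3(t-1)/2+(p'-s)/2-1}z_2^{(p'-s-1)/2}(1-z_2/z_1)^{-2+3t/2},$$ where $K_{a,n}=\prod_{j=0}^{n-1}\frac{a+j}{2a+j}$. For all $r,s$, $$h^\pm_{r,s}(z_1,z_2)=(z_1z_2)^{(t-1)/2\mp(rt-s)/2}z_1^{-t/2}(1-z_2/z_1)^{-t/2}.$$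 *)

theory Defs
  imports
    "HOL-Computational_Algebra.Formal_Power_Series"
    "HOL-Library.Groups_Big_Fun"
    Complex_Main
begin

section \<open>Virasoro modules\<close>

text \<open>
  All modules are complex subspaces \<open>V\<close> of one ambient complex vector space given by a scalar
  multiplication \<open>scale\<close>. This is no restriction, since any family of vector spaces embeds into its
  direct sum. Operators are functions on the ambient type of which only the restriction to the
  relevant subspace matters.
\<close>

definition linear_between ::
    "(complex \<Rightarrow> 'v \<Rightarrow> 'v) \<Rightarrow> 'v::ab_group_add set \<Rightarrow> 'v set \<Rightarrow> ('v \<Rightarrow> 'v) \<Rightarrow> bool" where
  "linear_between scale V W T \<longleftrightarrow>
     T ` V \<subseteq> W \<and>
     (\<forall>u\<in>V. \<forall>v\<in>V. T (u + v) = T u + T v) \<and>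
     (\<forall>a. \<forall>v\<in>V. T (scale a v) = scale a (T v))"

text \<open>The central element acts as the scalar \<open>c\<close>, as it does on every highest weight module.\<close>

definition virasoro_module ::
    "(complex \<Rightarrow> 'v \<Rightarrow> 'v) \<Rightarrow> rat \<Rightarrow> 'v::ab_group_add set \<Rightarrow> (int \<Rightarrow> 'v \<Rightarrow> 'v) \<Rightarrow> bool" where
  "virasoro_module scale c V L \<longleftrightarrow>
     module.subspace scale V \<and>
     (\<forall>n. linear_between scale V V (L n)) \<and>
     (\<forall>m n. \<forall>v\<in>V.
        L m (L n v) - L n (L m v) =
          scale (of_int (m - n)) (L (m + n) v) +
          scale (of_rat (c / 12 * of_int (m * (m\<^sup>2 - 1)) * (if m + n = 0 then 1 else 0))) v)"

definition virasoro_submodule ::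
    "(complex \<Rightarrow> 'v \<Rightarrow> 'v) \<Rightarrow> 'v::ab_group_add set \<Rightarrow> (int \<Rightarrow> 'v \<Rightarrow> 'v) \<Rightarrow> 'v set \<Rightarrow> bool" where
  "virasoro_submodule scale V L W \<longleftrightarrow>
     module.subspace scale W \<and> W \<subseteq> V \<and> (\<forall>n. L n ` W \<subseteq> W)"

definition weight_space ::
    "(complex \<Rightarrow> 'v \<Rightarrow> 'v) \<Rightarrow> 'v set \<Rightarrow> (int \<Rightarrow> 'v \<Rightarrow> 'v) \<Rightarrow> rat \<Rightarrow> 'v set" where
  "weight_space scale V L d = {v \<in> V. L 0 v = scale (of_rat d) v}"

definition highest_weight_module ::
    "(complex \<Rightarrow> 'v \<Rightarrow> 'v) \<Rightarrow> rat \<Rightarrow> rat \<Rightarrow>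
     'v::ab_group_add set \<Rightarrow> (int \<Rightarrow> 'v \<Rightarrow> 'v) \<Rightarrow> 'v \<Rightarrow> bool" where
  "highest_weight_module scale c h V L w \<longleftrightarrow>
     virasoro_module scale c V L \<and>
     w \<noteq> 0 \<and> w \<in> weight_space scale V L h \<and> (\<forall>n>0. L n w = 0) \<and>
     (\<forall>W. virasoro_submodule scale V L W \<and> w \<in> W \<longrightarrow> W = V)"

definition irreducible_highest_weight_module ::
    "(complex \<Rightarrow> 'v \<Rightarrow> 'v) \<Rightarrow> rat \<Rightarrow> rat \<Rightarrow>
     'v::ab_group_add set \<Rightarrow> (int \<Rightarrow> 'v \<Rightarrow> 'v) \<Rightarrow> 'v \<Rightarrow> bool" where
  "irreducible_highest_weight_module scale c h V L w \<longleftrightarrow>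
     highest_weight_module scale c h V L w \<and>
     (\<forall>W. virasoro_submodule scale V L W \<longrightarrow> W = {0} \<or> W = V)"

definition central_charge :: "rat \<Rightarrow> rat" where
  "central_charge t = 13 - 6 * (t + 1 / t)"

definition kac_weight :: "rat \<Rightarrow> int \<Rightarrow> int \<Rightarrow> rat" where
  "kac_weight t r s = ((of_int r * t - of_int s)\<^sup>2 - (t - 1)\<^sup>2) / (4 * t)"

definition delta21 :: "rat \<Rightarrow> rat" where
  "delta21 t = (3 * t - 2) / 4"


section \<open>Primary fields\<close>

text \<open>
  A formal series of operators with rational exponents is the function sending an exponent \<open>e\<close> to
  the coefficient of \<open>z\<^sup>e\<close>. For a family of modes \<open>\<phi>\<close>, the series is
  \<open>\<Sum>n. \<phi>\<^sub>n z\<^bsup>-n-\<Delta>\<^esup>\<close>.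
\<close>

definition field_series :: "rat \<Rightarrow> (rat \<Rightarrow> 'v \<Rightarrow> 'v) \<Rightarrow> rat \<Rightarrow> 'v \<Rightarrow> 'v" where
  "field_series \<Delta> \<phi> e = \<phi> (- e - \<Delta>)"

text \<open>
  A primary field of weight \<open>\<Delta>\<close> from the highest weight module \<open>(V, L, w)\<close> of weight \<open>h\<close>
  to \<open>(V', L', w')\<close> of weight \<open>h'\<close>. The summation range of the series is expressed by the vanishing
  of the modes \<open>\<phi>\<^sub>n\<close> with \<open>n\<close> outside \<open>\<int> + h - h'\<close>. The commutator condition is the coefficient
  of \<open>z\<^sup>e\<close> in \<open>[L\<^sub>n, \<phi>(z)] = z\<^sup>n (z \<partial> + (n + 1) \<Delta>) \<phi>(z)\<close>.
\<close>

definition primary_field ::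
    "(complex \<Rightarrow> 'v \<Rightarrow> 'v) \<Rightarrow> rat \<Rightarrow>
     rat \<Rightarrow> 'v::ab_group_add set \<Rightarrow> (int \<Rightarrow> 'v \<Rightarrow> 'v) \<Rightarrow> 'v \<Rightarrow>
     rat \<Rightarrow> 'v set \<Rightarrow> (int \<Rightarrow> 'v \<Rightarrow> 'v) \<Rightarrow> 'v \<Rightarrow>
     (rat \<Rightarrow> 'v \<Rightarrow> 'v) \<Rightarrow> bool" where
  "primary_field scale \<Delta> h V L w h' V' L' w' \<phi> \<longleftrightarrow>
     (\<forall>n. linear_between scale V V' (\<phi> n)) \<and>
     (\<forall>n. n - (h - h') \<notin> \<int> \<longrightarrow> (\<forall>v\<in>V. \<phi> n v = 0)) \<and>
     (\<forall>n e. \<forall>v\<in>V.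
        L' n (field_series \<Delta> \<phi> e v) - field_series \<Delta> \<phi> e (L n v) =
          scale (of_rat ((e - of_int n) + (of_int n + 1) * \<Delta>)) (field_series \<Delta> \<phi> (e - of_int n) v)) \<and>
     (\<forall>n d. \<phi> n ` weight_space scale V L d \<subseteq> weight_space scale V' L' (d - n)) \<and>
     \<phi> (h - h') w = w'"


section \<open>Formal series in two variables\<close>

text \<open>
  Scalar series in one or two variables with rational exponents are again represented by their
  coefficient functions, \<open>F a b\<close> being the coefficient of \<open>z\<^sub>1\<^sup>a z\<^sub>2\<^sup>b\<close>.
\<close>

text \<open>The series \<open>z\<^sup>\<mu> \<psi>(z)\<close>.\<close>

definition shifted_fps :: "rat \<Rightarrow> rat fps \<Rightarrow> rat \<Rightarrow> rat" where
  "shifted_fps \<mu> \<psi> e = (if e - \<mu> \<in> \<nat> then fps_nth \<psi> (nat \<lfloor>e - \<mu>\<rfloor>) else 0)"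

text \<open>The operator \<open>z d/dz\<close>.\<close>

definition euler_op :: "(rat \<Rightarrow> rat) \<Rightarrow> rat \<Rightarrow> rat" where
  "euler_op y e = e * y e"

text \<open>The series \<open>y(z\<^sub>2/z\<^sub>1)\<close>.\<close>

definition ratio_series :: "(rat \<Rightarrow> rat) \<Rightarrow> rat \<Rightarrow> rat \<Rightarrow> rat" where
  "ratio_series y a b = (if a = - b then y b else 0)"

text \<open>The series \<open>z\<^sub>1\<^sup>\<alpha> z\<^sub>2\<^sup>\<beta> F(z\<^sub>1, z\<^sub>2)\<close>.\<close>

definition monom_mult :: "rat \<Rightarrow> rat \<Rightarrow> (rat \<Rightarrow> rat \<Rightarrow> rat) \<Rightarrow> rat \<Rightarrow> rat \<Rightarrow> rat" where
  "monom_mult \<alpha> \<beta> F a b = F (a - \<alpha>) (b - \<beta>)"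

definition swap_vars :: "(rat \<Rightarrow> rat \<Rightarrow> 'a) \<Rightarrow> rat \<Rightarrow> rat \<Rightarrow> 'a" where
  "swap_vars F a b = F b a"

text \<open>The series \<open>\<delta>(z\<^sub>2/z\<^sub>1)\<close>.\<close>

definition delta_series :: "rat \<Rightarrow> rat \<Rightarrow> rat" where
  "delta_series = ratio_series (\<lambda>e. if e \<in> \<int> then 1 else 0)"

text \<open>The series \<open>A(z\<^sub>1) B(z\<^sub>2)\<close>, with \<open>B\<close> acting first.\<close>

definition op_product ::
    "(rat \<Rightarrow> 'v \<Rightarrow> 'v) \<Rightarrow> (rat \<Rightarrow> 'v \<Rightarrow> 'v) \<Rightarrow> rat \<Rightarrow> rat \<Rightarrow> 'v \<Rightarrow> 'v" where
  "op_product A B a b v = A a (B b v)"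

text \<open>
  The product of a scalar series and a series of operators, applied to a vector. The sum ranges over
  the indices of its nonzero terms. In the products of interest \<open>F\<close> is
  \<open>z\<^sub>1\<^sup>\<alpha> z\<^sub>2\<^sup>\<beta> \<psi>(z\<^sub>2/z\<^sub>1)\<close> and the operator series is \<open>A(z\<^sub>1) B(z\<^sub>2)\<close> (or the same with
  \<open>z\<^sub>1, z\<^sub>2\<close> exchanged). There only finitely many terms are nonzero: the term of index \<open>k\<close> in \<open>\<psi>\<close> applies
  to the vector a mode of \<open>B\<close> whose index grows with \<open>k\<close>, every vector is a finite sum of
  \<open>L\<^sub>0\<close>-eigenvectors, and the \<open>L\<^sub>0\<close>-eigenvalues of a highest weight module are bounded below.
\<close>

definition series_times ::
    "(complex \<Rightarrow> 'v::ab_group_add \<Rightarrow> 'v) \<Rightarrow> (rat \<Rightarrow> rat \<Rightarrow> rat) \<Rightarrow> (rat \<Rightarrow> rat \<Rightarrow> 'v \<Rightarrow> 'v) \<Rightarrow>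
     rat \<Rightarrow> rat \<Rightarrow> 'v \<Rightarrow> 'v" where
  "series_times scale F \<Phi> a b v =
     Sum_any (\<lambda>(i, j). scale (of_rat (F i j)) (\<Phi> (a - i) (b - j) v))"


section \<open>Coefficient functions\<close>

text \<open>Here \<open>t = p'/p\<close>, with \<open>q\<close> standing for \<open>p'\<close>, and signs \<open>\<sigma>\<close> are \<open>1\<close> or \<open>-1\<close>.\<close>

definition tparam :: "int \<Rightarrow> int \<Rightarrow> rat" where
  "tparam p q = of_int q / of_int p"

definition rho :: "rat \<Rightarrow> int \<Rightarrow> int \<Rightarrow> rat" where
  "rho t r s = of_int r * t - of_int s"

definition lam :: "rat \<Rightarrow> int \<Rightarrow> int \<Rightarrow> int \<Rightarrow> rat" where
  "lam t \<sigma> r s = t / 4 + of_int \<sigma> * rho t r s / 2"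

text \<open>The power series of \<open>(1 - z)\<^sup>a\<close>.\<close>

definition one_minus_powr :: "rat \<Rightarrow> rat fps" where
  "one_minus_powr a = fps_compose (fps_binomial a) (- fps_X)"

text \<open>
  The power series \<open>ycheck_fps\<close> is \<open>z\<^bsup>\<lambda>\<^esup>\<close> times the function \<open>ycheck\<close>, where \<open>\<lambda>\<close> is \<open>lam\<close>.
\<close>

definition ycheck_fps :: "rat \<Rightarrow> int \<Rightarrow> int \<Rightarrow> int \<Rightarrow> rat fps" where
  "ycheck_fps t \<sigma> r s =
     fps_const ((rho t r s + of_int \<sigma> * (t - 1)) / (2 * rho t r s)) *
     one_minus_powr (3 * t / 2 - 1) *
     fps_hypergeo [t - 1, t - 1 - of_int \<sigma> * rho t r s] [1 - of_int \<sigma> * rho t r s] 1"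

definition ycheck :: "rat \<Rightarrow> int \<Rightarrow> int \<Rightarrow> int \<Rightarrow> rat \<Rightarrow> rat" where
  "ycheck t \<sigma> r s = shifted_fps (- lam t \<sigma> r s) (ycheck_fps t \<sigma> r s)"

definition Kcoeff :: "rat \<Rightarrow> nat \<Rightarrow> rat" where
  "Kcoeff a n = (\<Prod>j<n. (a + of_nat j) / (2 * a + of_nat j))"

definition fcoeff :: "int \<Rightarrow> int \<Rightarrow> int \<Rightarrow> int \<Rightarrow> int \<Rightarrow> rat \<Rightarrow> rat \<Rightarrow> rat" where
  "fcoeff p q \<sigma> r s =
    (let t = tparam p q in
     if 2 \<le> r \<and> r \<le> p - 2 then
       monom_mult (delta21 t - 1) (delta21 t)
         (ratio_series (shifted_fps (- lam t \<sigma> r s) (one_minus_powr (- 1) * ycheck_fps t \<sigma> r s)))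
     else if r = 1 \<and> \<sigma> = 1 then
       monom_mult (3 * (t - 1) / 2 + of_int s / 2 - 1) ((of_int s - 1) / 2)
         (ratio_series (shifted_fps 0
            (fps_const (Kcoeff (1 - t) (nat (s - 1))) * one_minus_powr (- 2 + 3 * t / 2))))
     else if r = p - 1 \<and> \<sigma> = - 1 then
       monom_mult (3 * (t - 1) / 2 + of_int (q - s) / 2 - 1) (of_int (q - s - 1) / 2)
         (ratio_series (shifted_fps 0
            (fps_const (Kcoeff (1 - t) (nat (q - s - 1))) * one_minus_powr (- 2 + 3 * t / 2))))
     else (\<lambda>a b. 0))"

definition gcoeff :: "int \<Rightarrow> int \<Rightarrow> int \<Rightarrow> int \<Rightarrow> int \<Rightarrow> rat \<Rightarrow> rat \<Rightarrow> rat" where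
  "gcoeff p q \<sigma> r s =
    (let t = tparam p q in
     if 2 \<le> r \<and> r \<le> p - 2 then
       monom_mult (delta21 t) (delta21 t) (ratio_series (euler_op (ycheck t \<sigma> r s)))
     else (\<lambda>a b. 0))"

definition hcoeff :: "int \<Rightarrow> int \<Rightarrow> int \<Rightarrow> int \<Rightarrow> int \<Rightarrow> rat \<Rightarrow> rat \<Rightarrow> rat" where
  "hcoeff p q \<sigma> r s =
    (let t = tparam p q; \<beta> = (t - 1) / 2 - of_int \<sigma> * rho t r s / 2 in
     monom_mult (\<beta> - t / 2) \<beta> (ratio_series (shifted_fps 0 (one_minus_powr (- t / 2)))))"

text \<open>The signs \<open>\<sigma>\<close> for which the module with first index \<open>r + \<sigma>\<close> is present.\<close>

definition channels :: "int \<Rightarrow> int \<Rightarrow> int set" where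
  "channels p r = {\<sigma> \<in> {1, - 1}. 1 \<le> r + \<sigma> \<and> r + \<sigma> \<le> p - 1}"

end

theory Submission
  imports Defs
begin

text \<open>
  A family of operators that is closed under commutators with the \<open>L\<^sub>n\<close>, up to coefficients of
  Laurent polynomials, and that kills the highest weight vector in the degree of the top
  component, vanishes: a lowest nonzero value on the highest weight vector would be singular, and
  the common kernel is a submodule. This applies to the differences of the two sides of the
  relations. In (i) and (ii) the two differences form one family, since the series \<open>f\<close> and \<open>g\<close>
  together solve a first order system equivalent to the hypergeometric equation. The commutators
  involve only symmetric Laurent polynomials, so the symmetrized products satisfy the same system
  as the delta functions on the right. What remains are matrix elements between highest weight
  vectors. They are determined by the level two null vector
  \<open>(\<partial>\<^sup>2 - t T)\<phi> = 0\<close>, which holds because its components are singular vectors. For generic \<open>r\<close>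
  the sum over the two channels is a bilinear pairing of solutions of two dual second order
  equations, which is rational.
\<close>

section \<open>Power series\<close>

text \<open>Between highest weight vectors every product is the expansion in z = z_2/z_1 of a
  rational function, and its exchanged partner is expanded in 1/z; a simple pole at z = 1 therefore
  leaves a delta function in the sum of the two. The coefficient functions are made to produce these
  rational functions: 1/(1 - z) in (i) and -\<Delta>_{2,1} (1 + z)/(1 - z) in (ii) for generic r,
  the constant 1 in (iii), and K P(z)/(1 - z) for r = 1 and r = p - 1 in (i), where P is a
  palindromic polynomial and K is the inverse of P(1). The obstacle is the generic case, where each
  channel contributes a product of two infinite series and only the sum is simple. The four products
  of the solutions and their Euler derivatives form a first order system that depends on \<rho> only
  through \<rho>^2, so both channels solve the same system. Since \<rho> is not an integer, a
  solution is fixed by its constant terms, and comparison with an explicit rational solution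
  suffices.\<close>

lemma fps_const_simps_rat:
  fixes a b :: rat
  shows "fps_const (a + b) = fps_const a + fps_const b"
    "fps_const (a - b) = fps_const a - fps_const b"
    "fps_const (a * b) = fps_const a * fps_const b"
    "fps_const (- a) = - fps_const a"
    "fps_const (a ^ m) = fps_const a ^ m"
    "fps_const (numeral k) = numeral k"
  by (simp_all add: fps_const_power fps_numeral_fps_const)

section \<open>The Euler operator z d/dz and the series z/(1 - z)\<close>

definition theta :: "rat fps \<Rightarrow> rat fps" where
  "theta f = fps_X * fps_deriv f"

lemma theta_nth [simp]: "fps_nth (theta f) n = of_nat n * fps_nth f n"
  by (cases n) (simp_all add: theta_def)

lemma theta_simps [simp]:
  "theta (f + g) = theta f + theta g" "theta (f - g) = theta f - theta g"
  "theta (- f) = - theta f" "theta (fps_const c) = 0" "theta 1 = 0" "theta 0 = 0"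
  "theta (numeral k) = 0"
  by (simp_all add: theta_def algebra_simps)

lemma theta_mult: "theta (f * g) = theta f * g + f * theta g"
  by (simp add: theta_def algebra_simps)

lemma theta_const_mult [simp]: "theta (fps_const c * f) = fps_const c * theta f"
  by (simp add: theta_mult)

text \<open>The series \<open>z / (1 - z)\<close>; all differential equations below have coefficients polynomial in it.\<close>

definition geom :: "rat fps" where
  "geom = Abs_fps (\<lambda>n. if n = 0 then 0 else 1)"

lemma geom_nth: "fps_nth geom n = (if n = 0 then 0 else 1)"
  by (simp add: geom_def)

lemma geom_eq: "fps_X * (1 + geom) = geom"
proof (rule fps_ext)
  fix n show "fps_nth (fps_X * (1 + geom)) n = fps_nth geom n"
    by (cases n) (simp_all add: geom_nth)
qed

lemma one_minus_X_geom: "(1 - fps_X) * (1 + geom) = 1"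
  using geom_eq by (simp add: algebra_simps)

lemma theta_geom: "theta geom = geom + geom * geom"
proof -
  have "theta ((1 - fps_X) * (1 + geom)) = 0"
    by (simp add: one_minus_X_geom)
  moreover have "theta (1 - fps_X) = - fps_X"
    by (simp add: theta_def)
  ultimately have "(1 - fps_X) * theta geom = fps_X * (1 + geom)"
    by (simp add: theta_mult)
  then have "(1 + geom) * ((1 - fps_X) * theta geom) = (1 + geom) * geom"
    by (simp add: geom_eq)
  then show ?thesis
    by (metis (no_types) one_minus_X_geom mult.assoc mult.commute mult_1 distrib_right)
qed

text \<open>Read off from \<open>theta_geom\<close>: the square of \<open>geom\<close> is its Euler
  derivative minus itself.\<close>

lemma geom_sq_nth: "fps_nth (geom * geom) n = (if n = 0 then 0 else of_nat n - 1)"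
proof -
  have "fps_nth (geom * geom) n = fps_nth (theta geom - geom) n"
    by (simp only: theta_geom) simp
  then show ?thesis by (simp add: geom_nth)
qed

lemma fps_mult_geom_nth: "fps_nth (f * geom) n = (\<Sum>m<n. fps_nth f m)"
proof -
  have "fps_nth (f * geom) n = (\<Sum>m=0..n. fps_nth f m * (if n - m = 0 then 0 else 1))"
    by (simp add: fps_mult_nth geom_nth)
  also have "\<dots> = (\<Sum>m<n. fps_nth f m)"
    by (rule sum.mono_neutral_cong_right) (auto)
  finally show ?thesis .
qed

lemma fps_mult_geom_sq_nth:
  "fps_nth (f * (geom * geom)) n = (\<Sum>m<n. (of_nat (n - m) - 1) * fps_nth f m)"
proof -
  have "fps_nth (f * (geom * geom)) n
      = (\<Sum>m=0..n. fps_nth f m * (if n - m = 0 then 0 else of_nat (n - m) - 1))"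
    unfolding fps_mult_nth[of f] geom_sq_nth ..
  also have "\<dots> = (\<Sum>m<n. (of_nat (n - m) - 1) * fps_nth f m)"
    by (rule sum.mono_neutral_cong_right) (auto)
  finally show ?thesis .
qed

section \<open>Powers of 1 - z and the hypergeometric equation\<close>

lemma one_minus_powr_nth: "fps_nth (one_minus_powr a) n = (-1) ^ n * (a gchoose n)"
  using fps_compose_linear[of "fps_binomial a" "-1"]
  by (simp add: one_minus_powr_def flip: fps_const_neg)

lemma one_minus_powr_nth_0 [simp]: "fps_nth (one_minus_powr a) 0 = 1"
  by (simp add: one_minus_powr_nth)

lemma one_minus_powr_0 [simp]: "one_minus_powr 0 = 1"
  by (simp add: one_minus_powr_def)

lemma one_minus_powr_add: "one_minus_powr (a + b) = one_minus_powr a * one_minus_powr b"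
  by (simp add: one_minus_powr_def fps_binomial_add_mult fps_compose_mult_distrib)

lemma one_minus_powr_1: "one_minus_powr 1 = 1 - fps_X"
  by (simp add: one_minus_powr_def fps_binomial_1 fps_compose_add_distrib)

lemma one_minus_powr_minus_1: "one_minus_powr (-1) = 1 + geom"
proof -
  have "one_minus_powr (-1) * one_minus_powr 1 = 1"
    by (simp flip: one_minus_powr_add)
  then have "one_minus_powr (-1) * ((1 - fps_X) * (1 + geom)) = 1 + geom"
    by (simp add: one_minus_powr_1 flip: mult.assoc)
  then show ?thesis by (simp add: one_minus_X_geom)
qed

lemma theta_one_minus_powr:
  "theta (one_minus_powr a) = - (fps_const a * geom * one_minus_powr a)"
proof -
  have "fps_deriv (one_minus_powr a) = - (fps_deriv (fps_binomial a) oo - fps_X)"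
    by (simp add: one_minus_powr_def fps_compose_deriv)
  moreover have "(1 + fps_X) * fps_deriv (fps_binomial a) = fps_const a * fps_binomial a"
    by (simp add: fps_binomial_deriv fps_divide_unit flip: mult.assoc)
      (simp add: mult.assoc inverse_mult_eq_1' mult.left_commute)
  then have "((1 + fps_X) * fps_deriv (fps_binomial a)) oo - fps_X
      = (fps_const a * fps_binomial a) oo - fps_X" by simp
  then have "(1 - fps_X) * (fps_deriv (fps_binomial a) oo - fps_X) = fps_const a * one_minus_powr a"
    by (simp add: one_minus_powr_def fps_compose_mult_distrib fps_compose_add_distrib)
  ultimately have *: "(1 - fps_X) * fps_deriv (one_minus_powr a) = - (fps_const a * one_minus_powr a)"
    by simp
  \<comment> \<open>Insert 1 = (1 - z)(1 + \<open>geom\<close>): one factor clears the denominator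
    of the derivative, the other turns z into \<open>geom\<close>.\<close>
  have "theta (one_minus_powr a)
      = (fps_X * (1 + geom)) * ((1 - fps_X) * fps_deriv (one_minus_powr a))"
    using one_minus_X_geom unfolding theta_def by (metis mult.assoc mult.commute mult.right_neutral)
  then show ?thesis
    unfolding * geom_eq by simp
qed

text \<open>Assuming only the recursion of the coefficients makes this cover both the Gauss series
  in \<open>ycheck_fps\<close> and the terminating series \<open>palin_fps\<close>. The recursion
  says (theta + c - 1) theta F = z (theta + a)(theta + b) F.\<close>

lemma theta_hypergeo_rec:
  assumes rec: "\<And>n. of_nat (Suc n) * (c + of_nat n) * fps_nth F (Suc n)
      = (a + of_nat n) * (b + of_nat n) * fps_nth F n"
  shows "theta (theta F) = (fps_const (a + b - c + 1) * geom - fps_const (c - 1)) * theta F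
    + fps_const (a * b) * geom * F"
proof -
  have "theta (theta F) + fps_const (c - 1) * theta F
      = fps_X * (theta (theta F) + fps_const (a + b) * theta F + fps_const (a * b) * F)" (is "?l = fps_X * ?r")
  proof (rule fps_ext)
    fix n show "fps_nth ?l n = fps_nth (fps_X * ?r) n"
    proof (cases n)
      case (Suc m)
      have "fps_nth ?l (Suc m) = of_nat (Suc m) * (c + of_nat m) * fps_nth F (Suc m)"
        by simp (simp add: algebra_simps)
      also have "\<dots> = fps_nth (fps_X * ?r) (Suc m)"
        unfolding rec by simp (simp add: algebra_simps)
      finally show ?thesis by (simp only: Suc)
    qed simp
  qed
  \<comment> \<open>Multiplying by 1/(1 - z) isolates the second derivative: it gets the factor 1 +
    \<open>geom\<close> on the left and \<open>geom\<close> on the right.\<close>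
  then have "(1 + geom) * ?l = (fps_X * (1 + geom)) * ?r"
    by (simp only: mult_ac)
  then have "(1 + geom) * ?l = geom * ?r" by (simp only: geom_eq)
  then show ?thesis
    by (simp add: algebra_simps flip: fps_const_add fps_const_sub)
qed

lemma hypergeo_2_1_rec:
  fixes a b c :: rat
  assumes "\<And>n. c + of_nat n \<noteq> 0"
  shows "of_nat (Suc n) * (c + of_nat n) * fps_nth (fps_hypergeo [a, b] [c] 1) (Suc n)
      = (a + of_nat n) * (b + of_nat n) * fps_nth (fps_hypergeo [a, b] [c] 1) n"
  by (subst fps_hypergeo_rec)
    (use assms[of n] in \<open>simp add: divide_simps del: of_nat_Suc fps_hypergeo_nth\<close>)

section \<open>The recursion for two-point functions\<close>

text \<open>
  This is the null vector equation for the two-point function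
  \<open>\<langle>h\<^sub>2| \<psi>(z\<^sub>1) \<phi>(z\<^sub>2) |h\<rangle> \<propto> U(z\<^sub>2/z\<^sub>1)\<close> through the weight \<open>h\<^sub>1\<close>, where
  \<open>\<tau> = 2 (h\<^sub>1 - h - \<Delta>) + t - 1\<close> and \<open>\<eta> = h\<^sub>2 - h\<^sub>1 - \<Delta>\<close>.
\<close>

definition bpz_rec :: "rat \<Rightarrow> rat \<Rightarrow> rat \<Rightarrow> rat fps \<Rightarrow> bool" where
  "bpz_rec t \<tau> \<eta> U \<longleftrightarrow> fps_nth U 0 = 1 \<and>
     (\<forall>k. of_nat k * (of_nat k + \<tau>) * fps_nth U k =
        - t * (\<Sum>m<k. (\<eta> - of_nat m + (1 - of_nat (k - m)) * delta21 t) * fps_nth U m))"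

text \<open>The weights 1 and k - m - 1 of the convolution are the coefficients of
  \<open>geom\<close> and of its square. The recursion thus is a second order equation with regular
  singular points 0, 1 and infinity, and exponents 0 and -\<tau> at 0.\<close>

lemma bpz_rec_iff_ode:
  "bpz_rec t \<tau> \<eta> U \<longleftrightarrow> fps_nth U 0 = 1 \<and>
     theta (theta U) + fps_const \<tau> * theta U =
       - fps_const t * ((fps_const \<eta> * U - theta U) * geom - fps_const (delta21 t) * (U * (geom * geom)))"
proof -
  let ?l = "theta (theta U) + fps_const \<tau> * theta U"
  let ?r = "- fps_const t * ((fps_const \<eta> * U - theta U) * geom - fps_const (delta21 t) * (U * (geom * geom)))"
  have "fps_nth ?l k = of_nat k * (of_nat k + \<tau>) * fps_nth U k" for k
    by (simp add: algebra_simps)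
  moreover have "fps_nth ?r k =
      - t * (\<Sum>m<k. (\<eta> - of_nat m + (1 - of_nat (k - m)) * delta21 t) * fps_nth U m)" for k
  proof -
    have "fps_nth ?r k = - t * (fps_nth ((fps_const \<eta> * U - theta U) * geom) k
        - delta21 t * fps_nth (U * (geom * geom)) k)"
      by (simp only: fps_const_neg fps_mult_left_const_nth fps_sub_nth)
    also have "fps_nth ((fps_const \<eta> * U - theta U) * geom) k = (\<Sum>m<k. (\<eta> - of_nat m) * fps_nth U m)"
      unfolding fps_mult_geom_nth by (simp add: algebra_simps)
    finally show ?thesis
      unfolding fps_mult_geom_sq_nth
      by (simp add: sum_distrib_left algebra_simps flip: sum_subtractf)
  qed
  ultimately show ?thesis
    unfolding bpz_rec_def fps_eq_iff by (simp only:)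
qed

fun bpz_coeff :: "rat \<Rightarrow> rat \<Rightarrow> rat \<Rightarrow> nat \<Rightarrow> rat" where
  "bpz_coeff t \<tau> \<eta> k = (if k = 0 then 1 else
     - t * (\<Sum>m<k. (\<eta> - of_nat m + (1 - of_nat (k - m)) * delta21 t) * bpz_coeff t \<tau> \<eta> m)
       / (of_nat k * (of_nat k + \<tau>)))"

declare bpz_coeff.simps [simp del]

text \<open>No k + \<tau> vanishes, so every coefficient can be solved for. For generic r this
  existence replaces a closed form of the two-point function.\<close>

lemma bpz_rec_exists:
  assumes "\<tau> \<notin> \<int>"
  shows "bpz_rec t \<tau> \<eta> (Abs_fps (bpz_coeff t \<tau> \<eta>))"
proof -
  have nz: "of_nat k + \<tau> \<noteq> 0" for k :: nat
    using assms by (metis Ints_minus Ints_of_nat add.inverse_unique)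
  have "of_nat k * (of_nat k + \<tau>) * bpz_coeff t \<tau> \<eta> k =
      - t * (\<Sum>m<k. (\<eta> - of_nat m + (1 - of_nat (k - m)) * delta21 t) * bpz_coeff t \<tau> \<eta> m)" for k
    using nz[of k] by (subst bpz_coeff.simps) (cases "k = 0"; simp)
  then show ?thesis
    by (simp add: bpz_rec_def bpz_coeff.simps[of _ _ _ 0])
qed

text \<open>Doubling clears denominators: \<open>delta21\<close> and the other constants then enter
  through relations such as 2 D = 3 T - 1 with T = t/2. Constants are split into atoms by
  \<open>fps_const_simps_rat\<close>, against the default rules, which merge them; a polynomial
  identity remains.\<close>

lemma double_cancel: "2 * x = 2 * y \<Longrightarrow> x = (y :: rat fps)"
  by simp

text \<open>\<open>\<eta> = (\<tau> + 1) / 2\<close> is the case of two fields shifting r by the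
  same sign. The solution is then a pure power of 1 - z, and h in (iii) contains its
  inverse.\<close>

lemma bpz_rec_one_minus_powr:
  "bpz_rec t \<tau> ((\<tau> + 1) / 2) (one_minus_powr (t / 2))"
proof -
  define U where "U = one_minus_powr (t / 2)"
  define T R D E g where "T = fps_const (t / 2)" and "R = fps_const \<tau>"
    and "D = fps_const (delta21 t)" and "E = fps_const ((\<tau> + 1) / 2)" and "g = geom"
  have U1: "theta U = - (T * g * U)"
    by (simp add: U_def T_def g_def theta_one_minus_powr)
  have T0: "theta T = 0" by (simp add: T_def)
  have U2: "theta (theta U) = - (T * ((g + g * g) * U + g * theta U))"
    unfolding U1 by (simp add: theta_mult T0 theta_geom g_def algebra_simps U1[unfolded g_def])
  have t: "fps_const t = 2 * T"
    unfolding T_def by (simp flip: fps_const_simps_rat(6))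
  have D: "2 * D = 3 * T - 1"
  proof -
    have "fps_const (2 * delta21 t) = fps_const (3 * (t / 2) - 1)"
      by (rule arg_cong[where f = fps_const]) (simp add: delta21_def field_simps)
    then show ?thesis
      by (simp only: fps_const_simps_rat D_def T_def fps_const_1_eq_1)
  qed
  have E: "2 * E = R + 1"
  proof -
    have "fps_const (2 * ((\<tau> + 1) / 2)) = fps_const (\<tau> + 1)"
      by (rule arg_cong[where f = fps_const]) simp
    then show ?thesis
      by (simp only: fps_const_simps_rat E_def R_def fps_const_1_eq_1)
  qed
  have "2 * (theta (theta U) + R * theta U) = 2 * (- (2 * T) * ((E * U - theta U) * g - D * (U * (g * g))))"
  proof -
    have "2 * (- (2 * T) * ((E * U - theta U) * g - D * (U * (g * g))))
      = - (2 * T) * ((2 * E * U - 2 * theta U) * g - 2 * D * (U * (g * g)))"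
      by (simp add: algebra_simps)
    then show ?thesis
      unfolding E D U2 unfolding U1 by algebra
  qed
  then have "theta (theta U) + R * theta U = - (2 * T) * ((E * U - theta U) * g - D * (U * (g * g)))"
    by (rule double_cancel)
  then show ?thesis
    unfolding bpz_rec_iff_ode by (simp add: U_def R_def E_def D_def g_def t)
qed

text \<open>The terminating series \<open>F(-n, b, 1 - n - b; z)\<close>, written so that its symmetry is visible.\<close>

definition palin_fps :: "rat \<Rightarrow> nat \<Rightarrow> rat fps" where
  "palin_fps b n = Abs_fps (\<lambda>k. of_nat (n choose k) * pochhammer b k * pochhammer b (n - k) / pochhammer b n)"

lemma palin_fps_nth:
  "fps_nth (palin_fps b n) k = of_nat (n choose k) * pochhammer b k * pochhammer b (n - k) / pochhammer b n"
  by (simp add: palin_fps_def)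

lemma palin_fps_sym: "k \<le> n \<Longrightarrow> fps_nth (palin_fps b n) (n - k) = fps_nth (palin_fps b n) k"
  by (simp add: palin_fps_nth binomial_symmetric[of k n])

text \<open>The parameters are -n, b and 1 - n - b. The recursion survives past the degree: at k = n
  the factor k - n vanishes, beyond it the binomial coefficients do.\<close>

lemma palin_fps_rec:
  "of_nat (Suc k) * (1 - of_nat n - b + of_nat k) * fps_nth (palin_fps b n) (Suc k)
    = (- of_nat n + of_nat k) * (b + of_nat k) * fps_nth (palin_fps b n) k"
proof (cases "k < n")
  case True
  then obtain m where m: "n = Suc (k + m)" by (metis less_imp_Suc_add)
  have 1: "Suc k * (n choose Suc k) = (n - k) * (n choose k)"
    using True by (metis binomial_absorb_comp binomial_absorption diff_Suc_1 not_less_zero old.nat.exhaust)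
  define y where "y = b + of_nat n - of_nat k - 1"
  have 2: "pochhammer b (n - k) = pochhammer b (n - Suc k) * y"
    using m by (simp add: pochhammer_Suc y_def)
  have 3: "1 - of_nat n - b + of_nat k = - y"
    by (simp add: y_def)
  have "of_nat (Suc k) * (1 - of_nat n - b + of_nat k) * fps_nth (palin_fps b n) (Suc k)
     = of_nat (Suc k * (n choose Suc k)) * (b + of_nat k) * pochhammer b k * (1 - of_nat n - b + of_nat k)
         * pochhammer b (n - Suc k) / pochhammer b n"
    by (simp add: palin_fps_nth pochhammer_Suc del: of_nat_Suc mult_Suc)
  also have "\<dots> = - of_nat (n - k) * of_nat (n choose k) * (b + of_nat k) * pochhammer b k *
         pochhammer b (n - k) / pochhammer b n"
    unfolding 1 2 3 by (simp add: mult_ac)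
  finally show ?thesis
    using True by (simp add: palin_fps_nth of_nat_diff mult_ac)
next
  case False
  then have "k = n \<or> n < k" by auto
  then show ?thesis by (auto simp add: palin_fps_nth binomial_eq_0)
qed

text \<open>Evaluation at z = 1 by the Vandermonde convolution of Pochhammer symbols. The inverse of
  the result is \<open>Kcoeff b n\<close>, which is the origin of that constant.\<close>

lemma sum_palin_fps:
  assumes "m \<ge> n"
  shows "(\<Sum>k\<le>m. fps_nth (palin_fps b n) k) = pochhammer (2 * b) n / pochhammer b n"
proof -
  have "(\<Sum>k\<le>m. fps_nth (palin_fps b n) k) = (\<Sum>k\<le>n. fps_nth (palin_fps b n) k)"
    using assms by (intro sum.mono_neutral_right) (auto simp: palin_fps_nth)
  also have "\<dots> = pochhammer (b + b) n / pochhammer b n"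
    unfolding pochhammer_binomial_sum by (simp add: palin_fps_nth sum_divide_distrib)
  finally show ?thesis unfolding mult_2 .
qed

text \<open>This \<eta> belongs to a second field leading back to the initial module. The exponent 1
  - 3t/2 equals -2 \<Delta>_{2,1}, the singularity of two fields fusing to the identity. What
  remains after splitting it off is a Gauss series with parameters -n, 1 - t and t - n, which
  terminates.\<close>

lemma bpz_rec_palin_fps:
  assumes "pochhammer (1 - t) n \<noteq> 0"
  defines "\<tau> \<equiv> t - 1 - of_nat n"
  shows "bpz_rec t \<tau> (- (t / 4 + \<tau> / 2) - delta21 t)
    (one_minus_powr (1 - 3 * t / 2) * palin_fps (1 - t) n)"
proof -
  define P where "P = palin_fps (1 - t) n"
  define W where "W = one_minus_powr (1 - 3 * t / 2)"
  define T R D E g where "T = fps_const (t / 2)" and "R = fps_const \<tau>"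
    and "D = fps_const (delta21 t)" and "E = fps_const (- (t / 4 + \<tau> / 2) - delta21 t)" and "g = geom"
  have t: "fps_const t = 2 * T"
    unfolding T_def by (simp flip: fps_const_simps_rat(6))
  have "fps_const (2 * delta21 t) = fps_const (3 * (t / 2) - 1)"
    by (rule arg_cong[where f = fps_const]) (simp add: delta21_def field_simps)
  then have D: "2 * D = 3 * T - 1"
    by (simp only: fps_const_simps_rat D_def T_def fps_const_1_eq_1)
  have "fps_const (2 * (- (t / 4 + \<tau> / 2) - delta21 t)) = fps_const (- (t / 2) - \<tau> - 2 * delta21 t)"
    by (rule arg_cong[where f = fps_const]) (simp add: field_simps)
  then have E: "2 * E = - T - R - 2 * D"
    by (simp only: fps_const_simps_rat E_def R_def T_def D_def)
  have W1: "theta W = - ((1 - 3 * T) * g * W)"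
  proof -
    have "fps_const (1 - 3 * t / 2) = fps_const (1 - 3 * (t / 2))" by simp
    then have "fps_const (1 - 3 * t / 2) = 1 - 3 * T"
      by (simp only: fps_const_simps_rat fps_const_1_eq_1 T_def)
    then show ?thesis
      by (simp add: W_def g_def theta_one_minus_powr)
  qed
  have W2: "theta (theta W) = - (1 - 3 * T) * ((g + g * g) * W + g * theta W)"
  proof -
    have "theta (1 - 3 * T) = 0" by (simp add: T_def theta_mult)
    then show ?thesis
      unfolding W1 by (simp only: theta_simps theta_mult theta_geom[folded g_def] W1) (simp add: algebra_simps)
  qed
  \<comment> \<open>Express n through \<tau>, so that only the atoms T and R occur.\<close>
  have c: "1 - of_nat n - (1 - t) - 1 = \<tau>" "- of_nat n + (1 - t) - (1 - of_nat n - (1 - t)) + 1 = 2 - 4 * (t / 2)"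
      "- of_nat n * (1 - t) = (t - 1 - \<tau>) * (2 * (t / 2) - 1)"
    by (simp_all add: \<tau>_def algebra_simps)
  have "theta (theta P) = (fps_const (2 - 4 * (t / 2)) * g - fps_const \<tau>) * theta P
      + fps_const ((2 * (t / 2) - 1 - \<tau>) * (2 * (t / 2) - 1)) * g * P"
    using theta_hypergeo_rec[OF palin_fps_rec[of _ n "1 - t"]] unfolding c P_def g_def by simp
  then have P2: "theta (theta P) = ((2 - 4 * T) * g - R) * theta P + ((2 * T - 1 - R) * (2 * T - 1)) * g * P"
    by (simp only: fps_const_simps_rat fps_const_1_eq_1 T_def R_def)
  have U1: "theta (W * P) = theta W * P + W * theta P"
    by (rule theta_mult)
  have U2: "theta (theta (W * P)) = theta (theta W) * P + 2 * theta W * theta P + W * theta (theta P)"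
    unfolding U1 by (simp add: theta_mult)
  have "2 * (theta (theta (W * P)) + R * theta (W * P))
      = 2 * (- (2 * T) * ((E * (W * P) - theta (W * P)) * g - D * (W * P * (g * g))))"
  proof -
    have "2 * (- (2 * T) * ((E * (W * P) - theta (W * P)) * g - D * (W * P * (g * g))))
      = - (2 * T) * ((2 * E * (W * P) - 2 * theta (W * P)) * g - 2 * D * (W * P * (g * g)))"
      by (simp add: algebra_simps)
    then show ?thesis
      unfolding E D unfolding U2 unfolding U1 unfolding W2 P2 unfolding W1 by (simp add: algebra_simps)
  qed
  then have "theta (theta (W * P)) + R * theta (W * P)
      = - (2 * T) * ((E * (W * P) - theta (W * P)) * g - D * (W * P * (g * g)))"
    by (rule double_cancel)
  moreover have "fps_nth (W * P) 0 = 1"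
    using assms(1) by (simp add: W_def P_def palin_fps_nth)
  ultimately show ?thesis
    unfolding bpz_rec_iff_ode unfolding P_def W_def R_def E_def D_def g_def t by simp
qed

definition icoeff :: "rat fps \<Rightarrow> int \<Rightarrow> rat" where
  "icoeff f m = (if m < 0 then 0 else fps_nth f (nat m))"

lemma Kcoeff_eq: "Kcoeff b n = pochhammer b n / pochhammer (2 * b) n"
  unfolding Kcoeff_def pochhammer_prod prod_dividef by (simp add: atLeast0LessThan)

text \<open>Division of a palindromic polynomial by 1 - z gives its partial sums. Reflection turns
  the partial sum up to n - 1 - m into the tail beyond m, so both add up to the value at 1,
  normalized by \<open>Kcoeff\<close>. Outside the range 0, ..., n - 1 one term is 0 and the other
  the full sum; hence the extension by 0 in \<open>icoeff\<close>.\<close>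

lemma icoeff_palin_fps:
  fixes m :: int
  assumes "pochhammer b n \<noteq> 0" and "pochhammer (2 * b) n \<noteq> 0"
  defines "G \<equiv> fps_const (Kcoeff b n) * (1 + geom) * palin_fps b n"
  shows "icoeff G m + icoeff G (int n - 1 - m) = 1"
proof -
  let ?P = "fps_nth (palin_fps b n)"
  have G: "fps_nth G k = Kcoeff b n * (\<Sum>i\<le>k. ?P i)" for k
  proof -
    have "G = fps_const (Kcoeff b n) * (palin_fps b n + palin_fps b n * geom)"
      by (simp add: G_def algebra_simps)
    then have "fps_nth G k = Kcoeff b n * (?P k + fps_nth (palin_fps b n * geom) k)"
      by (simp only: fps_mult_left_const_nth fps_add_nth)
    then show ?thesis
      by (simp add: fps_mult_geom_nth lessThan_Suc_atMost[symmetric])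
  qed
  have K: "Kcoeff b n * (\<Sum>i\<le>k. ?P i) = 1" if "k \<ge> n" for k
    using that assms by (simp add: sum_palin_fps Kcoeff_eq)
  consider "m < 0" | "m \<ge> int n" | "0 \<le> m" "m < int n" by linarith
  then show ?thesis
  proof cases
    case 3
    define k where "k = nat m"
    have k: "m = int k" "k < n" using 3 by (auto simp: k_def)
    have "(\<Sum>i\<le>n - 1 - k. ?P i) = (\<Sum>i\<in>{Suc k..n}. ?P i)"
      by (rule sum.reindex_bij_witness[of _ "\<lambda>i. n - i" "\<lambda>i. n - i"])
        (use k palin_fps_sym[of _ n b] in auto)
    moreover have "{..n} = {..k} \<union> {Suc k..n}" "{..k} \<inter> {Suc k..n} = {}"
      using k by auto
    ultimately have "(\<Sum>i\<le>k. ?P i) + (\<Sum>i\<le>n - 1 - k. ?P i) = (\<Sum>i\<le>n. ?P i)"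
      by (simp add: sum.union_disjoint)
    then have "fps_nth G k + fps_nth G (n - 1 - k) = 1"
      using K[of n] by (simp add: G flip: distrib_left)
    moreover have "nat (int n - 1 - m) = n - 1 - k" using k by auto
    ultimately show ?thesis using k by (simp add: icoeff_def)
  qed (auto simp: icoeff_def G K)
qed

section \<open>The hypergeometric case\<close>

text \<open>
  For solutions \<open>y'\<close>, \<open>y\<close> of the dual equations, the products \<open>S = y' y\<close>, \<open>X = (\<theta>y') y\<close>,
  \<open>Z = y' \<theta>y\<close>, \<open>Q = (\<theta>y') (\<theta>y)\<close> solve this system, where \<open>T = t/4\<close> and \<open>b = R\<^sup>2 - T\<^sup>2\<close> with
  \<open>R = \<rho>/2\<close>. Its only resonances are at \<open>n = 0\<close> and \<open>n = \<plusminus>2R\<close>, whence uniqueness.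
\<close>

definition dual_system :: "rat \<Rightarrow> rat \<Rightarrow> rat fps \<Rightarrow> rat fps \<Rightarrow> rat fps \<Rightarrow> rat fps \<Rightarrow> bool" where
  "dual_system T b S X Z Q \<longleftrightarrow>
     theta S = X + Z \<and>
     theta X = - fps_const (2 * T) * (X + 2 * (X * geom))
       + fps_const b * S - fps_const ((6 * T - 1) * (2 - 2 * T)) * (S * geom + S * (geom * geom)) + Q \<and>
     theta Z = fps_const (2 * T) * (Z + 2 * (Z * geom))
       + fps_const b * S + fps_const (2 * T * (6 * T - 1)) * (S * geom + S * (geom * geom)) + Q \<and>
     theta Q = fps_const b * (X + Z) - fps_const ((6 * T - 1) * (2 - 2 * T)) * (Z * geom + Z * (geom * geom))
       + fps_const (2 * T * (6 * T - 1)) * (X * geom + X * (geom * geom))"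

lemma dual_system_add:
  assumes "dual_system T b S X Z Q" and "dual_system T b S' X' Z' Q'"
  shows "dual_system T b (S + S') (X + X') (Z + Z') (Q + Q')"
  using assms unfolding dual_system_def theta_simps
  by (elim conjE, intro conjI) (simp_all only:, simp_all add: algebra_simps)

lemma dual_system_diff:
  assumes "dual_system T b S X Z Q" and "dual_system T b S' X' Z' Q'"
  shows "dual_system T b (S - S') (X - X') (Z - Z') (Q - Q')"
  using assms unfolding dual_system_def theta_simps
  by (elim conjE, intro conjI) (simp_all only:, simp_all add: algebra_simps)

lemma fps_mult_const_double_nth: "fps_nth (fps_const c * (f + 2 * h)) n = c * (fps_nth f n + 2 * fps_nth h n)"
  for c :: rat
  by (simp only: mult_2 fps_mult_left_const_nth fps_add_nth)

text \<open>As \<open>geom\<close> has no constant term, its products involve only lower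
  coefficients at level n. Once these vanish, a homogeneous linear system in four unknowns is
  left.\<close>

lemma dual_system_zero:
  assumes sys: "dual_system T (R\<^sup>2 - T\<^sup>2) S X Z Q"
    and R: "2 * R \<notin> \<int>"
    and zero: "fps_nth S 0 = 0" "fps_nth X 0 = 0" "fps_nth Z 0 = 0" "fps_nth Q 0 = 0"
  shows "S = 0 \<and> X = 0"
proof -
  have "fps_nth S n = 0 \<and> fps_nth X n = 0 \<and> fps_nth Z n = 0 \<and> fps_nth Q n = 0" for n
  proof (induction n rule: less_induct)
    case (less n)
    show ?case
    proof (cases "n = 0")
      case False
      have low: "fps_nth (f * geom) n = 0" "fps_nth (f * (geom * geom)) n = 0"
        if "f \<in> {S, X, Z, Q}" for f
        unfolding fps_mult_geom_nth fps_mult_geom_sq_nth using that less by auto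
      have low2: "fps_nth (2 * (f * geom)) n = 0" if "f \<in> {S, X, Z, Q}" for f
        unfolding mult_2 fps_add_nth using low(1)[OF that] by simp
      define N where "N = (of_nat n :: rat)"
      define b where "b = R\<^sup>2 - T\<^sup>2"
      note eqs = sys[unfolded dual_system_def, folded b_def]
      have eqs': "N * fps_nth S n = fps_nth X n + fps_nth Z n"
        "N * fps_nth X n = - (2 * T) * fps_nth X n + b * fps_nth S n + fps_nth Q n"
        "N * fps_nth Z n = 2 * T * fps_nth Z n + b * fps_nth S n + fps_nth Q n"
        "N * fps_nth Q n = b * (fps_nth X n + fps_nth Z n)"
        using arg_cong[OF conjunct1[OF eqs], of "\<lambda>f. fps_nth f n"]
          arg_cong[OF conjunct1[OF conjunct2[OF eqs]], of "\<lambda>f. fps_nth f n"]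
          arg_cong[OF conjunct1[OF conjunct2[OF conjunct2[OF eqs]]], of "\<lambda>f. fps_nth f n"]
          arg_cong[OF conjunct2[OF conjunct2[OF conjunct2[OF eqs]]], of "\<lambda>f. fps_nth f n"]
        unfolding theta_nth N_def[symmetric]
        by (simp_all add: low low2 fps_mult_const_double_nth del: fps_const_mult fps_const_sub fps_const_neg fps_const_add
            flip: fps_const_neg)
      have N: "N \<noteq> 0" using False by (simp add: N_def)
      have NR: "N\<^sup>2 \<noteq> (2 * R)\<^sup>2"
      proof
        assume "N\<^sup>2 = (2 * R)\<^sup>2"
        then have "2 * R = N \<or> 2 * R = - N" by (metis minus_minus power2_eq_iff)
        then show False using R by (auto simp: N_def)
      qed
      define s x z q where "s = fps_nth S n" and "x = fps_nth X n" and "z = fps_nth Z n" and "q = fps_nth Q n"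
      note e = eqs'[folded s_def x_def z_def q_def]
      \<comment> \<open>Dividing by the level N expresses q and x - z through s and leaves N^2 s =
        (2R)^2 s. This breaks down at level 0, whence the hypotheses on the constant terms.\<close>
      have "N * q = b * (N * s)" unfolding e(1) by (rule e(4))
      then have "N * q = N * (b * s)" by (simp only: mult.left_commute)
      then have q: "q = b * s" using N by simp
      have "N * (x - z) = - 2 * T * (N * s)"
        unfolding e(1) using e(2,3) by (simp add: algebra_simps)
      then have "N * (x - z) = N * (- 2 * T * s)" by (simp only: mult_ac)
      then have xz: "x - z = - 2 * T * s" using N by (metis mult_left_cancel)
      have "N * (N * s) = - (2 * T) * (x - z) + 4 * b * s"
        unfolding e(1) using e(2,3) by (simp add: algebra_simps q)
      then have "N\<^sup>2 * s = (2 * R)\<^sup>2 * s"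
        unfolding xz b_def by (simp add: algebra_simps power2_eq_square)
      then have s: "s = 0" using NR by simp
      then show ?thesis
        using xz q e(1) by (simp add: s_def x_def z_def q_def)
    qed (use zero in simp)
  qed
  then show ?thesis by (simp add: fps_eq_iff)
qed

text \<open>For S = 1 the first equation gives Z = -X, the difference of the next two integrates to
  X up to a constant, and their sum yields Q. As (6T - 1)/2 is \<Delta>_{2,1}, X is -\<Delta>_{2,1}
  (1 + z)/(1 - z).\<close>

lemma dual_system_solution:
  "dual_system T b 1 (- fps_const ((6 * T - 1) / 2) * (1 + 2 * geom)) (fps_const ((6 * T - 1) / 2) * (1 + 2 * geom))
     (- fps_const (T * (6 * T - 1) + b) - fps_const ((6 * T - 1)\<^sup>2) * (geom + geom * geom))"
proof -
  define D where "D = fps_const ((6 * T - 1) / 2)"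
  define t where "t = fps_const T"
  define g where "g = geom"
  define c where "c = fps_const b"
  have "fps_const (6 * T - 1) = fps_const (2 * ((6 * T - 1) / 2))"
    by (rule arg_cong[where f = fps_const]) simp
  then have "fps_const (6 * T - 1) = 2 * D"
    by (simp only: fps_const_simps_rat(3,6) D_def)
  then have D2: "6 * t - 1 = 2 * D"
    by (simp only: fps_const_simps_rat fps_const_1_eq_1 t_def)
  have [simp]: "theta D = 0" "theta t = 0" by (simp_all add: D_def t_def)
  have tg: "theta (1 + 2 * g) = 2 * (g + g * g)" "theta (g + g * g) = (1 + 2 * g) * (g + g * g)"
    unfolding g_def by (simp_all add: theta_mult theta_geom algebra_simps)
  have "fps_const (T * (6 * T - 1) + b) = t * (2 * D) + c" "fps_const ((6 * T - 1)\<^sup>2) = (2 * D) * (2 * D)"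
    "fps_const ((6 * T - 1) * (2 - 2 * T)) = (2 * D) * (2 - 2 * t)"
    "fps_const (2 * T * (6 * T - 1)) = 2 * t * (2 * D)" "fps_const (2 * T) = 2 * t"
    by (simp_all only: power2_eq_square fps_const_simps_rat fps_const_1_eq_1 D2 c_def[symmetric] t_def[symmetric])
  note ceqs = this D_def[symmetric] c_def[symmetric] g_def[symmetric]
  show ?thesis
    unfolding dual_system_def ceqs
  proof (intro conjI)
    show "theta 1 = - D * (1 + 2 * g) + D * (1 + 2 * g)" by simp
    show "theta (- D * (1 + 2 * g)) = - (2 * t) * (- D * (1 + 2 * g) + 2 * (- D * (1 + 2 * g) * g))
        + c * 1 - 2 * D * (2 - 2 * t) * (1 * g + 1 * (g * g)) + (- (t * (2 * D) + c) - 2 * D * (2 * D) * (g + g * g))"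
      unfolding theta_mult[of "- D"] tg using D2 by (simp, algebra)
    show "theta (D * (1 + 2 * g)) = 2 * t * (D * (1 + 2 * g) + 2 * (D * (1 + 2 * g) * g)) + c * 1
        + 2 * t * (2 * D) * (1 * g + 1 * (g * g)) + (- (t * (2 * D) + c) - 2 * D * (2 * D) * (g + g * g))"
      unfolding theta_mult[of D] tg using D2 by (simp, algebra)
    have tQ: "theta (- (t * (2 * D) + c) - 2 * D * (2 * D) * (g + g * g)) = - 4 * D * D * ((1 + 2 * g) * (g + g * g))"
    proof -
      have "theta (2 * D * (2 * D) * u) = 2 * D * (2 * D) * theta u" for u
        by (simp add: theta_mult)
      moreover have "theta (- (t * (2 * D) + c)) = 0" by (simp add: theta_mult c_def)
      ultimately show ?thesis
        by (simp only: theta_simps(2) tg(2)) (simp add: mult.assoc)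
    qed
    show "theta (- (t * (2 * D) + c) - 2 * D * (2 * D) * (g + g * g)) =
        c * (- D * (1 + 2 * g) + D * (1 + 2 * g)) - 2 * D * (2 - 2 * t) * (D * (1 + 2 * g) * g + D * (1 + 2 * g) * (g * g))
        + 2 * t * (2 * D) * (- D * (1 + 2 * g) * g + - D * (1 + 2 * g) * (g * g))"
      unfolding tQ by (simp add: algebra_simps)
  qed
qed

text \<open>\<open>Y1\<close> and \<open>U1\<close> are the Euler derivatives of z^(-\<lambda>) Y
  and z^\<lambda> U, stripped of the fractional powers, which cancel in the products. The two second
  order equations are dual in that their first order terms are opposite.\<close>

lemma ycheck_system:
  fixes t :: rat and r s \<sigma> :: int
  assumes \<sigma>: "\<sigma> \<in> {1, - 1}" and \<rho>: "rho t r s \<notin> \<int>"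
    and U: "bpz_rec t (of_int \<sigma> * rho t r s) (- lam t \<sigma> r s - delta21 t) U"
  defines "R \<equiv> of_int \<sigma> * rho t r s / 2" and "T \<equiv> t / 4"
  defines "Y \<equiv> ycheck_fps t \<sigma> r s"
  defines "Y1 \<equiv> theta Y - fps_const (lam t \<sigma> r s) * Y"
    and "U1 \<equiv> theta U + fps_const (lam t \<sigma> r s) * U"
  shows "theta Y1 = fps_const (lam t \<sigma> r s) * Y1 - fps_const (2 * T) * (Y1 + 2 * (Y1 * geom))
       + fps_const (R\<^sup>2 - T\<^sup>2) * Y - fps_const ((6 * T - 1) * (2 - 2 * T)) * (Y * geom + Y * (geom * geom))" (is ?Y)
    and "dual_system T (R\<^sup>2 - T\<^sup>2) (Y * U) (Y1 * U) (Y * U1) (Y1 * U1)" (is ?S)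
proof -
  define F where "F = fps_hypergeo [t - 1, t - 1 - 2 * R] [1 - 2 * R] 1"
  define W where "W = one_minus_powr (3 * t / 2 - 1)"
  define k where "k = fps_const ((rho t r s + of_int \<sigma> * (t - 1)) / (2 * rho t r s))"
  have lam: "lam t \<sigma> r s = T + R" by (simp add: lam_def T_def R_def)
  have Y: "Y = k * W * F"
    by (simp add: Y_def ycheck_fps_def k_def W_def F_def R_def)
  define g x y l b where "g = geom" and "x = fps_const T" and "y = fps_const R" and "l = x + y" and "b = y * y - x * x"
  have [simp]: "theta k = 0" "theta x = 0" "theta y = 0" "theta l = 0" by (simp_all add: k_def x_def y_def l_def)
  have "theta W = - (fps_const (6 * T - 1) * geom * W)"
    unfolding W_def theta_one_minus_powr by (simp add: T_def)
  then have W1: "theta W = (1 - 6 * x) * (g * W)"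
    by (simp only: fps_const_simps_rat fps_const_1_eq_1 x_def g_def) (simp add: algebra_simps)
  have W2: "theta (theta W) = (1 - 6 * x) * ((g + g * g) * W + g * theta W)"
    unfolding W1 by (simp only: theta_simps theta_mult[of "1 - 6 * x"] theta_mult[of 6] theta_mult[of g] \<open>theta x = 0\<close>
        theta_geom[folded g_def] W1) simp
  have F2: "theta (theta F) = (fps_const (8 * T - 2) * g + fps_const (2 * R)) * theta F
     + fps_const ((4 * T - 1) * (4 * T - 1 - 2 * R)) * g * F"
  proof -
    have nz: "1 - 2 * R + of_nat n \<noteq> 0" for n
    proof
      assume "1 - 2 * R + of_nat n = 0"
      then have "of_int \<sigma> * rho t r s = of_nat n + 1" by (simp add: R_def)
      then have "rho t r s = of_int \<sigma> * (of_nat n + 1)" using \<sigma> by auto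
      then have "rho t r s \<in> \<int>" by (auto intro: Ints_mult Ints_add)
      then show False using \<rho> by contradiction
    qed
    have c: "t - 1 + (t - 1 - 2 * R) - (1 - 2 * R) + 1 = 8 * T - 2" "1 - 2 * R - 1 = - (2 * R)"
      "(t - 1) * (t - 1 - 2 * R) = (4 * T - 1) * (4 * T - 1 - 2 * R)"
      by (simp_all add: T_def)
    show ?thesis
      using theta_hypergeo_rec[OF hypergeo_2_1_rec[where a = "t - 1" and b = "t - 1 - 2 * R", OF nz], folded F_def]
      unfolding c g_def by simp
  qed
  then have F2: "theta (theta F) = ((8 * x - 2) * g + 2 * y) * theta F + (4 * x - 1) * (4 * x - 1 - 2 * y) * (g * F)"
    by (simp only: fps_const_simps_rat fps_const_1_eq_1 x_def y_def mult.assoc)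
  have Y1: "Y1 = theta Y - l * Y" by (simp add: Y1_def lam l_def x_def y_def fps_const_simps_rat del: fps_const_add)
  have U1: "U1 = theta U + l * U" by (simp add: U1_def lam l_def x_def y_def fps_const_simps_rat del: fps_const_add)
  have tY: "theta Y = k * (theta W * F + W * theta F)"
    unfolding Y by (simp add: theta_mult mult.assoc)
  have ttY: "theta (theta Y) = k * (theta (theta W) * F + 2 * theta W * theta F + W * theta (theta F))"
    unfolding tY by (simp add: theta_mult algebra_simps)
  have "theta Y1 = theta (theta Y) - l * theta Y"
    unfolding Y1 by (simp add: theta_mult)
  also have "\<dots> = l * Y1 - 2 * x * (Y1 + 2 * (Y1 * g)) + b * Y - (6 * x - 1) * (2 - 2 * x) * (Y * g + Y * (g * g))"
    unfolding Y1 ttY F2 W2 unfolding tY W1 unfolding Y l_def b_def by (simp add: algebra_simps)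
  finally have tY1: "theta Y1 = l * Y1 - 2 * x * (Y1 + 2 * (Y1 * g)) + b * Y - (6 * x - 1) * (2 - 2 * x) * (Y * g + Y * (g * g))" .
  have ceqs: "fps_const (lam t \<sigma> r s) = l" "fps_const (2 * T) = 2 * x" "fps_const (R\<^sup>2 - T\<^sup>2) = b"
    "fps_const ((6 * T - 1) * (2 - 2 * T)) = (6 * x - 1) * (2 - 2 * x)"
    "fps_const (2 * T * (6 * T - 1)) = 2 * x * (6 * x - 1)"
    unfolding lam power2_eq_square l_def b_def x_def y_def
    by (simp_all only: fps_const_simps_rat fps_const_1_eq_1)
  show ?Y
    unfolding ceqs g_def[symmetric] by (rule tY1)
  have "theta (theta U) + fps_const (of_int \<sigma> * rho t r s) * theta U =
       - fps_const t * ((fps_const (- lam t \<sigma> r s - delta21 t) * U - theta U) * geom - fps_const (delta21 t) * (U * (geom * geom)))"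
    using U unfolding bpz_rec_iff_ode by blast
  also have "of_int \<sigma> * rho t r s = 2 * R" by (simp add: R_def)
  finally have "theta (theta U) + fps_const (2 * R) * theta U =
     fps_const (4 * T * (T + R) + 2 * T * (6 * T - 1)) * (U * geom) + fps_const (4 * T) * (theta U * geom)
       + fps_const (2 * T * (6 * T - 1)) * (U * (geom * geom))"
  proof -
    have c: "t = 4 * T" "4 * T * (T + R) + 2 * T * (6 * T - 1) = - t * (- (T + R) - delta21 t)"
      "2 * T * (6 * T - 1) = t * delta21 t"
      by (simp_all add: T_def delta21_def field_simps)
    assume "theta (theta U) + fps_const (2 * R) * theta U =
       - fps_const t * ((fps_const (- lam t \<sigma> r s - delta21 t) * U - theta U) * geom - fps_const (delta21 t) * (U * (geom * geom)))"
    moreover define X where "X = fps_const (- lam t \<sigma> r s - delta21 t)"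
    moreover have "fps_const (4 * T * (T + R) + 2 * T * (6 * T - 1)) = - fps_const t * X"
      unfolding c(2) X_def lam by (simp only: fps_const_simps_rat(3,4))
    moreover have "fps_const (2 * T * (6 * T - 1)) = fps_const t * fps_const (delta21 t)"
      unfolding c(3) by (rule fps_const_simps_rat(3))
    moreover have "fps_const (4 * T) = fps_const t" by (simp add: T_def)
    ultimately show ?thesis
      by (simp add: algebra_simps del: fps_const_mult fps_const_neg)
  qed
  then have "theta (theta U) + 2 * y * theta U =
     (4 * x * l + 2 * x * (6 * x - 1)) * (U * g) + 4 * x * (theta U * g) + 2 * x * (6 * x - 1) * (U * (g * g))"
    by (simp only: fps_const_simps_rat fps_const_1_eq_1 x_def y_def g_def l_def)
  then have ttU: "theta (theta U) = - (2 * y * theta U) +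
     (4 * x * l + 2 * x * (6 * x - 1)) * (U * g) + 4 * x * (theta U * g) + 2 * x * (6 * x - 1) * (U * (g * g))"
    by (simp add: algebra_simps eq_neg_iff_add_eq_0)
  have tU1: "theta U1 = - (l * U1) + 2 * x * (U1 + 2 * (U1 * g)) + b * U + 2 * x * (6 * x - 1) * (U * g + U * (g * g))"
  proof -
    have "theta U1 = theta (theta U) + l * theta U" unfolding U1 by (simp add: theta_mult)
    then show ?thesis
      unfolding ttU U1 l_def b_def by (simp add: algebra_simps)
  qed
  have tY': "theta Y = Y1 + l * Y" and tU': "theta U = U1 - l * U"
    by (simp_all add: Y1 U1)
  show ?S
    unfolding dual_system_def ceqs g_def[symmetric] theta_mult tY1 tU1 tY' tU'
    by (intro conjI) (simp_all add: algebra_simps)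
qed

text \<open>The system sees the sign only through R^2, so the sum over both channels solves it and
  has to match the rational solution only in the constant terms. The prefactors in
  \<open>ycheck_fps\<close> are made for this: they add up to 1, and weighted with -\<lambda> to
  -\<Delta>_{2,1}.\<close>

lemma ycheck_pairing:
  fixes t :: rat and r s :: int
  assumes \<rho>: "rho t r s \<notin> \<int>"
    and U: "\<And>\<sigma>. \<sigma> \<in> {1, - 1} \<Longrightarrow> bpz_rec t (of_int \<sigma> * rho t r s) (- lam t \<sigma> r s - delta21 t) (U \<sigma>)"
  shows "(\<Sum>\<sigma>\<in>{1,-1}. ycheck_fps t \<sigma> r s * U \<sigma>) = 1"
    and "(\<Sum>\<sigma>\<in>{1,-1}. (theta (ycheck_fps t \<sigma> r s) - fps_const (lam t \<sigma> r s) * ycheck_fps t \<sigma> r s) * U \<sigma>)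
       = - fps_const (delta21 t) * (1 + 2 * geom)"
proof -
  define Y where "Y \<sigma> = ycheck_fps t \<sigma> r s" for \<sigma>
  define Y1 where "Y1 \<sigma> = theta (Y \<sigma>) - fps_const (lam t \<sigma> r s) * Y \<sigma>" for \<sigma>
  define U1 where "U1 \<sigma> = theta (U \<sigma>) + fps_const (lam t \<sigma> r s) * U \<sigma>" for \<sigma>
  define T R where "T = t / 4" and "R = rho t r s / 2"
  have \<rho>0: "rho t r s \<noteq> 0" using \<rho> by auto
  have sq: "(of_int \<sigma> * rho t r s / 2)\<^sup>2 = R\<^sup>2" if "\<sigma> \<in> {1, - 1}" for \<sigma> :: int
    using that by (auto simp: R_def power2_eq_square)
  have sys: "dual_system T (R\<^sup>2 - T\<^sup>2) (Y \<sigma> * U \<sigma>) (Y1 \<sigma> * U \<sigma>) (Y \<sigma> * U1 \<sigma>) (Y1 \<sigma> * U1 \<sigma>)"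
    if "\<sigma> \<in> {1, - 1}" for \<sigma>
    using ycheck_system(2)[OF that \<rho> U[OF that]] unfolding sq[OF that]
    by (simp only: T_def Y_def Y1_def U1_def)
  have sum: "dual_system T (R\<^sup>2 - T\<^sup>2) (Y 1 * U 1 + Y (-1) * U (-1)) (Y1 1 * U 1 + Y1 (-1) * U (-1))
     (Y 1 * U1 1 + Y (-1) * U1 (-1)) (Y1 1 * U1 1 + Y1 (-1) * U1 (-1))"
    by (rule dual_system_add) (simp_all add: sys)
  have U0: "fps_nth (U \<sigma>) 0 = 1" if "\<sigma> \<in> {1, - 1}" for \<sigma>
    using U[OF that] by (simp add: bpz_rec_def)
  have Y0: "fps_nth (Y \<sigma>) 0 = (rho t r s + of_int \<sigma> * (t - 1)) / (2 * rho t r s)" for \<sigma>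
    by (simp add: Y_def ycheck_fps_def)
  have Y10: "fps_nth (Y1 \<sigma>) 0 = - lam t \<sigma> r s * fps_nth (Y \<sigma>) 0" for \<sigma>
    by (simp add: Y1_def)
  have U10: "fps_nth (U1 \<sigma>) 0 = lam t \<sigma> r s" if "\<sigma> \<in> {1, - 1}" for \<sigma>
    by (simp add: U1_def U0[OF that])
  note diff = dual_system_diff[OF sum dual_system_solution]
  have "2 * R \<notin> \<int>" using \<rho> by (simp add: R_def)
  note zero = dual_system_zero[OF diff this]
  have D: "(6 * T - 1) / 2 = delta21 t" by (simp add: T_def delta21_def field_simps)
  have fin: "Y 1 * U 1 + Y (-1) * U (-1) - 1 = 0 \<and>
      Y1 1 * U 1 + Y1 (-1) * U (-1) - - fps_const ((6 * T - 1) / 2) * (1 + 2 * geom) = 0"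
    by (rule zero)
      (use \<rho>0 in \<open>simp_all add: U0 U10 Y10 Y0 T_def R_def lam_def geom_nth field_simps power2_eq_square\<close>)
  from fin show "(\<Sum>\<sigma>\<in>{1,-1}. ycheck_fps t \<sigma> r s * U \<sigma>) = 1"
    by (simp add: Y_def)
  from fin show "(\<Sum>\<sigma>\<in>{1,-1}. (theta (ycheck_fps t \<sigma> r s) - fps_const (lam t \<sigma> r s) * ycheck_fps t \<sigma> r s) * U \<sigma>)
       = - fps_const (delta21 t) * (1 + 2 * geom)"
    unfolding D by (simp add: Y_def Y1_def)
qed

section \<open>Highest weight modules\<close>

lemma linear_between_in: "linear_between sc V W T \<Longrightarrow> v \<in> V \<Longrightarrow> T v \<in> W"
  and linear_between_add: "linear_between sc V W T \<Longrightarrow> u \<in> V \<Longrightarrow> v \<in> V \<Longrightarrow> T (u + v) = T u + T v"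
  and linear_between_scale: "linear_between sc V W T \<Longrightarrow> v \<in> V \<Longrightarrow> T (sc a v) = sc a (T v)"
  by (auto simp: linear_between_def)

locale complex_vs = vector_space scale for scale :: "complex \<Rightarrow> 'v::ab_group_add \<Rightarrow> 'v"
begin

text \<open>All coefficients are rational; hiding their embedding into the complex scalars lets the
  simplifier compute with rational numbers.\<close>

definition qs :: "rat \<Rightarrow> 'v \<Rightarrow> 'v" where
  "qs q v = scale (of_rat q) v"

lemma qs_simps [simp]: "qs 0 v = 0" "qs q 0 = 0" "qs 1 v = v" "qs a (qs b v) = qs (a * b) v"
    "qs (- a) v = - qs a v" "qs a (- v) = - qs a v"
  by (simp_all add: qs_def of_rat_mult of_rat_minus)

lemma qs_left_distrib: "qs (a + b) v = qs a v + qs b v"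
  and qs_left_diff: "qs (a - b) v = qs a v - qs b v"
  and qs_right_distrib: "qs a (u + v) = qs a u + qs a v"
  and qs_right_diff: "qs a (u - v) = qs a u - qs a v"
  by (simp_all add: qs_def of_rat_add of_rat_diff algebra_simps)

lemmas qs_distribs = qs_left_distrib qs_left_diff qs_right_distrib qs_right_diff

lemma qs_sum_right: "qs a (\<Sum>i\<in>I. f i) = (\<Sum>i\<in>I. qs a (f i))"
  by (simp add: qs_def scale_sum_right)

lemma qs_sum_left: "qs (\<Sum>i\<in>I. f i) v = (\<Sum>i\<in>I. qs (f i) v)"
  by (simp add: qs_def of_rat_sum scale_sum_left)

lemma qs_eq_0_iff [simp]: "qs a v = 0 \<longleftrightarrow> a = 0 \<or> v = 0"
  by (simp add: qs_def)

lemma qs_scale: "qs q (scale a v) = scale a (qs q v)"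
  by (simp add: qs_def mult.commute)

lemma subspace_qs: "subspace V \<Longrightarrow> v \<in> V \<Longrightarrow> qs a v \<in> V"
  by (simp add: qs_def subspace_scale)

lemma linear_between_zero: "subspace V \<Longrightarrow> linear_between scale V W T \<Longrightarrow> T 0 = 0"
  using linear_between_scale[of scale V W T 0 0] subspace_0 by simp

lemma linear_between_qs: "linear_between scale V W T \<Longrightarrow> v \<in> V \<Longrightarrow> T (qs a v) = qs a (T v)"
  by (simp add: qs_def linear_between_scale)

lemma linear_between_neg:
  "subspace V \<Longrightarrow> linear_between scale V W T \<Longrightarrow> v \<in> V \<Longrightarrow> T (- v) = - T v"
  using linear_between_scale[of scale V W T v "-1"] by simp

lemma linear_between_diff:
  "subspace V \<Longrightarrow> linear_between scale V W T \<Longrightarrow> u \<in> V \<Longrightarrow> v \<in> V \<Longrightarrow> T (u - v) = T u - T v"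
  using linear_between_add[of scale V W T u "- v"] linear_between_neg[of V W T v]
  by (simp add: subspace_neg)

lemma linear_between_sum:
  assumes "subspace V" "linear_between scale V W T" "\<And>i. i \<in> I \<Longrightarrow> f i \<in> V"
  shows "T (\<Sum>i\<in>I. f i) = (\<Sum>i\<in>I. T (f i))"
  using assms(3)
proof (induction I rule: infinite_finite_induct)
  case (insert x F)
  then show ?case
    by (simp add: linear_between_add[OF assms(2)] subspace_sum[OF assms(1)])
qed (simp_all add: linear_between_zero[OF assms(1,2)])

end

locale vir_mod = complex_vs +
  fixes c :: rat and V :: "'a set" and L :: "int \<Rightarrow> 'a \<Rightarrow> 'a"
  assumes virasoro: "virasoro_module scale c V L"
begin

abbreviation ws where "ws \<equiv> weight_space scale V L"

lemma subspace_V: "subspace V"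
  and L_linear: "linear_between scale V V (L n)"
  using virasoro by (auto simp: virasoro_module_def)

lemmas V_closed = subspace_0[OF subspace_V] subspace_add[OF subspace_V] subspace_diff[OF subspace_V]
  subspace_neg[OF subspace_V] subspace_sum[OF subspace_V] subspace_scale[OF subspace_V] subspace_qs[OF subspace_V]

lemmas L_in = linear_between_in[OF L_linear]
lemmas L_add = linear_between_add[OF L_linear]
lemmas L_scale = linear_between_scale[OF L_linear]
lemmas L_zero = linear_between_zero[OF subspace_V L_linear]
lemmas L_qs = linear_between_qs[OF L_linear]
lemmas L_diff = linear_between_diff[OF subspace_V L_linear]
lemmas L_sum = linear_between_sum[OF subspace_V L_linear]

lemma L_comm:
  assumes "v \<in> V"
  shows "L m (L n v) = L n (L m v) + qs (of_int (m - n)) (L (m + n) v) +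
     qs (c / 12 * of_int (m * (m\<^sup>2 - 1)) * (if m + n = 0 then 1 else 0)) v"
  using virasoro assms unfolding virasoro_module_def qs_def of_rat_of_int_eq
  by (simp add: algebra_simps)

lemma ws_iff: "v \<in> ws d \<longleftrightarrow> v \<in> V \<and> L 0 v = qs d v"
  by (auto simp: weight_space_def qs_def)

lemma ws_V: "v \<in> ws d \<Longrightarrow> v \<in> V"
  by (simp add: ws_iff)

lemma subspace_ws: "subspace (ws d)"
  unfolding subspace_def
  by (auto simp: ws_iff V_closed L_zero L_add L_scale qs_distribs qs_scale)

lemma L_ws:
  assumes "v \<in> ws d" shows "L n v \<in> ws (d - of_int n)"
proof -
  have v: "v \<in> V" "L 0 v = qs d v" using assms by (auto simp: ws_iff)
  have "L 0 (L n v) = L n (L 0 v) + qs (of_int (- n)) (L n v)"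
    using L_comm[OF v(1), of 0 n] by simp
  also have "\<dots> = qs (d - of_int n) (L n v)"
    by (simp add: v L_qs qs_left_diff)
  finally show ?thesis by (simp add: ws_iff v L_in)
qed

lemma ws_independent:
  assumes "finite I" and "inj_on wt I" and "\<And>i. i \<in> I \<Longrightarrow> g i \<in> ws (wt i)" and "(\<Sum>i\<in>I. g i) = 0"
  shows "\<forall>i\<in>I. g i = 0"
  using assms
proof (induction I arbitrary: g rule: finite_induct)
  case (insert j I)
  have gV: "g i \<in> V" "L 0 (g i) = qs (wt i) (g i)" if "i \<in> insert j I" for i
    using insert.prems(2)[OF that] by (auto simp: ws_iff)
  \<comment> \<open>L_0 minus the weight of j kills the summand j and multiplies the others by
    nonzero numbers.\<close>
  have "L 0 (\<Sum>i\<in>insert j I. g i) - qs (wt j) (\<Sum>i\<in>insert j I. g i) = 0"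
    by (simp only: insert.prems L_zero) simp
  also have "L 0 (\<Sum>i\<in>insert j I. g i) = (\<Sum>i\<in>insert j I. qs (wt i) (g i))"
    by (subst L_sum) (use gV in auto)
  finally have "(\<Sum>i\<in>insert j I. qs (wt i - wt j) (g i)) = 0"
    by (simp add: qs_sum_right sum_subtractf qs_distribs)
  then have "(\<Sum>i\<in>I. qs (wt i - wt j) (g i)) = 0"
    using insert.hyps by simp
  moreover have "qs (wt i - wt j) (g i) \<in> ws (wt i)" if "i \<in> I" for i
    using that insert.prems(2) by (intro subspace_qs[OF subspace_ws]) auto
  ultimately have "\<forall>i\<in>I. qs (wt i - wt j) (g i) = 0"
    using insert.prems(1) by (intro insert.IH) auto
  then have "\<forall>i\<in>I. g i = 0"
    using insert.prems(1) insert.hyps(2) by (auto simp: inj_on_def)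
  then show ?case
    using insert.prems(3) insert.hyps by simp
qed simp

section \<open>Submodules generated by singular vectors\<close>

inductive descends :: "'a \<Rightarrow> nat \<Rightarrow> 'a \<Rightarrow> bool" for x where
  descends_base: "descends x 0 x"
| descends_step: "descends x k y \<Longrightarrow> n > 0 \<Longrightarrow> descends x (k + n) (L (- int n) y)"

text \<open>The monomials in \<open>descends\<close> come in any order: only their weights and the
  closure of their span matter.\<close>

definition gen :: "'a \<Rightarrow> 'a set" where
  "gen x = span {y. \<exists>k. descends x k y}"

lemma descends_ws: "descends x k y \<Longrightarrow> x \<in> ws d \<Longrightarrow> y \<in> ws (d + of_nat k)"
proof (induction rule: descends.induct)
  case (descends_step k y n)
  then show ?case using L_ws[of y "d + of_nat k" "- int n"] by (simp add: add.assoc)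
qed simp

lemma descends_gen: "descends x k y \<Longrightarrow> y \<in> gen x"
  unfolding gen_def by (rule span_base) auto

lemma gen_V:
  assumes "x \<in> ws d" "y \<in> gen x" shows "y \<in> V"
proof -
  have "{y. \<exists>k. descends x k y} \<subseteq> V" using descends_ws[OF _ assms(1)] ws_V by blast
  then have "gen x \<subseteq> V" unfolding gen_def by (rule span_minimal) (rule subspace_V)
  then show ?thesis using assms(2) by blast
qed

lemma subspace_gen: "subspace (gen x)"
  by (simp add: gen_def)

lemmas gen_closed = subspace_add[OF subspace_gen] subspace_qs[OF subspace_gen] subspace_0[OF subspace_gen]

lemma L_gen_extend:
  assumes x: "x \<in> ws d" and m: "\<And>k y. descends x k y \<Longrightarrow> L m y \<in> gen x" and y: "y \<in> gen x"
  shows "L m y \<in> gen x"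
proof -
  define S where "S = {y \<in> V. L m y \<in> gen x}"
  have "subspace S"
    unfolding S_def subspace_def
    by (auto simp: V_closed L_zero L_add L_scale gen_closed subspace_scale[OF subspace_gen])
  moreover have "{y. \<exists>k. descends x k y} \<subseteq> S"
    unfolding S_def using m descends_ws[OF _ x] ws_V by blast
  ultimately have "gen x \<subseteq> S" unfolding gen_def by (intro span_minimal)
  then show ?thesis using y by (auto simp: S_def)
qed

text \<open>A mode moved to the right past the lowering modes finally reaches x, which the positive
  modes kill; the commutators are modes applied to shorter monomials.\<close>

lemma L_gen:
  assumes x: "x \<in> ws d" and sing: "\<And>n. n > 0 \<Longrightarrow> L n x = 0" and y: "y \<in> gen x"
  shows "L m y \<in> gen x"
proof -
  have neg: "L m y \<in> gen x" if "m < 0" "y \<in> gen x" for m y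
  proof (rule L_gen_extend[OF x _ that(2)])
    fix k z assume "descends x k z"
    from descends_step[OF this, of "nat (- m)"] that(1) show "L m z \<in> gen x"
      by (auto intro: descends_gen)
  qed
  \<comment> \<open>All m at once, because commuting L_m with L_(-n) brings in L_(m-n).\<close>
  have "\<forall>m. L m z \<in> gen x" if "descends x k z" for k z
    using that
  proof (induction rule: descends.induct)
    case descends_base
    have "x \<in> gen x" by (rule descends_gen) (rule descends.descends_base)
    show ?case
    proof
      fix m show "L m x \<in> gen x"
      proof (cases "m = 0")
        case True
        then show ?thesis using x \<open>x \<in> gen x\<close> by (simp add: ws_iff gen_closed)
      next
        case False
        then show ?thesis using neg[OF _ \<open>x \<in> gen x\<close>, of m] sing[of m] gen_closed by (cases "m < 0") auto
      qed
    qed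
  next
    case (descends_step k y n)
    have y: "y \<in> V" "y \<in> gen x" using descends_step descends_gen gen_V[OF x] by blast+
    show ?case
    proof
      fix m
      have "L (- int n) (L m y) \<in> gen x"
        using neg[of "- int n" "L m y"] descends_step by simp
      then show "L m (L (- int n) y) \<in> gen x"
        unfolding L_comm[OF y(1), of m]
        using descends_step.IH y by (intro gen_closed) auto
    qed
  qed
  then show ?thesis using L_gen_extend[OF x _ y] by blast
qed

lemma submodule_gen:
  assumes "x \<in> ws d" and "\<And>n. n > 0 \<Longrightarrow> L n x = 0"
  shows "virasoro_submodule scale V L (gen x)"
  using L_gen[OF assms] gen_V[OF assms(1)] subspace_gen
  by (auto simp: virasoro_submodule_def)

lemma gen_decompose:
  assumes x: "x \<in> ws d" and v: "v \<in> gen x"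
  obtains K f where "v = (\<Sum>k\<le>K. f k)" "\<And>k. f k \<in> ws (d + of_nat k)"
proof -
  \<comment> \<open>The clause on the indices beyond K allows sums of different lengths to be
    added.\<close>
  let ?P = "\<lambda>v f K. (\<forall>k. f k \<in> ws (d + of_nat k)) \<and> (\<forall>k>K. f k = 0) \<and> v = (\<Sum>k\<le>K. f k)"
  have "\<exists>f K. ?P v f K"
    using v unfolding gen_def
  proof (induction rule: span_induct_alt)
    case base
    show ?case
      by (rule exI[of _ "\<lambda>_. 0"])
        (auto simp: subspace_0[OF subspace_ws])
  next
    case (step a y v)
    then obtain k f K where k: "descends x k y" and f: "?P v f K" by auto
    define g where "g i = (if i = k then scale a y else 0) + f i" for i
    have y: "y \<in> ws (d + of_nat k)" by (rule descends_ws[OF k x])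
    have "(\<Sum>i\<le>K + k. f i) = (\<Sum>i\<le>K. f i)"
      using f by (intro sum.mono_neutral_right) auto
    then have "scale a y + v = (\<Sum>i\<le>K + k. g i)"
      using f by (simp add: g_def sum.distrib)
    moreover have "\<forall>i. g i \<in> ws (d + of_nat i)"
      using f y by (auto simp: g_def intro!: subspace_add[OF subspace_ws] subspace_scale[OF subspace_ws] subspace_0[OF subspace_ws])
    moreover have "\<forall>i>K + k. g i = 0" using f by (auto simp: g_def)
    ultimately show ?case by blast
  qed
  then show ?thesis using that by blast
qed

lemma gen_weight:
  assumes x: "x \<in> ws d" and v: "v \<in> gen x" "v \<in> ws e" and nz: "v \<noteq> 0"
  shows "\<exists>k::nat. e = d + of_nat k"
proof -
  obtain K f where f: "v = (\<Sum>k\<le>K. f k)" "\<And>k. f k \<in> ws (d + of_nat k)"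
    using gen_decompose[OF x v(1)] by blast
  have L0: "L 0 v = (\<Sum>k\<le>K. qs (d + of_nat k) (f k))"
    unfolding f(1) by (subst L_sum) (use f(2) in \<open>auto simp: ws_iff\<close>)
  have "(\<Sum>k\<le>K. qs (d + of_nat k - e) (f k)) = L 0 v - qs e v"
    unfolding L0 by (simp add: f(1) qs_sum_right qs_left_diff sum_subtractf)
  also have "\<dots> = 0" using v(2) by (simp add: ws_iff)
  finally have "\<forall>k\<in>{..K}. qs (d + of_nat k - e) (f k) = 0"
    using f(2) by (intro ws_independent[where wt = "\<lambda>k. d + of_nat k"])
      (auto simp: inj_on_def intro: subspace_qs[OF subspace_ws])
  then have fk: "k \<le> K \<Longrightarrow> e \<noteq> d + of_nat k \<Longrightarrow> f k = 0" for k by auto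
  obtain k where k: "k \<le> K" "f k \<noteq> 0"
    using nz f(1) by (metis atMost_iff sum.neutral)
  then have "e = d + of_nat k" using fk by blast
  then show ?thesis by blast
qed

end

locale irr_hw = complex_vs +
  fixes c h :: rat and V :: "'a set" and L :: "int \<Rightarrow> 'a \<Rightarrow> 'a" and w :: 'a
  assumes irr: "irreducible_highest_weight_module scale c h V L w"
begin

sublocale vir_mod scale c V L
  using irr by unfold_locales (simp add: irreducible_highest_weight_module_def highest_weight_module_def)

lemma w_ws: "w \<in> ws h" and w_nz: "w \<noteq> 0" and L_w: "n > 0 \<Longrightarrow> L n w = 0"
  using irr by (auto simp: irreducible_highest_weight_module_def highest_weight_module_def)

lemma w_V: "w \<in> V" using w_ws by (rule ws_V)

lemma submodule_with_w: "virasoro_submodule scale V L W \<Longrightarrow> w \<in> W \<Longrightarrow> W = V"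
  using irr by (auto simp: irreducible_highest_weight_module_def highest_weight_module_def)

lemma gen_w: "gen w = V"
  by (rule submodule_with_w) (auto intro: submodule_gen w_ws L_w descends_gen descends.descends_base)

lemma decompose:
  assumes "v \<in> V"
  obtains K f where "v = (\<Sum>k\<le>K. f k)" "\<And>k. f k \<in> ws (h + of_nat k)"
  using gen_decompose[OF w_ws, of v] assms gen_w by blast

lemma weight_bound: "v \<in> ws e \<Longrightarrow> v \<noteq> 0 \<Longrightarrow> \<exists>k::nat. e = h + of_nat k"
  using gen_weight[OF w_ws, of v e] gen_w ws_V by blast

text \<open>[L_(n-1), L_1] = (n - 2) L_n reaches all modes from n = 3 on but gives nothing for n =
  2, so L_2 is assumed separately.\<close>

lemma L_pos_zero:
  assumes v: "v \<in> V" and 1: "L 1 v = 0" and 2: "L 2 v = 0" and "n > 0"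
  shows "L n v = 0"
  using \<open>n > 0\<close>
proof (induction "nat n" arbitrary: n rule: less_induct)
  case less
  consider "n = 1" | "n = 2" | "n > 2" using less.prems by linarith
  then show ?case
  proof cases
    case 3
    have "L (n - 1) v = 0" using 3 by (intro less.hyps) auto
    then have "L (n - 1) (L 1 v) = L 1 0 + qs (of_int (n - 2)) (L n v)"
      using L_comm[OF v, of "n - 1" 1] 3 by simp
    then show ?thesis using 1 3 by (simp add: L_zero)
  qed (use 1 2 in auto)
qed

text \<open>A nonzero v would generate the whole module, so h would lie above e by a natural number;
  since e also lies above h by one, e = h.\<close>

lemma singular_zero:
  assumes v: "v \<in> ws e" and e: "e \<noteq> h" and 1: "L 1 v = 0" and 2: "L 2 v = 0"
  shows "v = 0"
proof (rule ccontr)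
  assume nz: "v \<noteq> 0"
  have pos: "L n v = 0" if "n > 0" for n
    by (rule L_pos_zero) (use v 1 2 that ws_V in auto)
  have "v \<in> gen v" by (rule descends_gen) (rule descends.descends_base)
  with nz have "gen v \<noteq> {0}" by auto
  then have "gen v = V"
    using submodule_gen[OF v pos] irr by (auto simp: irreducible_highest_weight_module_def)
  then have "\<exists>k::nat. h = e + of_nat k"
    using gen_weight[OF v, of w h] w_V w_ws w_nz by blast
  moreover have "\<exists>k::nat. e = h + of_nat k" by (rule weight_bound[OF v nz])
  ultimately obtain k l :: nat where "h = h + of_nat (k + l)" "e = h + of_nat k" by auto
  then show False using e by simp
qed

end

section \<open>Null vectors and two-point functions\<close>

lemma (in irr_hw) weight_zero: "v \<in> ws e \<Longrightarrow> (\<And>k::nat. e \<noteq> h + of_nat k) \<Longrightarrow> v = 0"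
  using weight_bound by blast

locale hw_pair = complex_vs scale + S: irr_hw scale c h V L w + T: irr_hw scale c h' V' L' w'
  for scale :: "complex \<Rightarrow> 'v::ab_group_add \<Rightarrow> 'v" and c h V L w h' V' L' w'
begin

text \<open>\<open>comm\<close> encodes the commutators without naming their coefficients:
  [L_n, X_i] is built from members of degree \<open>deg i - n\<close>, so X_i commutes with L_n at v
  as soon as these vanish there. Positive modes lower the degree, hence the induction on the
  level.\<close>

lemma commuting_family_zero:
  fixes X :: "'i \<Rightarrow> 'v \<Rightarrow> 'v" and deg :: "'i \<Rightarrow> rat"
  assumes lin: "\<And>i. linear_between scale V V' (X i)"
    and ws: "\<And>i. X i w \<in> T.ws (h + deg i)"
    and comm: "\<And>i n v. v \<in> V \<Longrightarrow> (\<And>j. deg j = deg i - of_int n \<Longrightarrow> X j v = 0) \<Longrightarrow>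
        L' n (X i v) = X i (L n v)"
    and top: "\<And>i. deg i = h' - h \<Longrightarrow> X i w = 0"
    and v: "v \<in> V"
  shows "X i v = 0"
proof -
  have zero: "X i 0 = 0" for i by (rule linear_between_zero[OF S.subspace_V lin])
  have level: "X i w = 0" if "deg i = h' - h + of_nat k" for i k
    using that
  proof (induction k arbitrary: i rule: less_induct)
    case (less k)
    have pos: "L' (int n) (X i w) = 0" if n: "n > 0" for n
    proof -
      have "X j w = 0" if j: "deg j = deg i - of_int (int n)" for j
      proof (cases "n \<le> k")
        case True
        then show ?thesis
          using less.IH[of "k - n" j] less.prems j n by (simp add: of_nat_diff)
      next
        case False
        then have "(of_nat k :: rat) < of_nat n" by simp
        then have "h + deg j < h'" using j less.prems by simp
        then show ?thesis
          by (intro T.weight_zero[OF ws]) (metis le_add_same_cancel1 not_le of_nat_0_le_iff)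
      qed
      then have "L' (int n) (X i w) = X i (L (int n) w)" by (intro comm S.w_V)
      then show ?thesis using S.L_w[of "int n"] n by (simp add: zero)
    qed
    show ?case
    proof (cases "k = 0")
      case False
      show ?thesis
        by (rule T.singular_zero[OF ws]) (use less.prems False pos[of 1] pos[of 2] in auto)
    qed (use top less.prems in simp)
  qed
  have w: "X i w = 0" for i
    using level[of i] T.weight_zero[OF ws, of i] by (metis add_diff_cancel_left' diff_add_eq group_cancel.add1)
  define N where "N = {v \<in> V. \<forall>i. X i v = 0}"
  have "virasoro_submodule scale V L N"
    unfolding virasoro_submodule_def
  proof (intro conjI allI image_subsetI)
    show "subspace N"
      unfolding subspace_def N_def using lin
      by (auto simp: S.V_closed zero linear_between_add[OF lin] linear_between_scale[OF lin])
  next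
    fix n v assume v: "v \<in> N"
    then have "X i (L n v) = L' n (X i v)" for i
      by (subst comm) (auto simp: N_def)
    then show "L n v \<in> N" using v by (auto simp: N_def S.L_in T.L_zero)
  qed (auto simp: N_def)
  then have "N = V" by (rule S.submodule_with_w) (simp add: N_def S.w_V w)
  then show ?thesis using v by (auto simp: N_def)
qed

end

section \<open>Primary fields and their components on the highest weight vector\<close>

locale field = hw_pair scale c h V L w h' V' L' w'
  for scale :: "complex \<Rightarrow> 'v::ab_group_add \<Rightarrow> 'v" and c h V L w h' V' L' w' +
  fixes \<Delta> :: rat and \<phi> :: "rat \<Rightarrow> 'v \<Rightarrow> 'v"
  assumes primary: "primary_field scale \<Delta> h V L w h' V' L' w' \<phi>"
begin

abbreviation B where "B \<equiv> field_series \<Delta> \<phi>"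

lemma B_linear: "linear_between scale V V' (B e)"
  using primary by (simp add: primary_field_def field_series_def)

lemmas B_in = linear_between_in[OF B_linear]
lemmas B_add = linear_between_add[OF B_linear]
lemmas B_scale = linear_between_scale[OF B_linear]
lemmas B_zero = linear_between_zero[OF S.subspace_V B_linear]
lemmas B_qs = linear_between_qs[OF B_linear]
lemmas B_sum = linear_between_sum[OF S.subspace_V B_linear]

lemma L_B:
  "v \<in> V \<Longrightarrow> L' n (B e v) = B e (L n v) + qs (e - of_int n + (of_int n + 1) * \<Delta>) (B (e - of_int n) v)"
  using primary unfolding primary_field_def qs_def by (simp add: algebra_simps)

lemma B_ws: "v \<in> S.ws d \<Longrightarrow> B e v \<in> T.ws (d + e + \<Delta>)"
proof -
  assume v: "v \<in> S.ws d"
  have "\<phi> n ` weight_space scale V L d \<subseteq> weight_space scale V' L' (d - n)" for n d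
    using primary by (simp add: primary_field_def)
  then have "\<phi> (- e - \<Delta>) v \<in> weight_space scale V' L' (d - (- e - \<Delta>))" using v by blast
  then show ?thesis by (simp add: field_series_def algebra_simps)
qed

lemma B_top: "B (h' - h - \<Delta>) w = w'"
  using primary by (simp add: primary_field_def field_series_def)

text \<open>A vector has finitely many weights, and those of the target are bounded below. This
  makes the products with power series finite sums.\<close>

lemma B_bounded:
  assumes "v \<in> V" shows "\<exists>N. \<forall>e<N. B e v = 0"
proof -
  obtain K f where f: "v = (\<Sum>k\<le>K. f k)" "\<And>k. f k \<in> S.ws (h + of_nat k)"
    using S.decompose[OF assms] by blast
  have "B e v = 0" if "e < h' - h - \<Delta> - of_nat K" for e
  proof -
    have "B e (f k) = 0" if "k \<le> K" for k
    proof (rule T.weight_zero[OF B_ws[OF f(2)]])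
      fix l :: nat
      have "h + of_nat k + e + \<Delta> < h'"
        using \<open>e < _\<close> of_nat_mono[OF \<open>k \<le> K\<close>, where ?'a = rat] by linarith
      then show "h + of_nat k + e + \<Delta> \<noteq> h' + of_nat l" by linarith
    qed
    then show ?thesis
      unfolding f(1) by (subst B_sum) (use f(2) S.ws_V in auto)
  qed
  then show ?thesis by blast
qed

text \<open>The component of level k of \<phi>(z) w, whose leading exponent is h' - h -
  \<Delta>.\<close>

definition desc :: "nat \<Rightarrow> 'v" where
  "desc k = B (h' - h - \<Delta> + of_nat k) w"

lemma desc_ws: "desc k \<in> T.ws (h' + of_nat k)"
  using B_ws[OF S.w_ws, of "h' - h - \<Delta> + of_nat k"] by (simp add: desc_def algebra_simps)

lemma desc_V: "desc k \<in> V'"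
  by (rule T.ws_V[OF desc_ws])

lemma desc_0: "desc 0 = w'"
  by (simp add: desc_def B_top)

lemma L_pos_B_w:
  assumes "n > 0"
  shows "L' n (B e w) = qs (e - of_int n + (of_int n + 1) * \<Delta>) (B (e - of_int n) w)"
  using L_B[OF S.w_V, of n e] S.L_w[OF assms] by (simp add: B_zero)

lemma L_desc:
  assumes "n > 0"
  shows "L' (int n) (desc (k + n)) = qs (h' - h - \<Delta> + of_nat k + (of_nat n + 1) * \<Delta>) (desc k)"
  using L_pos_B_w[of "int n" "h' - h - \<Delta> + of_nat (k + n)"] assms
  by (simp add: desc_def algebra_simps)

lemma L_desc_zero:
  assumes "k < n"
  shows "L' (int n) (desc k) = 0"
proof (rule T.weight_zero[OF T.L_ws[OF desc_ws]])
  fix l :: nat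
  have "(of_nat k :: rat) < of_nat n" using assms by simp
  then show "h' + of_nat k - of_int (int n) \<noteq> h' + of_nat l" by simp
qed

text \<open>The component of level k of T_-(z) \<phi>(z) w, where T_-(z) is the sum of L_(-n)
  z^(n-2) over n \<ge> 1.\<close>

definition desc_sum :: "nat \<Rightarrow> 'v" where
  "desc_sum k = (\<Sum>i<k. L' (- int (Suc i)) (desc (k - Suc i)))"

lemma desc_sum_ws: "desc_sum k \<in> T.ws (h' + of_nat k)"
  unfolding desc_sum_def
proof (rule subspace_sum[OF T.subspace_ws])
  fix i assume "i \<in> {..<k}"
  then show "L' (- int (Suc i)) (desc (k - Suc i)) \<in> T.ws (h' + of_nat k)"
    using T.L_ws[OF desc_ws[of "k - Suc i"], of "- int (Suc i)"] by (simp add: of_nat_diff)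
qed

lemma desc_sum_V: "desc_sum k \<in> V'"
  by (rule T.ws_V[OF desc_sum_ws])

lemma L_desc_sum:
  assumes "n > 0"
  shows "L' (int n) (desc_sum k) = (\<Sum>i<k. L' (- int (Suc i)) (L' (int n) (desc (k - Suc i)))
     + qs (of_nat (n + Suc i)) (L' (int n - int (Suc i)) (desc (k - Suc i)))
     + qs (if Suc i = n then c / 12 * of_int (int n * ((int n)\<^sup>2 - 1)) else 0) (desc (k - Suc i)))"
  unfolding desc_sum_def
proof (subst T.L_sum, goal_cases)
  case 2
  show ?case
  proof (rule sum.cong)
    fix i assume "i \<in> {..<k}"
    have *: "int n + - int (Suc i) = 0 \<longleftrightarrow> Suc i = n" "int n - - int (Suc i) = int (n + Suc i)"
        "int n + - int (Suc i) = int n - int (Suc i)" by auto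
    show "L' (int n) (L' (- int (Suc i)) (desc (k - Suc i))) = L' (- int (Suc i)) (L' (int n) (desc (k - Suc i)))
     + qs (of_nat (n + Suc i)) (L' (int n - int (Suc i)) (desc (k - Suc i)))
     + qs (if Suc i = n then c / 12 * of_int (int n * ((int n)\<^sup>2 - 1)) else 0) (desc (k - Suc i))"
      unfolding T.L_comm[OF desc_V, of "int n"] * of_int_of_nat_eq
      by (simp del: of_nat_Suc add: *(1)[simplified])
  qed simp
qed (auto intro: T.L_in desc_V)

text \<open>The terms regroup into \<open>desc_sum k\<close> because their coefficient does not
  depend on i: k - i - 1 from the field and i + 3 from the commutator have a constant sum. The term
  i = 0 of the commutator sum gives the weight of \<open>desc k\<close>.\<close>

lemma L1_desc_sum:
  "L' 1 (desc_sum (Suc k)) = qs (2 * (h' + of_nat k)) (desc k)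
     + qs (h' - h - \<Delta> + of_nat k + 2 + 2 * \<Delta>) (desc_sum k)"
proof -
  have 0: "L' 0 (desc k) = qs (h' + of_nat k) (desc k)"
    using desc_ws[of k] by (simp add: T.ws_iff)
  have "L' 1 (desc_sum (Suc k)) = (\<Sum>i<Suc k. L' (- int (Suc i)) (L' 1 (desc (k - i))))
     + (\<Sum>i<Suc k. qs (of_nat (Suc (Suc i))) (L' (- int i) (desc (k - i))))"
  proof -
    have e: "int (Suc 0) = 1" "int 1 = 1" "1 - int (Suc i) = - int i" for i by simp_all
    show ?thesis
      using L_desc_sum[of 1 "Suc k"] by (simp del: of_nat_Suc sum.lessThan_Suc add: sum.distrib e cong: if_cong)
  qed
  also have "(\<Sum>i<Suc k. L' (- int (Suc i)) (L' 1 (desc (k - i))))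
     = (\<Sum>i<k. qs (h' - h - \<Delta> + of_nat (k - Suc i) + 2 * \<Delta>) (L' (- int (Suc i)) (desc (k - Suc i))))"
  proof -
    have "L' 1 (desc (k - i)) = qs (h' - h - \<Delta> + of_nat (k - Suc i) + 2 * \<Delta>) (desc (k - Suc i))" if "i < k" for i
      using L_desc[of 1 "k - Suc i"] that by (simp add: Suc_diff_Suc)
    then have "(\<Sum>i<k. L' (- int (Suc i)) (L' 1 (desc (k - i))))
      = (\<Sum>i<k. L' (- int (Suc i)) (qs (h' - h - \<Delta> + of_nat (k - Suc i) + 2 * \<Delta>) (desc (k - Suc i))))"
      by (intro sum.cong) auto
    then show ?thesis
      using L_desc_zero[of 0 1] by (simp add: T.L_zero T.L_qs desc_V)
  qed
  also have "(\<Sum>i<Suc k. qs (of_nat (Suc (Suc i))) (L' (- int i) (desc (k - i))))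
     = qs (2 * (h' + of_nat k)) (desc k) + (\<Sum>i<k. qs (of_nat (i + 3)) (L' (- int (Suc i)) (desc (k - Suc i))))"
    unfolding sum.lessThan_Suc_shift by (simp add: 0 numeral_3_eq_3)
  finally have "L' 1 (desc_sum (Suc k)) = qs (2 * (h' + of_nat k)) (desc k)
     + (\<Sum>i<k. qs (h' - h - \<Delta> + of_nat (k - Suc i) + 2 * \<Delta> + of_nat (i + 3)) (L' (- int (Suc i)) (desc (k - Suc i))))"
    by (simp only: qs_left_distrib sum.distrib add_ac)
  also have "(\<Sum>i<k. qs (h' - h - \<Delta> + of_nat (k - Suc i) + 2 * \<Delta> + of_nat (i + 3)) (L' (- int (Suc i)) (desc (k - Suc i))))
     = qs (h' - h - \<Delta> + of_nat k + 2 + 2 * \<Delta>) (desc_sum k)"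
    unfolding desc_sum_def qs_sum_right
    by (intro sum.cong arg_cong2[where f = qs]) (auto simp: of_nat_diff)
  finally show ?thesis .
qed

text \<open>As for L_1, with i + 5 for i + 3. Left over are L_1 on level k + 1 with factor 3, L_0 on
  level k with factor 4, and the central term c/2.\<close>

lemma L2_desc_sum:
  "L' 2 (desc_sum (Suc (Suc k))) = qs (3 * (h' - h - \<Delta> + of_nat k + 2 * \<Delta>) + 4 * (h' + of_nat k) + c / 2) (desc k)
     + qs (h' - h - \<Delta> + of_nat k + 4 + 3 * \<Delta>) (desc_sum k)"
proof -
  have 0: "L' 0 (desc k) = qs (h' + of_nat k) (desc k)"
    using desc_ws[of k] by (simp add: T.ws_iff)
  have 1: "L' 1 (desc (Suc k)) = qs (h' - h - \<Delta> + of_nat k + 2 * \<Delta>) (desc k)"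
    using L_desc[of 1 k] by simp
  let ?n = "Suc (Suc k)"
  have "L' 2 (desc_sum ?n) = (\<Sum>i<?n. L' (- int (Suc i)) (L' 2 (desc (Suc k - i))))
     + (\<Sum>i<?n. qs (of_nat (i + 3)) (L' (1 - int i) (desc (Suc k - i))))
     + (\<Sum>i<?n. qs (if i = 1 then c / 2 else 0) (desc (Suc k - i)))"
  proof -
    have e: "int 2 = 2" "2 - int (Suc i) = 1 - int i" "Suc i = 2 \<longleftrightarrow> i = 1" "2 + Suc i = i + 3"
      "c / 12 * of_int (2 * (2\<^sup>2 - 1)) = c / 2" for i by simp_all
    show ?thesis
      using L_desc_sum[of 2 ?n] by (simp only: sum.distrib diff_Suc_Suc e cong: if_cong)
  qed
  also have "(\<Sum>i<?n. L' (- int (Suc i)) (L' 2 (desc (Suc k - i))))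
     = (\<Sum>i<k. qs (h' - h - \<Delta> + of_nat (k - Suc i) + 3 * \<Delta>) (L' (- int (Suc i)) (desc (k - Suc i))))"
  proof -
    have "L' 2 (desc (Suc k - i)) = qs (h' - h - \<Delta> + of_nat (k - Suc i) + 3 * \<Delta>) (desc (k - Suc i))" if "i < k" for i
    proof -
      have "Suc k - i = k - Suc i + 2" using that by simp
      then show ?thesis using L_desc[of 2 "k - Suc i"] by simp
    qed
    then have "(\<Sum>i<k. L' (- int (Suc i)) (L' 2 (desc (Suc k - i))))
      = (\<Sum>i<k. L' (- int (Suc i)) (qs (h' - h - \<Delta> + of_nat (k - Suc i) + 3 * \<Delta>) (desc (k - Suc i))))"
      by (intro sum.cong) auto
    then show ?thesis
      using L_desc_zero[of 0 2] L_desc_zero[of 1 2] by (simp add: T.L_zero T.L_qs desc_V)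
  qed
  also have "(\<Sum>i<?n. qs (of_nat (i + 3)) (L' (1 - int i) (desc (Suc k - i))))
     = qs (3 * (h' - h - \<Delta> + of_nat k + 2 * \<Delta>) + 4 * (h' + of_nat k)) (desc k)
       + (\<Sum>i<k. qs (of_nat (i + 5)) (L' (- int (Suc i)) (desc (k - Suc i))))"
    unfolding sum.lessThan_Suc_shift by (simp add: 0 1 qs_left_distrib[symmetric] add.assoc[symmetric] add.commute[of 5])
  also have "(\<Sum>i<?n. qs (if i = 1 then c / 2 else 0) (desc (Suc k - i))) = qs (c / 2) (desc k)"
    unfolding sum.lessThan_Suc_shift by simp
  finally have "L' 2 (desc_sum ?n) = qs (3 * (h' - h - \<Delta> + of_nat k + 2 * \<Delta>) + 4 * (h' + of_nat k) + c / 2) (desc k)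
     + (\<Sum>i<k. qs (h' - h - \<Delta> + of_nat (k - Suc i) + 3 * \<Delta> + of_nat (i + 5)) (L' (- int (Suc i)) (desc (k - Suc i))))"
    by (simp only: qs_left_distrib sum.distrib add_ac)
  also have "(\<Sum>i<k. qs (h' - h - \<Delta> + of_nat (k - Suc i) + 3 * \<Delta> + of_nat (i + 5)) (L' (- int (Suc i)) (desc (k - Suc i))))
     = qs (h' - h - \<Delta> + of_nat k + 4 + 3 * \<Delta>) (desc_sum k)"
    unfolding desc_sum_def qs_sum_right
    by (intro sum.cong arg_cong2[where f = qs]) (auto simp: of_nat_diff)
  finally show ?thesis .
qed

end

locale field21 = field scale "central_charge t" h V L w h' V' L' w' "delta21 t" \<phi>
  for scale :: "complex \<Rightarrow> 'v::ab_group_add \<Rightarrow> 'v" and t h V L w h' V' L' w' \<phi> +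
  assumes t_nz: "t \<noteq> 0"
    and fusion: "(h' - h - delta21 t)\<^sup>2 + (t - 1) * (h' - h - delta21 t) = t * h"
begin

text \<open>
  The components of \<open>(\<partial>\<^sup>2 - t T)\<phi>\<close> applied to the highest weight vector, with
  \<open>\<phi>(z) L\<^sub>-\<^sub>1 w\<close> rewritten as \<open>L\<^sub>-\<^sub>1 \<phi>(z) w - \<partial>\<phi>(z) w\<close>. The assumption \<open>fusion\<close> says that the
  component of level \<open>0\<close> vanishes.
\<close>

definition null :: "nat \<Rightarrow> 'v" where
  "null k = qs (of_nat k * (of_nat k + (2 * (h' - h - delta21 t) + t - 1))) (desc k) - qs t (desc_sum k)"

lemma null_ws: "null k \<in> T.ws (h' + of_nat k)"
  unfolding null_def
  by (intro subspace_diff[OF T.subspace_ws] subspace_qs[OF T.subspace_ws] desc_ws desc_sum_ws)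

text \<open>The coefficients of \<open>desc k\<close> agree by a polynomial identity modulo
  \<open>fusion\<close> and 4 \<Delta> = 3t - 2; this is where the weight \<Delta>_{2,1} is
  forced.\<close>

lemma L1_null: "L' 1 (null (Suc k)) = qs (h' - h - delta21 t + of_nat k + 2 + 2 * delta21 t) (null k)"
proof -
  define e where "e = h' - h - delta21 t"
  define D where "D = delta21 t"
  define n :: rat where "n = of_nat k"
  have h: "e\<^sup>2 + (t - 1) * e = t * h" "h' = e + h + D" "4 * D = 3 * t - 2"
    using fusion by (auto simp: e_def D_def delta21_def)
  have "L' 1 (null (Suc k)) = qs ((n + 1) * (n + 1 + (2 * e + t - 1)) * (e + n + 2 * D)) (desc k)
      - (qs (t * (2 * (h' + n))) (desc k) + qs (t * (e + n + 2 + 2 * D)) (desc_sum k))"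
    unfolding null_def
    by (subst T.L_diff)
      (use L_desc[of 1 k] in \<open>simp_all add: T.V_closed desc_V desc_sum_V T.L_qs L1_desc_sum qs_right_distrib e_def D_def n_def algebra_simps\<close>)
  also have "\<dots> = qs ((n + 1) * (n + 1 + (2 * e + t - 1)) * (e + n + 2 * D) - t * (2 * (h' + n))) (desc k)
       - qs (t * (e + n + 2 + 2 * D)) (desc_sum k)"
    by (simp add: qs_left_diff)
  also have "(n + 1) * (n + 1 + (2 * e + t - 1)) * (e + n + 2 * D) - t * (2 * (h' + n))
      = (e + n + 2 + 2 * D) * (n * (n + (2 * e + t - 1)))"
    using h by algebra
  finally show ?thesis
    unfolding null_def by (simp add: qs_right_diff e_def D_def n_def mult.commute)
qed

text \<open>Here the central charge enters, through its polynomial relation after multiplication by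
  t.\<close>

lemma L2_null: "L' 2 (null (Suc (Suc k))) = qs (h' - h - delta21 t + of_nat k + 4 + 3 * delta21 t) (null k)"
proof -
  define e where "e = h' - h - delta21 t"
  define D where "D = delta21 t"
  define c where "c = central_charge t"
  define n :: rat where "n = of_nat k"
  have h: "e\<^sup>2 + (t - 1) * e = t * h" "h' = e + h + D" "4 * D = 3 * t - 2"
    using fusion by (auto simp: e_def D_def delta21_def)
  have c: "t * c = 13 * t - 6 * t\<^sup>2 - 6"
    using t_nz by (simp add: c_def central_charge_def field_simps power2_eq_square)
  have "L' 2 (null (Suc (Suc k))) = qs ((n + 2) * (n + 2 + (2 * e + t - 1)) * (e + n + 3 * D)) (desc k)
      - (qs (t * (3 * (e + n + 2 * D) + 4 * (h' + n) + c / 2)) (desc k) + qs (t * (e + n + 4 + 3 * D)) (desc_sum k))"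
    unfolding null_def
    by (subst T.L_diff)
      (use L_desc[of 2 k] in \<open>simp_all add: T.V_closed desc_V desc_sum_V T.L_qs L2_desc_sum qs_right_distrib e_def D_def n_def c_def algebra_simps\<close>)
  also have "\<dots> = qs ((n + 2) * (n + 2 + (2 * e + t - 1)) * (e + n + 3 * D) - t * (3 * (e + n + 2 * D) + 4 * (h' + n) + c / 2)) (desc k)
       - qs (t * (e + n + 4 + 3 * D)) (desc_sum k)"
    by (simp add: qs_left_diff)
  also have "(n + 2) * (n + 2 + (2 * e + t - 1)) * (e + n + 3 * D) - t * (3 * (e + n + 2 * D) + 4 * (h' + n) + c / 2)
      = (e + n + 4 + 3 * D) * (n * (n + (2 * e + t - 1)))"
  proof -
    have "2 * ((n + 2) * (n + 2 + (2 * e + t - 1)) * (e + n + 3 * D) - t * (3 * (e + n + 2 * D) + 4 * (h' + n))) - t * c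
      = 2 * ((e + n + 4 + 3 * D) * (n * (n + (2 * e + t - 1))))"
      using h c by algebra
    then show ?thesis by (simp add: algebra_simps)
  qed
  finally show ?thesis
    unfolding null_def by (simp add: qs_right_diff e_def D_def n_def mult.commute)
qed

text \<open>L_1 and L_2 lead to multiples of lower components, so each component above level 0 is
  singular; on level 1, L_2 leads below the top weight. Level 0 vanishes by its factor k and the
  empty sum.\<close>

lemma null_zero: "null k = 0"
proof (induction k rule: less_induct)
  case (less k)
  show ?case
  proof (cases k)
    case 0
    then show ?thesis by (simp add: null_def desc_sum_def)
  next
    case (Suc l)
    show ?thesis
    proof (rule T.singular_zero[OF null_ws])
      show "h' + of_nat k \<noteq> h'" using Suc by simp
      show "L' 1 (null k) = 0" unfolding Suc L1_null using less Suc by simp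
      show "L' 2 (null k) = 0"
      proof (cases l)
        case 0
        show ?thesis
        proof (rule T.weight_zero[OF T.L_ws[OF null_ws]])
          fix m :: nat
          have "- 1 \<noteq> (of_nat m :: rat)" by (metis neg_0_less_iff_less not_one_less_zero of_nat_0_le_iff not_le zero_less_one neg_less_0_iff_less)
          then show "h' + of_nat k - of_int 2 \<noteq> h' + of_nat m" using Suc 0 by simp
        qed
      next
        case (Suc m)
        have "null m = 0" using less[of m] \<open>k = Suc l\<close> Suc by simp
        then show ?thesis unfolding \<open>k = Suc l\<close> Suc L2_null by simp
      qed
    qed
  qed
qed

end

locale field_pair = complex_vs scale + B: field21 scale t h V L w h1 V1 L1 w1 \<phi> +
    A: field scale "central_charge t" h1 V1 L1 w1 h2 V2 L2 w2 "delta21 t" \<psi>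
  for scale :: "complex \<Rightarrow> 'v::ab_group_add \<Rightarrow> 'v" and t h V L w h1 V1 L1 w1 \<phi> h2 V2 L2 w2 \<psi>
begin

abbreviation "A \<equiv> A.B"
abbreviation "B \<equiv> B.B"
abbreviation "\<tau> \<equiv> 2 * (h1 - h - delta21 t) + t - 1"
abbreviation "\<eta> \<equiv> h2 - h1 - delta21 t"

text \<open>Apply the coefficient of \<psi> that maps level k to the top weight to
  \<open>null k = 0\<close>. On the lower levels this coefficient lands below the top weight, so
  moving L_(-i-1) to the left through it leaves only the commutator, which gives the
  recursion.\<close>

lemma two_point:
  assumes U: "bpz_rec t \<tau> \<eta> U" and nres: "\<tau> \<notin> \<int>"
  shows "A (\<eta> - of_nat k) (B.desc k) = qs (fps_nth U k) w2"
proof (induction k rule: less_induct)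
  case (less k)
  show ?case
  proof (cases "k = 0")
    case True
    then show ?thesis
      using A.B_top U by (simp add: B.desc_0 bpz_rec_def)
  next
    case False
    define e where "e = \<eta> - of_nat k"
    define f where "f m = (\<eta> - of_nat m + (1 - of_nat (k - m)) * delta21 t) * fps_nth U m" for m
    have L_term: "A e (L1 (- int (Suc i)) (B.desc (k - Suc i))) = - qs (f (k - Suc i)) w2" if i: "i < k" for i
    proof -
      have "A e (B.desc (k - Suc i)) = 0"
      proof (rule A.T.weight_zero[OF A.B_ws[OF B.desc_ws]])
        fix l :: nat
        have "- of_nat (Suc i) \<noteq> (of_nat l :: rat)"
          by (metis neg_less_0_iff_less not_le of_nat_0_le_iff of_nat_0_less_iff zero_less_Suc)
        then show "h1 + of_nat (k - Suc i) + e + delta21 t \<noteq> h2 + of_nat l"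
          using i by (simp add: e_def of_nat_diff del: of_nat_Suc)
      qed
      then have "0 = A e (L1 (- int (Suc i)) (B.desc (k - Suc i)))
          + qs (e + of_nat (Suc i) + (1 - of_nat (Suc i)) * delta21 t) (A (e + of_nat (Suc i)) (B.desc (k - Suc i)))"
        using A.L_B[OF B.desc_V, of "- int (Suc i)" e "k - Suc i"] A.T.L_zero
        by (simp del: of_nat_Suc add: add.commute[of _ 1])
      moreover have "e + of_nat (Suc i) = \<eta> - of_nat (k - Suc i)"
        using i by (simp add: e_def of_nat_diff del: of_nat_Suc)
      moreover have "k - (k - Suc i) = Suc i" using i by simp
      ultimately show ?thesis
        using less[of "k - Suc i"] i by (simp add: f_def eq_neg_iff_add_eq_0 del: of_nat_Suc)
    qed
    have "qs (of_nat k * (of_nat k + \<tau>)) (B.desc k) = qs t (B.desc_sum k)"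
      using B.null_zero[of k] by (simp add: B.null_def)
    then have "A e (qs (of_nat k * (of_nat k + \<tau>)) (B.desc k)) = A e (qs t (B.desc_sum k))" by simp
    then have "qs (of_nat k * (of_nat k + \<tau>)) (A e (B.desc k)) = qs t (A e (B.desc_sum k))"
      by (simp only: A.B_qs B.desc_V B.desc_sum_V)
    also have "A e (B.desc_sum k) = (\<Sum>i<k. A e (L1 (- int (Suc i)) (B.desc (k - Suc i))))"
      unfolding B.desc_sum_def by (rule A.B_sum) (intro B.T.L_in B.desc_V)
    also have "\<dots> = (\<Sum>i<k. - qs (f (k - Suc i)) w2)"
      by (rule sum.cong) (use L_term in auto)
    also have "\<dots> = - qs (\<Sum>m<k. f m) w2"
      using sum.nat_diff_reindex[of "\<lambda>m. qs (f m) w2" k] by (simp add: qs_sum_left sum_negf)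
    also have "qs t (- qs (\<Sum>m<k. f m) w2) = qs (of_nat k * (of_nat k + \<tau>)) (qs (fps_nth U k) w2)"
      using U unfolding bpz_rec_def f_def by simp
    finally have "qs (of_nat k * (of_nat k + \<tau>)) (A e (B.desc k) - qs (fps_nth U k) w2) = 0"
      by (simp only: qs_right_diff) simp
    moreover have "of_nat k + \<tau> \<noteq> 0"
      using nres by (metis Ints_minus Ints_of_nat add.inverse_unique)
    ultimately show ?thesis using False by (simp add: e_def)
  qed
qed

end

section \<open>Products of two primary fields with a formal series\<close>

text \<open>\<open>hsum n f\<close> is the product of \<open>f\<close> with \<open>(z\<^sub>1\<^sup>n - z\<^sub>2\<^sup>n) / (z\<^sub>1 - z\<^sub>2)\<close>.\<close>

definition hsum :: "int \<Rightarrow> (rat \<Rightarrow> rat \<Rightarrow> 'a::ab_group_add) \<Rightarrow> rat \<Rightarrow> rat \<Rightarrow> 'a" where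
  "hsum n f a b = (if n \<ge> 0 then \<Sum>i<nat n. f (a - of_int n + 1 + of_nat i) (b - of_nat i)
     else - (\<Sum>i<nat (- n). f (a + 1 + of_nat i) (b - of_int n - of_nat i)))"

lemma hsum_0 [simp]: "hsum 0 f a b = 0"
  by (simp add: hsum_def)

lemma hsum_add: "hsum n (\<lambda>a b. f a b + g a b) a b = hsum n f a b + hsum n g a b"
  by (simp add: hsum_def sum.distrib)

lemma hsum_shift: "hsum n (\<lambda>a b. f (a + x) (b + y)) a b = hsum n f (a + x) (b + y)"
  by (simp add: hsum_def algebra_simps)

lemma hsum_cong:
  assumes "\<And>a' b'. a' + b' = a + b - of_int n + 1 \<Longrightarrow> f a' b' = g a' b'"
  shows "hsum n f a b = hsum n g a b"
  unfolding hsum_def by (auto intro!: sum.cong arg_cong[where f = uminus] assms)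

text \<open>With p_n = (z_1^n - z_2^n)/(z_1 - z_2) this is p_(n+1) = z_1 p_n + z_2^n, for all
  integers n. Exchange, telescoping and the action on delta functions follow from it by induction in
  both directions.\<close>

lemma hsum_step: "hsum (n + 1) f a b = hsum n f (a - 1) b + f a (b - of_int n)"
proof (cases "n \<ge> 0")
  case True
  then have "nat (n + 1) = Suc (nat n)" by simp
  with True show ?thesis by (simp add: hsum_def algebra_simps)
next
  case False
  define m where "m = nat (- n - 1)"
  have n: "n = - int m - 1" using False by (simp add: m_def)
  have "hsum (n + 1) f a b = - (\<Sum>i<m. f (a + of_nat (Suc i)) (b - of_int n - of_nat (Suc i)))"
  proof (cases "m = 0")
    case True
    then show ?thesis by (simp add: n)
  next
    case False
    then have "nat (- (n + 1)) = m" "\<not> n + 1 \<ge> 0" using n by auto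
    then show ?thesis by (simp only: hsum_def if_False) (simp add: algebra_simps)
  qed
  also have "\<dots> = f a (b - of_int n) - (\<Sum>i<Suc m. f (a + of_nat i) (b - of_int n - of_nat i))"
    unfolding sum.lessThan_Suc_shift by simp
  also have "(\<Sum>i<Suc m. f (a + of_nat i) (b - of_int n - of_nat i)) = - hsum n f (a - 1) b"
  proof -
    have "nat (- n) = Suc m" "\<not> n \<ge> 0" using n by auto
    then show ?thesis by (simp only: hsum_def if_False) simp
  qed
  finally show ?thesis by simp
qed

text \<open>The step is an equivalence because multiplication by z_1 is invertible;
  \<open>all_shift\<close> absorbs it into the quantifier over a.\<close>

lemma hsum_induct [case_names zero step]:
  fixes P :: "int \<Rightarrow> bool"
  assumes "P 0" and step: "\<And>n. P n \<longleftrightarrow> P (n + 1)"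
  shows "P n"
proof (induction n rule: int_induct[of _ 0])
  case (step2 i)
  then show ?case using step[of "i - 1"] by simp
qed (use assms in auto)

lemma all_shift: "(\<forall>a::rat. P (a - 1)) = (\<forall>a. P a)"
  by (metis add_diff_cancel_right')

lemma eq_add_iff_of_diff_eq:
  fixes x y z :: "'a::ab_group_add"
  assumes "x - y - z = x' - y' - z'"
  shows "x = y + z \<longleftrightarrow> x' = y' + z'"
proof -
  have "x = y + z \<longleftrightarrow> x - y - z = 0" "x' = y' + z' \<longleftrightarrow> x' - y' - z' = 0"
    by (simp_all add: algebra_simps)
  then show ?thesis using assms by simp
qed

lemma hsum_step': "hsum (n + 1) f a b = hsum n f a (b - 1) + f (a - of_int n) b"
proof -
  have "\<forall>a b. hsum (n + 1) f a b = hsum n f a (b - 1) + f (a - of_int n) b"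
  proof (induction n rule: hsum_induct)
    case zero
    show ?case using hsum_step[of 0 f] by simp
  next
    case (step n)
    have "hsum (n + 1 + 1) f a b - hsum (n + 1) f a (b - 1) - f (a - of_int (n + 1)) b =
       hsum (n + 1) f (a - 1) b - hsum n f (a - 1) (b - 1) - f (a - 1 - of_int n) b" for a b
      using hsum_step[of "n + 1" f a b] hsum_step[of n f a "b - 1"] by (simp add: algebra_simps)
    then have *: "hsum (n + 1 + 1) f a b = hsum (n + 1) f a (b - 1) + f (a - of_int (n + 1)) b \<longleftrightarrow>
       hsum (n + 1) f (a - 1) b = hsum n f (a - 1) (b - 1) + f (a - 1 - of_int n) b" for a b
      by (rule eq_add_iff_of_diff_eq)
    show ?case
      unfolding * by (rule all_shift[symmetric])
  qed
  then show ?thesis by blast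
qed

lemma hsum_swap: "hsum n (\<lambda>a b. f b a) a b = hsum n f b a"
proof -
  have "\<forall>a b. hsum n (\<lambda>a b. f b a) a b = hsum n f b a"
  proof (induction n rule: hsum_induct)
    case (step n)
    have *: "hsum (n + 1) (\<lambda>a b. f b a) a b = hsum (n + 1) f b a \<longleftrightarrow>
       hsum n (\<lambda>a b. f b a) (a - 1) b = hsum n f b (a - 1)" for a b
      unfolding hsum_step[of n "\<lambda>a b. f b a"] hsum_step'[of n f] by simp
    show ?case unfolding * by (rule all_shift[symmetric])
  qed simp
  then show ?thesis by blast
qed

text \<open>z_1^n - z_2^n factors through z_1 - z_2 = z_1 (1 - z_2/z_1), and the shift to a - 1 is
  this z_1. Nothing is divided by z_1 - z_2, which is a zero divisor on two-sided series.\<close>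

lemma hsum_telescope:
  assumes "\<And>a b. H a b - H (a + 1) (b - 1) = G a b"
  shows "H (a - of_int n) b - H a (b - of_int n) = hsum n G (a - 1) b"
proof -
  have "\<forall>a b. H (a - of_int n) b - H a (b - of_int n) = hsum n G (a - 1) b"
  proof (induction n rule: hsum_induct)
    case (step n)
    have *: "H (a - of_int (n + 1)) b - H a (b - of_int (n + 1)) = hsum (n + 1) G (a - 1) b \<longleftrightarrow>
       H (a - 1 - of_int n) b - H (a - 1) (b - of_int n) = hsum n G (a - 1 - 1) b" for a b
      unfolding hsum_step using assms[of "a - 1" "b - of_int n"] by (auto simp: algebra_simps)
    show ?case unfolding * by (rule all_shift[symmetric])
  qed simp
  then show ?thesis by blast
qed

text \<open>The coefficients of \<open>z\<^sub>1\<^sup>s \<delta>(z\<^sub>2/z\<^sub>1)\<close>, for integral \<open>s\<close>.\<close>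

definition diag :: "rat \<Rightarrow> rat \<Rightarrow> rat \<Rightarrow> rat" where
  "diag s a b = (if a + b = s \<and> a \<in> \<int> then 1 else 0)"

lemma diag_shift: "diag s (a - of_int n) b = diag (s + of_int n) a b"
  by (auto simp: diag_def algebra_simps)

lemma diag_shift2: "diag s a (b - of_int n) = diag (s + of_int n) a b"
  by (auto simp: diag_def algebra_simps)

lemma diag_shift': "diag s (a - 1) b = diag (s + 1) a b" "diag s a (b - 1) = diag (s + 1) a b"
  using diag_shift[of s a 1 b] diag_shift2[of s a b 1] by simp_all

text \<open>On a delta function the variables may be identified, and (z_1^n - z_2^n)/(z_1 - z_2)
  becomes n z_1^(n-1).\<close>

lemma hsum_diag: "hsum n (diag s) a b = of_int n * diag (s + of_int n - 1) a b"
proof -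
  have "\<forall>a b. hsum n (diag s) a b = of_int n * diag (s + of_int n - 1) a b"
  proof (induction n rule: hsum_induct)
    case (step n)
    have *: "hsum (n + 1) (diag s) a b = of_int (n + 1) * diag (s + of_int (n + 1) - 1) a b \<longleftrightarrow>
       hsum n (diag s) (a - 1) b = of_int n * diag (s + of_int n - 1) (a - 1) b" for a b
      unfolding hsum_step diag_shift2 diag_shift' by (simp add: algebra_simps)
    show ?case unfolding * by (rule all_shift[symmetric])
  qed simp
  then show ?thesis by blast
qed

lemma (in complex_vs) hsum_qs: "hsum n (\<lambda>a b. qs (d a b) v) a b = qs (hsum n d a b) v"
  by (simp add: hsum_def qs_sum_left)

lemma (in complex_vs) hsum_qs': "hsum n (\<lambda>a b. qs c (f a b)) a b = qs c (hsum n f a b)"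
  by (simp add: hsum_def qs_sum_right)

context field_pair begin

sublocale hw_pair scale "central_charge t" h V L w h2 V2 L2 w2 ..

abbreviation (input) "D \<equiv> delta21 t"

definition F :: "rat \<Rightarrow> rat \<Rightarrow> 'v \<Rightarrow> 'v" where
  "F a b v = A a (B b v)"

lemma F_linear: "linear_between scale V V2 (F a b)"
  unfolding linear_between_def F_def
  by (auto simp: A.B_in B.B_in A.B_add B.B_add A.B_scale B.B_scale)

lemma F_ws: "v \<in> B.S.ws d \<Longrightarrow> F a b v \<in> A.T.ws (d + a + b + 2 * D)"
  using A.B_ws[OF B.B_ws[of v d b], of a] by (simp add: F_def algebra_simps)

lemma L_F:
  assumes "v \<in> V"
  shows "L2 n (F a b v) = F a b (L n v) + qs (a - of_int n + (of_int n + 1) * D) (F (a - of_int n) b v)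
     + qs (b - of_int n + (of_int n + 1) * D) (F a (b - of_int n) v)"
  unfolding F_def
  by (subst A.L_B, rule B.B_in[OF assms], subst B.L_B[OF assms])
    (simp add: A.B_add A.B_qs B.B_in B.T.V_closed B.S.L_in assms)

lemma F_vanish:
  assumes "v \<in> V" shows "eventually (\<lambda>k. \<forall>a. F a (b - of_nat k) v = 0) sequentially"
proof -
  obtain N where N: "\<forall>e<N. B e v = 0" using B.B_bounded[OF assms] by blast
  obtain k :: nat where "b - N < of_nat k" using reals_Archimedean2 by blast
  then have "F a (b - of_nat l) v = 0" if "l \<ge> k" for l a
    using N that of_nat_mono[OF that, where ?'a = rat]
    by (simp add: F_def linear_between_zero[OF B.T.subspace_V A.B_linear])
  then show ?thesis by (auto simp: eventually_sequentially)
qed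

text \<open>The coefficients of \<open>f(z\<^sub>2/z\<^sub>1) \<psi>(z\<^sub>1) \<phi>(z\<^sub>2)\<close>.\<close>

definition G :: "rat fps \<Rightarrow> rat \<Rightarrow> rat \<Rightarrow> 'v \<Rightarrow> 'v" where
  "G f a b v = Sum_any (\<lambda>k. qs (fps_nth f k) (F (a + of_nat k) (b - of_nat k) v))"

text \<open>One truncation serves all f and a, so identities between several values of G become
  identities of finite sums over a common range.\<close>

lemma G_eventually:
  assumes "v \<in> V"
  shows "eventually (\<lambda>K. \<forall>f a. G f a b v = (\<Sum>k<K. qs (fps_nth f k) (F (a + of_nat k) (b - of_nat k) v))) sequentially"
proof -
  obtain N where N: "\<And>k a. k \<ge> N \<Longrightarrow> F a (b - of_nat k) v = 0"
    using F_vanish[OF assms, of b] by (auto simp: eventually_sequentially)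
  have "G f a b v = (\<Sum>k<K. qs (fps_nth f k) (F (a + of_nat k) (b - of_nat k) v))" if "K \<ge> N" for f a K
    unfolding G_def
  proof (rule Sum_any.expand_superset)
    show "{k. qs (fps_nth f k) (F (a + of_nat k) (b - of_nat k) v) \<noteq> 0} \<subseteq> {..<K}"
    proof
      fix k assume "k \<in> {k. qs (fps_nth f k) (F (a + of_nat k) (b - of_nat k) v) \<noteq> 0}"
      then have "\<not> K \<le> k" using N[of k] that by auto
      then show "k \<in> {..<K}" by simp
    qed
  qed simp
  then show ?thesis by (auto simp: eventually_sequentially)
qed

lemma G_linear: "linear_between scale V V2 (G f a b)"
  unfolding linear_between_def
proof (intro conjI ballI allI image_subsetI)
  fix v assume v: "v \<in> V"
  show "G f a b v \<in> V2"
    using eventually_happens'[OF _ G_eventually[OF v, of b]]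
    by (auto simp: intro!: A.T.V_closed linear_between_in[OF F_linear v])
next
  fix u v assume uv: "u \<in> V" "v \<in> V"
  have "eventually (\<lambda>K::nat. G f a b (u + v) = G f a b u + G f a b v) sequentially"
    using G_eventually[OF uv(1), of b] G_eventually[OF uv(2), of b] G_eventually[of "u + v" b, OF B.S.V_closed(2)[OF uv]]
    by eventually_elim (simp add: linear_between_add[OF F_linear] uv qs_distribs sum.distrib)
  then show "G f a b (u + v) = G f a b u + G f a b v" by simp
next
  fix c v assume v: "v \<in> V"
  have "eventually (\<lambda>K::nat. G f a b (scale c v) = scale c (G f a b v)) sequentially"
    using G_eventually[OF v, of b] G_eventually[of "scale c v" b, OF B.S.V_closed(6)[OF v]]
    by eventually_elim (simp add: linear_between_scale[OF F_linear] v qs_scale scale_sum_right)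
  then show "G f a b (scale c v) = scale c (G f a b v)" by simp
qed

lemma G_ws:
  assumes v: "v \<in> B.S.ws d" shows "G f a b v \<in> A.T.ws (d + a + b + 2 * D)"
proof -
  have "F (a + of_nat k) (b - of_nat k) v \<in> A.T.ws (d + a + b + 2 * D)" for k
    using F_ws[OF v, of "a + of_nat k" "b - of_nat k"] by (simp add: algebra_simps)
  then show ?thesis
    using eventually_happens'[OF _ G_eventually[OF B.S.ws_V[OF v], of b]]
    by (auto intro!: subspace_sum[OF A.T.subspace_ws] subspace_qs[OF A.T.subspace_ws])
qed

lemma G_add: "v \<in> V \<Longrightarrow> G (f + g) a b v = G f a b v + G g a b v"
proof -
  assume v: "v \<in> V"
  have "eventually (\<lambda>K::nat. G (f + g) a b v = G f a b v + G g a b v) sequentially"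
    using G_eventually[OF v, of b] by eventually_elim (simp add: qs_distribs sum.distrib)
  then show ?thesis by simp
qed

lemma G_const: "v \<in> V \<Longrightarrow> G (fps_const c * f) a b v = qs c (G f a b v)"
proof -
  assume v: "v \<in> V"
  have "eventually (\<lambda>K::nat. G (fps_const c * f) a b v = qs c (G f a b v)) sequentially"
    using G_eventually[OF v, of b] by eventually_elim (simp add: qs_sum_right)
  then show ?thesis by simp
qed

lemma G_X: "v \<in> V \<Longrightarrow> G (fps_X * f) a b v = G f (a + 1) (b - 1) v"
proof -
  assume v: "v \<in> V"
  \<comment> \<open>Truncated at \<open>Suc K\<close>, the left side has K terms after the index
    shift, as many as the right side.\<close>
  have 1: "eventually (\<lambda>K. \<forall>f a. G f a b v = (\<Sum>k<Suc K. qs (fps_nth f k) (F (a + of_nat k) (b - of_nat k) v))) sequentially"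
    using G_eventually[OF v, of b] eventually_sequentially_Suc[of "\<lambda>K. \<forall>f a. G f a b v = (\<Sum>k<K. qs (fps_nth f k) (F (a + of_nat k) (b - of_nat k) v))"] by blast
  have "eventually (\<lambda>K::nat. G (fps_X * f) a b v = G f (a + 1) (b - 1) v) sequentially"
    using 1 G_eventually[OF v, of "b - 1"]
    by eventually_elim (simp only: sum.lessThan_Suc_shift, simp add: algebra_simps)
  then show ?thesis by simp
qed

lemma G_diff: "v \<in> V \<Longrightarrow> G (f - g) a b v = G f a b v - G g a b v"
  using G_add[of v "f - g" g] by (simp add: algebra_simps)

text \<open>The exponents a + k and b - k in \<open>L_F\<close> contribute k and -k, and k times the
  k-th coefficient of f is that of \<open>theta f\<close>.\<close>

lemma L_G:
  assumes v: "v \<in> V"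
  shows "L2 n (G f a b v) = G f a b (L n v)
     + qs (a - of_int n + (of_int n + 1) * D) (G f (a - of_int n) b v)
     + qs (b - of_int n + (of_int n + 1) * D) (G f a (b - of_int n) v)
     + (G (theta f) (a - of_int n) b v - G (theta f) a (b - of_int n) v)" (is "_ = ?r")
proof -
  have "eventually (\<lambda>K::nat. L2 n (G f a b v) = ?r) sequentially"
    using G_eventually[OF v, of b] G_eventually[OF v, of "b - of_int n"] G_eventually[of "L n v" b, OF B.S.L_in[OF v]]
  proof eventually_elim
    case (elim K)
    let ?F1 = "\<lambda>k. F (a - of_int n + of_nat k) (b - of_nat k) v"
    let ?F2 = "\<lambda>k. F (a + of_nat k) (b - of_int n - of_nat k) v"
    have "L2 n (G f a b v) = (\<Sum>k<K. qs (fps_nth f k) (L2 n (F (a + of_nat k) (b - of_nat k) v)))"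
      unfolding elim(1)[rule_format, of f a]
      by (subst A.T.L_sum) (auto simp: A.T.L_qs linear_between_in[OF F_linear v] intro!: A.T.V_closed)
    also have "\<dots> = (\<Sum>k<K. qs (fps_nth f k) (F (a + of_nat k) (b - of_nat k) (L n v))
       + qs (a - of_int n + (of_int n + 1) * D) (qs (fps_nth f k) (?F1 k))
       + qs (b - of_int n + (of_int n + 1) * D) (qs (fps_nth f k) (?F2 k))
       + (qs (fps_nth (theta f) k) (?F1 k) - qs (fps_nth (theta f) k) (?F2 k)))"
      unfolding L_F[OF v]
      by (intro sum.cong refl)
        (simp add: qs_distribs algebra_simps)
    also have "\<dots> = ?r"
      unfolding elim(1)[rule_format, of f "a - of_int n"] elim(2)[rule_format, of f a]
        elim(3)[rule_format, of f a] elim(1)[rule_format, of "theta f" "a - of_int n"] elim(2)[rule_format, of "theta f" a]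
      by (simp only: sum.distrib sum_subtractf qs_sum_right)
    finally show ?case .
  qed
  then show ?thesis by simp
qed

text \<open>
  \<open>G (\<theta>f)\<close> enters \<open>L_G\<close> only through its product with \<open>z\<^sub>1\<^sup>n - z\<^sub>2\<^sup>n\<close>, which cancels the simple pole
  of \<open>(1 + geom) * g\<close> at \<open>z\<^sub>1 = z\<^sub>2\<close>.
\<close>

lemma L_G_pole:
  assumes v: "v \<in> V" and f: "theta f = fps_const l * f + (1 + geom) * g + k"
  shows "L2 n (G f a b v) = G f a b (L n v)
     + qs (a - of_int n + (of_int n + 1) * D + l) (G f (a - of_int n) b v)
     + qs (b - of_int n + (of_int n + 1) * D - l) (G f a (b - of_int n) v)
     + hsum n (\<lambda>a b. G g a b v) (a - 1) b
     + (G k (a - of_int n) b v - G k a (b - of_int n) v)"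
proof -
  have "(1 + geom) * g - fps_X * ((1 + geom) * g) = g"
    using one_minus_X_geom by (metis (no_types) left_diff_distrib mult.assoc mult_1)
  then have "G ((1 + geom) * g) a b v - G ((1 + geom) * g) (a + 1) (b - 1) v = G g a b v" for a b
    by (metis G_X G_diff v)
  from hsum_telescope[of "\<lambda>a b. G ((1 + geom) * g) a b v", OF this]
  have tel: "G ((1 + geom) * g) (a - of_int n) b v - G ((1 + geom) * g) a (b - of_int n) v
    = hsum n (\<lambda>a b. G g a b v) (a - 1) b" .
  show ?thesis
    unfolding L_G[OF v] f G_add[OF v] G_const[OF v] tel[symmetric]
    by (simp add: qs_distribs)
qed

lemma series_times_G:
  assumes v: "v \<in> V"
  shows "series_times scale (monom_mult \<alpha> \<beta> (ratio_series (shifted_fps \<mu> f))) (op_product A B) a b v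
    = G f (a - \<alpha> + \<mu>) (b - \<beta> - \<mu>) v"
proof -
  let ?g = "\<lambda>(i, j). scale (of_rat (monom_mult \<alpha> \<beta> (ratio_series (shifted_fps \<mu> f)) i j)) (op_product A B (a - i) (b - j) v)"
  \<comment> \<open>The exponents of z_1 and z_2 in the k-th term of the scalar series, which
    contain its support.\<close>
  let ?\<kappa> = "\<lambda>k::nat. (\<alpha> - \<mu> - of_nat k, \<beta> + \<mu> + of_nat k)"
  obtain K where G: "G f (a - \<alpha> + \<mu>) (b - \<beta> - \<mu>) v
      = (\<Sum>k<K. qs (fps_nth f k) (F (a - \<alpha> + \<mu> + of_nat k) (b - \<beta> - \<mu> - of_nat k) v))"
    and K: "\<And>k a. k \<ge> K \<Longrightarrow> F a (b - \<beta> - \<mu> - of_nat k) v = 0"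
    using eventually_happens'[OF _ eventually_conj[OF G_eventually[OF v, of "b - \<beta> - \<mu>"]
       eventually_all_ge_at_top[OF F_vanish[OF v, of "b - \<beta> - \<mu>"]]]] by auto
  have "series_times scale (monom_mult \<alpha> \<beta> (ratio_series (shifted_fps \<mu> f))) (op_product A B) a b v
    = sum ?g (?\<kappa> ` {..<K})"
    unfolding series_times_def
  proof (rule Sum_any.expand_superset)
    show "{p. ?g p \<noteq> 0} \<subseteq> ?\<kappa> ` {..<K}"
    proof
      fix p assume "p \<in> {p. ?g p \<noteq> 0}"
      moreover obtain i j where p: "p = (i, j)" by (cases p)
      ultimately have nz: "monom_mult \<alpha> \<beta> (ratio_series (shifted_fps \<mu> f)) i j \<noteq> 0" "F (a - i) (b - j) v \<noteq> 0"
        by (auto simp: op_product_def F_def)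
      then have ij: "i - \<alpha> = - (j - \<beta>)" "j - \<beta> - \<mu> \<in> \<nat>"
        by (auto simp: monom_mult_def ratio_series_def shifted_fps_def split: if_splits)
      from ij(2) obtain k :: nat where k: "j - \<beta> - \<mu> = of_nat k" by (auto elim: Nats_cases)
      then have j: "j = \<beta> + \<mu> + of_nat k" "i = \<alpha> - \<mu> - of_nat k" using ij(1) by (auto simp: algebra_simps)
      have "k < K" using K[of k "a - i"] nz(2) by (force simp: j algebra_simps not_less[symmetric])
      then show "p \<in> ?\<kappa> ` {..<K}" using p j by auto
    qed
  qed simp
  also have "\<dots> = (\<Sum>k<K. ?g (?\<kappa> k))"
    by (subst sum.reindex) (auto simp: inj_on_def)
  also have "\<dots> = G f (a - \<alpha> + \<mu>) (b - \<beta> - \<mu>) v"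
    unfolding G
    by (intro sum.cong refl)
      (simp add: monom_mult_def ratio_series_def shifted_fps_def op_product_def F_def qs_def algebra_simps)
  finally show ?thesis .
qed

text \<open>On highest weight vectors \<psi>(z_1) \<phi>(z_2) becomes U(z_2/z_1) by
  \<open>two_point\<close>, so the product with f is a Cauchy product. Negative m would reach below
  the top weight of the middle module.\<close>

lemma G_top:
  assumes U: "bpz_rec t \<tau> \<eta> U" and nres: "\<tau> \<notin> \<int>"
  shows "G f (\<eta> - of_int m) (h1 - h - D + of_int m) w = qs (icoeff (f * U) m) w2"
proof -
  have F0: "F a (h1 - h - D + of_int m - of_nat k) w = 0" if "int k > m" for k a
  proof -
    have "B (h1 - h - D + of_int m - of_nat k) w = 0"
    proof (rule B.T.weight_zero[OF B.B_ws[OF B.S.w_ws]])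
      fix l :: nat
      have "(of_int m :: rat) < of_nat k" using that by (metis of_int_less_iff of_int_of_nat_eq)
      then show "h + (h1 - h - D + of_int m - of_nat k) + D \<noteq> h1 + of_nat l" by simp
    qed
    then show ?thesis by (simp add: F_def linear_between_zero[OF B.T.subspace_V A.B_linear])
  qed
  obtain K where G: "G f (\<eta> - of_int m) (h1 - h - D + of_int m) w
    = (\<Sum>k<K. qs (fps_nth f k) (F (\<eta> - of_int m + of_nat k) (h1 - h - D + of_int m - of_nat k) w))"
    and K: "K \<ge> Suc (nat m)"
    using eventually_happens'[OF _ eventually_conj[OF G_eventually[OF B.S.w_V, of "h1 - h - D + of_int m"]
       eventually_ge_at_top[of "Suc (nat m)"]]] by auto
  show ?thesis
  proof (cases "m < 0")
    case True
    then show ?thesis unfolding G by (auto simp: F0 icoeff_def intro!: sum.neutral)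
  next
    case False
    define l where "l = nat m"
    have m: "m = int l" using False by (simp add: l_def)
    have "G f (\<eta> - of_int m) (h1 - h - D + of_int m) w
      = (\<Sum>k=0..l. qs (fps_nth f k) (F (\<eta> - of_int m + of_nat k) (h1 - h - D + of_int m - of_nat k) w))"
      unfolding G by (rule sum.mono_neutral_right) (use K F0[unfolded m] in \<open>auto simp: m\<close>)
    also have "\<dots> = (\<Sum>k=0..l. qs (fps_nth f k * fps_nth U (l - k)) w2)"
    proof (rule sum.cong[OF refl])
      fix k assume "k \<in> {0..l}"
      then have e: "\<eta> - of_int m + of_nat k = \<eta> - of_nat (l - k)"
          "h1 - h - D + of_int m - of_nat k = h1 - h - D + of_nat (l - k)"
        by (simp_all add: m of_nat_diff)
      have "F (\<eta> - of_int m + of_nat k) (h1 - h - D + of_int m - of_nat k) w = qs (fps_nth U (l - k)) w2"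
        unfolding F_def e using two_point[OF U nres, of "l - k"] by (simp add: B.desc_def)
      then show "qs (fps_nth f k) (F (\<eta> - of_int m + of_nat k) (h1 - h - D + of_int m - of_nat k) w)
         = qs (fps_nth f k * fps_nth U (l - k)) w2" by simp
    qed
    also have "\<dots> = qs (icoeff (f * U) m) w2"
      by (simp add: icoeff_def m fps_mult_nth qs_sum_left)
    finally show ?thesis .
  qed
qed

lemma G_top_zero:
  assumes "b - (h1 - h - D) \<notin> \<int>"
  shows "G f a b w = 0"
proof -
  have "F a' (b - of_nat k) w = 0" for a' and k :: nat
  proof -
    have "B (b - of_nat k) w = 0"
    proof (rule B.T.weight_zero[OF B.B_ws[OF B.S.w_ws]])
      fix l :: nat
      show "h + (b - of_nat k) + D \<noteq> h1 + of_nat l"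
      proof
        assume "h + (b - of_nat k) + D = h1 + of_nat l"
        then have "b - (h1 - h - D) = of_nat (k + l)" by simp
        then show False using assms by (metis Ints_of_nat)
      qed
    qed
    then show ?thesis by (simp add: F_def linear_between_zero[OF B.T.subspace_V A.B_linear])
  qed
  then show ?thesis by (simp add: G_def)
qed

end

section \<open>Products with a power of the difference of the variables\<close>

context complex_vs begin

lemma linear_between_plus:
  "subspace W \<Longrightarrow> linear_between scale V W T \<Longrightarrow> linear_between scale V W T' \<Longrightarrow> linear_between scale V W (\<lambda>v. T v + T' v)"
  unfolding linear_between_def by (auto simp: scale_right_distrib intro: subspace_add)

lemma linear_between_minus:
  "subspace W \<Longrightarrow> linear_between scale V W T \<Longrightarrow> linear_between scale V W T' \<Longrightarrow> linear_between scale V W (\<lambda>v. T v - T' v)"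
  unfolding linear_between_def by (auto simp: scale_right_diff_distrib intro: subspace_diff)

lemma linear_between_qs_id: "subspace V \<Longrightarrow> linear_between scale V V (\<lambda>v. qs c v)"
  unfolding linear_between_def by (auto simp: qs_distribs qs_scale intro: subspace_qs)

lemmas linear_between_intros = linear_between_plus linear_between_minus linear_between_qs_id

end

lemma icoeff_1: "icoeff 1 m = (if m = 0 then 1 else 0)"
  by (auto simp: icoeff_def)

context field_pair begin

text \<open>The coefficients of \<open>z\<^sub>1\<^sup>\<alpha> z\<^sub>2\<^sup>\<beta> f(z\<^sub>2/z\<^sub>1) \<psi>(z\<^sub>1) \<phi>(z\<^sub>2)\<close>.\<close>

definition H :: "rat fps \<Rightarrow> rat \<Rightarrow> rat \<Rightarrow> rat \<Rightarrow> rat \<Rightarrow> 'v \<Rightarrow> 'v" where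
  "H f \<alpha> \<beta> a b v = G f (a - \<alpha>) (b - \<beta>) v"

lemma H_linear: "linear_between scale V V2 (H f \<alpha> \<beta> a b)"
  using G_linear by (simp add: H_def[abs_def])

lemma H_ws: "v \<in> B.S.ws d \<Longrightarrow> H f \<alpha> \<beta> a b v \<in> A.T.ws (d + (a + b - \<alpha> - \<beta> + 2 * D))"
  using G_ws[of v d f "a - \<alpha>" "b - \<beta>"] by (simp add: H_def algebra_simps)

lemma hsum_H: "hsum n (\<lambda>a b. H f \<alpha> \<beta> a b v) a b = hsum n (\<lambda>a b. G f a b v) (a - \<alpha>) (b - \<beta>)"
  using hsum_shift[of n "\<lambda>a b. G f a b v" "- \<alpha>" "- \<beta>" a b] by (simp add: H_def)

text \<open>The prefactor is (z_1 z_2)^\<beta> (z_1 - z_2)^\<gamma> up to a constant; this choice of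
  exponents makes the multipliers in the commutator symmetric under exchange.\<close>

lemma L_H_power:
  fixes c \<gamma> :: rat
  assumes v: "v \<in> V"
  defines "f \<equiv> fps_const c * one_minus_powr \<gamma>"
  shows "L2 n (H f (\<beta> + \<gamma>) \<beta> a b v) = H f (\<beta> + \<gamma>) \<beta> a b (L n v)
    + qs (a - of_int n - \<beta> + (of_int n + 1) * D) (H f (\<beta> + \<gamma>) \<beta> (a - of_int n) b v)
    + qs (b - of_int n - \<beta> + (of_int n + 1) * D) (H f (\<beta> + \<gamma>) \<beta> a (b - of_int n) v)
    - qs \<gamma> (hsum (n + 1) (\<lambda>a b. H f (\<beta> + \<gamma>) \<beta> a b v) a b)"
proof -
  have "theta f = fps_const \<gamma> * f + (1 + geom) * (fps_const (- \<gamma>) * f) + 0"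
    by (simp only: f_def theta_const_mult theta_one_minus_powr fps_const_neg[symmetric])
      (simp add: algebra_simps del: fps_const_mult fps_const_neg)
  note L = L_G_pole[OF v this, of n "a - (\<beta> + \<gamma>)" "b - \<beta>"]
  have s: "a - (\<beta> + \<gamma>) - of_int n = a - of_int n - (\<beta> + \<gamma>)" "b - \<beta> - of_int n = b - of_int n - \<beta>"
     "a - (\<beta> + \<gamma>) - 1 = a - 1 - (\<beta> + \<gamma>)"
    by simp_all
  have c: "qs (a - of_int n - (\<beta> + \<gamma>) + (of_int n + 1) * D + \<gamma>) = qs (a - of_int n - \<beta> + (of_int n + 1) * D)"
    by (rule arg_cong[where f = qs]) simp
  have H0: "H 0 (\<beta> + \<gamma>) \<beta> a b v = 0" for a b by (simp add: H_def G_def)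
  show ?thesis
    using L unfolding G_const[OF v] hsum_qs' s c unfolding hsum_H[symmetric] H_def[symmetric] hsum_step[of n _ a b]
    by (simp add: qs_distribs H0 algebra_simps)
qed

lemma H_top:
  assumes U: "bpz_rec t \<tau> \<eta> U" and nres: "\<tau> \<notin> \<int>"
    and \<beta>: "\<beta> = - (h1 - h - D) + of_int i" and ab: "a + b - \<alpha> - \<beta> + 2 * D = h2 - h"
  shows "H f \<alpha> \<beta> a b w = qs (if b \<in> \<int> then icoeff (f * U) (\<lfloor>b\<rfloor> - i) else 0) w2"
proof (cases "b \<in> \<int>")
  case True
  then obtain m where m: "b = of_int m" by (auto elim: Ints_cases)
  have e: "b - \<beta> = h1 - h - D + of_int (m - i)" "a - \<alpha> = \<eta> - of_int (m - i)"
    using \<beta> ab by (auto simp: m algebra_simps)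
  have "H f \<alpha> \<beta> a b w = qs (icoeff (f * U) (m - i)) w2"
    unfolding H_def e by (rule G_top[OF U nres])
  then show ?thesis by (simp add: m)
next
  case False
  have "b - \<beta> - (h1 - h - D) \<notin> \<int>"
  proof
    assume "b - \<beta> - (h1 - h - D) \<in> \<int>"
    then have "b - \<beta> - (h1 - h - D) + of_int i \<in> \<int>" by (intro Ints_add) auto
    then show False using False \<beta> by simp
  qed
  then show ?thesis using False by (simp add: H_def G_top_zero)
qed

text \<open>One channel suffices here. On the top component the claim is the reflection identity
  \<open>icoeff_palin_fps\<close>.\<close>

lemma anticommute_boundary:
  assumes eq: "h2 = h" "V2 = V" "L2 = L" "w2 = w"
    and \<tau>: "\<tau> = t - 1 - of_nat N" and t: "t \<notin> \<int>" "2 * t \<notin> \<int>" and v: "v \<in> V"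
  defines "\<gamma> \<equiv> 3 * t / 2 - 2" and "\<beta> \<equiv> of_nat N / 2"
  defines "f \<equiv> fps_const (Kcoeff (1 - t) N) * one_minus_powr \<gamma>"
  shows "H f (\<beta> + \<gamma>) \<beta> a b v + H f (\<beta> + \<gamma>) \<beta> b a v = qs (diag (of_nat N - 1) a b) v"
proof -
  define K where "K = H f (\<beta> + \<gamma>) \<beta>"
  define d where "d = diag (of_nat N - 1)"
  define X where "X = (\<lambda>(a, b) v. K a b v + K b a v - qs (d a b) v)"
  define deg where "deg = (\<lambda>(a, b). a + b + 1 - of_nat N :: rat)"
  have nz: "pochhammer (1 - t) N \<noteq> 0" "pochhammer (2 * (1 - t)) N \<noteq> 0"
  proof -
    have "1 - t + of_nat k \<noteq> 0" "2 * (1 - t) + of_nat k \<noteq> 0" for k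
    proof -
      show "1 - t + of_nat k \<noteq> 0"
      proof
        assume "1 - t + of_nat k = 0"
        then have "t = 1 + of_nat k" by simp
        then show False using t(1) by simp
      qed
      show "2 * (1 - t) + of_nat k \<noteq> 0"
      proof
        assume "2 * (1 - t) + of_nat k = 0"
        then have "2 * t = 2 + of_nat k" by (simp add: algebra_simps)
        then show False using t(2) by simp
      qed
    qed
    then show "pochhammer (1 - t) N \<noteq> 0" "pochhammer (2 * (1 - t)) N \<noteq> 0"
      by (auto simp: pochhammer_eq_0_iff eq_neg_iff_add_eq_0)
  qed
  have nres: "\<tau> \<notin> \<int>"
  proof
    assume "\<tau> \<in> \<int>"
    then have "\<tau> + 1 + of_nat N \<in> \<int>" by (intro Ints_add) auto
    moreover have "\<tau> + 1 + of_nat N = t" unfolding \<tau> by simp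
    ultimately show False using t(1) by (simp only:)
  qed
  define U where "U = one_minus_powr (1 - 3 * t / 2) * palin_fps (1 - t) N"
  have e0: "h1 - h - D = - \<beta>" using \<tau> by (simp add: \<beta>_def field_simps)
  have \<eta>: "\<eta> = - (t / 4 + \<tau> / 2) - D"
    using eq(1) e0 by (simp add: \<tau> \<beta>_def delta21_def field_simps)
  have U: "bpz_rec t \<tau> \<eta> U"
    unfolding \<eta> U_def using bpz_rec_palin_fps[OF nz(1)] unfolding \<tau> .
  \<comment> \<open>The exponent of f exceeds that of the inverse of the power in U by -1, which
    leaves the simple pole.\<close>
  have fU: "f * U = fps_const (Kcoeff (1 - t) N) * (1 + geom) * palin_fps (1 - t) N"
  proof -
    have "one_minus_powr \<gamma> * one_minus_powr (1 - 3 * t / 2) = one_minus_powr (- 1)"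
      by (simp add: \<gamma>_def flip: one_minus_powr_add)
    then have "f * U = fps_const (Kcoeff (1 - t) N) * one_minus_powr (- 1) * palin_fps (1 - t) N"
      unfolding f_def U_def by (simp add: mult.assoc)
    then show ?thesis by (simp only: one_minus_powr_minus_1)
  qed
  have d0: "2 * \<beta> + \<gamma> - 2 * D = of_nat N - 1" by (simp add: \<beta>_def \<gamma>_def delta21_def field_simps)
  have "X (a, b) v = 0"
  proof (rule commuting_family_zero[of X deg])
    show "linear_between scale V V2 (X i)" for i
      unfolding X_def eq(2) K_def
      by (cases i) (auto intro!: linear_between_intros B.S.subspace_V H_linear[unfolded eq(2)])
  next
    fix i
    obtain a b :: rat where i: "i = (a, b)" by (cases i)
    have K: "K a' b' w \<in> A.T.ws (h + deg (a', b'))" for a' b'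
    proof -
      have "h + (a' + b' - (\<beta> + \<gamma>) - \<beta> + 2 * D) = h + deg (a', b')"
        using d0 by (simp add: deg_def)
      then show ?thesis using H_ws[OF B.S.w_ws, of f "\<beta> + \<gamma>" \<beta> a' b'] by (simp only: K_def)
    qed
    have "qs (d a b) w \<in> A.T.ws (h + deg (a, b))"
    proof (cases "d a b = 0")
      case True
      then show ?thesis by (simp add: subspace_0[OF A.T.subspace_ws])
    next
      case False
      then have "deg (a, b) = 0" by (auto simp: d_def diag_def deg_def split: if_splits)
      then show ?thesis using B.S.w_ws unfolding eq by (simp add: subspace_qs[OF B.S.subspace_ws])
    qed
    moreover have "deg (b, a) = deg (a, b)" by (simp add: deg_def)
    ultimately show "X i w \<in> A.T.ws (h + deg i)"
      using K[of a b] K[of b a]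
      by (simp add: X_def i subspace_add[OF A.T.subspace_ws] subspace_diff[OF A.T.subspace_ws])
  next
    fix i n v
    assume v: "v \<in> V" and IH: "\<And>j. deg j = deg i - of_int n \<Longrightarrow> X j v = 0"
    obtain a b :: rat where i: "i = (a, b)" by (cases i)
    define \<delta> where "\<delta> = diag (of_nat N - 1 + of_int n) a b"
    define k where "k x = x - of_int n - \<beta> + (of_int n + 1) * D" for x
    have S: "K a' b' v + K b' a' v = qs (d a' b') v" if "a' + b' = a + b - of_int n" for a' b'
      using IH[of "(a', b')"] that by (simp add: X_def deg_def i)
    have "hsum (n + 1) (\<lambda>a b. K a b v) a b + hsum (n + 1) (\<lambda>a b. K a b v) b a
        = hsum (n + 1) (\<lambda>a b. K a b v + K b a v) a b"
      unfolding hsum_add using hsum_swap[of "n + 1" "\<lambda>a b. K a b v" a b] by simp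
    also have "\<dots> = hsum (n + 1) (\<lambda>a b. qs (d a b) v) a b"
      by (rule hsum_cong) (rule S, simp)
    also have "\<dots> = qs (of_int (n + 1) * \<delta>) v"
      unfolding hsum_qs d_def hsum_diag \<delta>_def by (simp add: algebra_simps)
    finally have hs: "hsum (n + 1) (\<lambda>a b. K a b v) a b + hsum (n + 1) (\<lambda>a b. K a b v) b a = qs (of_int (n + 1) * \<delta>) v" .
    have S1: "K (a - of_int n) b v + K b (a - of_int n) v = qs \<delta> v"
      using S[of "a - of_int n" b] by (simp add: d_def diag_shift \<delta>_def)
    have S2: "K a (b - of_int n) v + K (b - of_int n) a v = qs \<delta> v"
      using S[of a "b - of_int n"] by (simp add: d_def diag_shift2 \<delta>_def)
    \<comment> \<open>The delta function satisfies the same commutator relation: on its support a +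
      b = N - 1 + n, and \<gamma> = 2 \<Delta>_{2,1} - 1.\<close>
    have z: "(k a + k b - \<gamma> * of_int (n + 1)) * \<delta> = 0"
      by (auto simp: \<delta>_def diag_def k_def \<beta>_def \<gamma>_def delta21_def field_simps)
    have LK: "L2 n (K a b v) = K a b (L n v) + qs (k a) (K (a - of_int n) b v) + qs (k b) (K a (b - of_int n) v)
        - qs \<gamma> (hsum (n + 1) (\<lambda>a b. K a b v) a b)" for a b
      unfolding K_def f_def k_def by (rule L_H_power[OF v])
    have V2: "K a b v \<in> V2" "K b a v \<in> V2"
      by (simp_all add: K_def linear_between_in[OF H_linear v])
    have vV2: "v \<in> V2" using v eq(2) by simp
    have "L2 n (X i v) = L2 n (K a b v) + L2 n (K b a v) - qs (d a b) (L n v)"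
      using V2 vV2 by (simp add: X_def i A.T.L_diff A.T.L_add A.T.L_qs A.T.V_closed) (simp add: eq(3))
    also have "\<dots> = X i (L n v) + (qs (k a) (K (a - of_int n) b v + K b (a - of_int n) v)
        + qs (k b) (K a (b - of_int n) v + K (b - of_int n) a v)
        - qs \<gamma> (hsum (n + 1) (\<lambda>a b. K a b v) a b + hsum (n + 1) (\<lambda>a b. K a b v) b a))"
      unfolding LK by (simp add: X_def i qs_distribs)
    also have "\<dots> = X i (L n v) + qs ((k a + k b - \<gamma> * of_int (n + 1)) * \<delta>) v"
      unfolding S1 S2 hs by (simp add: qs_distribs algebra_simps)
    finally show "L2 n (X i v) = X i (L n v)"
      unfolding z by simp
  next
    fix i assume deg: "deg i = h2 - h"
    obtain a b :: rat where i: "i = (a, b)" by (cases i)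
    have ab: "a + b = of_nat N - 1" using deg eq(1) by (simp add: deg_def i)
    have top: "K a' b' w = qs (if b' \<in> \<int> then icoeff (f * U) \<lfloor>b'\<rfloor> else 0) w" if "a' + b' = of_nat N - 1" for a' b'
      using H_top[OF U nres, of \<beta> 0 a' b' "\<beta> + \<gamma>" f] that d0 e0 eq by (simp add: K_def)
    show "X i w = 0"
    proof (cases "b \<in> \<int>")
      case True
      then obtain m where m: "b = of_int m" by (auto elim: Ints_cases)
      have a: "a = of_int (int N - 1 - m)" using ab by (simp add: m)
      have "icoeff (f * U) m + icoeff (f * U) (int N - 1 - m) = 1"
        unfolding fU by (rule icoeff_palin_fps) (rule nz)+
      moreover have "K a b w = qs (icoeff (f * U) m) w" "K b a w = qs (icoeff (f * U) (int N - 1 - m)) w"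
        using top[of a b] top[of b a] ab by (simp_all add: m a add.commute)
      moreover have "d a b = 1" using ab a by (simp add: d_def diag_def)
      ultimately show ?thesis by (simp add: X_def i flip: qs_left_distrib)
    next
      case False
      have "a \<notin> \<int>"
      proof
        assume "a \<in> \<int>"
        then have "of_nat N - 1 - a \<in> \<int>" by (intro Ints_diff) auto
        moreover have "b = of_nat N - 1 - a" using ab by simp
        ultimately show False using False by simp
      qed
      then show ?thesis
        using False top[of a b] top[of b a] ab by (simp add: X_def i d_def diag_def add.commute)
    qed
  qed (rule v)
  then show ?thesis by (simp add: X_def K_def d_def)
qed

text \<open>On the top component f cancels the two-point function, and the constant 1 is symmetric.
  \<beta> cancels the leading exponent of \<phi>(z_2) w.\<close>

lemma commute_same_sign:
  assumes \<eta>: "\<eta> = (\<tau> + 1) / 2" and nres: "\<tau> \<notin> \<int>" and v: "v \<in> V"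
  defines "\<beta> \<equiv> (t - 1) / 2 - \<tau> / 2"
  shows "H (one_minus_powr (- t / 2)) (\<beta> - t / 2) \<beta> a b v = H (one_minus_powr (- t / 2)) (\<beta> - t / 2) \<beta> b a v"
proof -
  define f where "f = one_minus_powr (- t / 2)"
  define K where "K = H f (\<beta> - t / 2) \<beta>"
  define X where "X = (\<lambda>(a, b) v. K a b v - K b a v)"
  define deg where "deg = (\<lambda>(a, b). a + b - (\<beta> - t / 2) - \<beta> + 2 * D :: rat)"
  have U: "bpz_rec t \<tau> \<eta> (one_minus_powr (t / 2))"
    unfolding \<eta> by (rule bpz_rec_one_minus_powr)
  have fU: "f * one_minus_powr (t / 2) = 1"
    by (simp add: f_def flip: one_minus_powr_add)
  have "X (a, b) v = 0"
  proof (rule commuting_family_zero[of X deg])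
    show "linear_between scale V V2 (X i)" for i
      unfolding X_def K_def
      by (cases i) (auto intro!: linear_between_minus A.T.subspace_V H_linear)
  next
    fix i
    obtain a b :: rat where i: "i = (a, b)" by (cases i)
    have "K a' b' w \<in> A.T.ws (h + deg (a', b'))" for a' b'
      using H_ws[OF B.S.w_ws, of f "\<beta> - t / 2" \<beta> a' b'] by (simp only: K_def deg_def prod.case)
    from this[of a b] this[of b a] have "K a b w - K b a w \<in> A.T.ws (h + deg (a, b))"
      by (simp add: deg_def add.left_commute[of b a] subspace_diff[OF A.T.subspace_ws])
    then show "X i w \<in> A.T.ws (h + deg i)" by (simp add: X_def i)
  next
    fix i n v
    assume v: "v \<in> V" and IH: "\<And>j. deg j = deg i - of_int n \<Longrightarrow> X j v = 0"
    obtain a b :: rat where i: "i = (a, b)" by (cases i)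
    define k where "k x = x - of_int n - \<beta> + (of_int n + 1) * D" for x
    have S: "K a' b' v = K b' a' v" if "a' + b' = a + b - of_int n" for a' b'
      using IH[of "(a', b')"] that by (simp add: X_def deg_def i)
    have hs: "hsum (n + 1) (\<lambda>a b. K a b v) b a = hsum (n + 1) (\<lambda>a b. K a b v) a b"
      unfolding hsum_swap[of "n + 1" "\<lambda>a b. K a b v" a b, symmetric]
      by (rule hsum_cong) (rule S, simp)
    have "f = fps_const 1 * one_minus_powr (- (t / 2))" "\<beta> - t / 2 = \<beta> + - (t / 2)" by (simp_all add: f_def)
    then have LK: "L2 n (K a b v) = K a b (L n v) + qs (k a) (K (a - of_int n) b v) + qs (k b) (K a (b - of_int n) v)
        - qs (- (t / 2)) (hsum (n + 1) (\<lambda>a b. K a b v) a b)" for a b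
      unfolding K_def k_def using L_H_power[OF v, of n 1 "- (t / 2)"] by simp
    have V2: "K a b v \<in> V2" "K b a v \<in> V2"
      using v by (simp_all add: K_def linear_between_in[OF H_linear])
    have "L2 n (X i v) = L2 n (K a b v) - L2 n (K b a v)"
      using V2 by (simp add: X_def i A.T.L_diff)
    then show "L2 n (X i v) = X i (L n v)"
      unfolding LK hs using S[of "a - of_int n" b] S[of a "b - of_int n"] by (simp add: X_def i)
  next
    fix i assume deg: "deg i = h2 - h"
    obtain a b :: rat where i: "i = (a, b)" by (cases i)
    have e0: "\<beta> = - (h1 - h - D)" by (simp add: \<beta>_def field_simps)
    have h2: "h2 - h = 2 * D + (t / 2 - 2 * \<beta>)"
      using \<eta> e0 by (simp add: \<beta>_def delta21_def field_simps)
    then have ab: "a + b = 0" using deg by (simp add: deg_def i)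
    have top: "K a' b' w = qs (if b' = 0 then 1 else 0) w2" if "a' + b' = 0" for a' b'
      using H_top[OF U nres, of \<beta> 0 a' b' "\<beta> - t / 2" f] that e0 h2
      by (auto simp: K_def fU icoeff_1 elim!: Ints_cases)
    have "a = - b" using ab by simp
    then show "X i w = 0"
      using top[of a b] top[of b a] by (simp add: X_def i)
  qed (rule v)
  then show ?thesis by (simp add: X_def K_def f_def)
qed

end

section \<open>Commutators in the hypergeometric case\<close>

lemma hsum_mult: "hsum n (\<lambda>a b. c * f a b) a b = c * hsum n f a b" for c :: rat
  by (simp add: hsum_def sum_distrib_left)

context complex_vs begin

text \<open>
  \<open>EF\<close> and \<open>EG\<close> are the commutators of \<open>L\<^sub>n\<close> with the products formed with \<open>f\<close> and \<open>g\<close>. Both are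
  invariant under the exchange of the variables.
\<close>

definition EF :: "rat \<Rightarrow> int \<Rightarrow> (rat \<Rightarrow> rat \<Rightarrow> 'v) \<Rightarrow> (rat \<Rightarrow> rat \<Rightarrow> 'v) \<Rightarrow> rat \<Rightarrow> rat \<Rightarrow> 'v" where
  "EF d n F G a b = qs (a - of_int n + of_int n * d) (F (a - of_int n) b)
     + qs (b - of_int n + of_int n * d) (F a (b - of_int n))
     + hsum (n + 1) F a b + hsum n G a b"

definition EG :: "rat \<Rightarrow> rat \<Rightarrow> rat \<Rightarrow> int \<Rightarrow> (rat \<Rightarrow> rat \<Rightarrow> 'v) \<Rightarrow> (rat \<Rightarrow> rat \<Rightarrow> 'v) \<Rightarrow> rat \<Rightarrow> rat \<Rightarrow> 'v" where
  "EG d t k n F G a b = qs (a - of_int n + of_int n * d) (G (a - of_int n) b)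
     + qs (b - of_int n + of_int n * d) (G a (b - of_int n))
     - qs (t / 2) (hsum n G (a - 1) b + hsum n G a (b - 1))
     + qs k (F (a - 1 - of_int n) b - F (a - of_int n) (b - 1) - F (a - 1) (b - of_int n) + F a (b - 1 - of_int n))
     - qs (d * (4 - t)) (hsum n F (a - 1) (b - 1))"

lemma EF_add: "EF d n (\<lambda>a b. F a b + F' a b) (\<lambda>a b. G a b + G' a b) a b = EF d n F G a b + EF d n F' G' a b"
  by (simp add: EF_def hsum_add qs_distribs algebra_simps)

lemma EG_add: "EG d t k n (\<lambda>a b. F a b + F' a b) (\<lambda>a b. G a b + G' a b) a b = EG d t k n F G a b + EG d t k n F' G' a b"
  by (simp add: EG_def hsum_add qs_distribs algebra_simps)

lemma EF_swap: "EF d n (\<lambda>a b. F b a) (\<lambda>a b. G b a) a b = EF d n F G b a"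
  by (simp add: EF_def hsum_swap[of _ F] hsum_swap[of _ G])

lemma EG_swap: "EG d t k n (\<lambda>a b. F b a) (\<lambda>a b. G b a) a b = EG d t k n F G b a"
  unfolding EG_def hsum_swap[of _ F] hsum_swap[of _ G] by (simp add: qs_distribs algebra_simps)

lemma EF_cong:
  assumes "\<And>a' b'. a' + b' = a + b - of_int n \<Longrightarrow> F a' b' = F' a' b'"
    and "\<And>a' b'. a' + b' = a + b + 1 - of_int n \<Longrightarrow> G a' b' = G' a' b'"
  shows "EF d n F G a b = EF d n F' G' a b"
proof -
  have "hsum (n + 1) F a b = hsum (n + 1) F' a b" "hsum n G a b = hsum n G' a b"
    by (rule hsum_cong; use assms in simp)+
  then show ?thesis using assms(1) by (simp add: EF_def)
qed

lemma EG_cong: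
  assumes "\<And>a' b'. a' + b' = a + b - 1 - of_int n \<Longrightarrow> F a' b' = F' a' b'"
    and "\<And>a' b'. a' + b' = a + b - of_int n \<Longrightarrow> G a' b' = G' a' b'"
  shows "EG d t k n F G a b = EG d t k n F' G' a b"
proof -
  have "hsum n F (a - 1) (b - 1) = hsum n F' (a - 1) (b - 1)" "hsum n G (a - 1) b = hsum n G' (a - 1) b"
      "hsum n G a (b - 1) = hsum n G' a (b - 1)"
    by (rule hsum_cong; use assms in simp)+
  then show ?thesis using assms by (simp add: EG_def)
qed

text \<open>With z_1 = z_2 the commutator is multiplication by a number, which is 0 on the support a
  + b = n - 1.\<close>

lemma EF_diag:
  "EF d n (\<lambda>a b. qs (diag (- 1) a b) v) (\<lambda>a b. qs (- 2 * d * diag 0 a b) v) a b = 0"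
proof -
  define \<delta> where "\<delta> = diag (of_int n - 1) a b"
  have "EF d n (\<lambda>a b. qs (diag (- 1) a b) v) (\<lambda>a b. qs (- 2 * d * diag 0 a b) v) a b
     = qs ((a - of_int n + of_int n * d + (b - of_int n + of_int n * d) + of_int (n + 1) - 2 * d * of_int n) * \<delta>) v"
    unfolding EF_def hsum_qs hsum_mult hsum_diag diag_shift diag_shift2 qs_simps(4) qs_distribs(1,2)[symmetric]
    by (intro arg_cong2[where f = qs] refl) (simp add: \<delta>_def algebra_simps)
  also have "(a - of_int n + of_int n * d + (b - of_int n + of_int n * d) + of_int (n + 1) - 2 * d * of_int n) * \<delta> = 0"
    by (auto simp: \<delta>_def diag_def algebra_simps)
  finally show ?thesis by simp
qed

text \<open>The four terms with k cancel on a delta function; the rest is a multiple of 3t - 2 -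
  4d.\<close>

lemma EG_diag:
  assumes "4 * d = 3 * t - 2"
  shows "EG d t k n (\<lambda>a b. qs (diag (- 1) a b) v) (\<lambda>a b. qs (- 2 * d * diag 0 a b) v) a b = 0"
proof -
  define \<delta> where "\<delta> = diag (of_int n) a b"
  have s: "a - 1 - of_int n = a - of_int (n + 1)" "b - 1 - of_int n = b - of_int (n + 1)" by simp_all
  have "EG d t k n (\<lambda>a b. qs (diag (- 1) a b) v) (\<lambda>a b. qs (- 2 * d * diag 0 a b) v) a b
     = qs ((- 2 * d * (a - of_int n + of_int n * d + (b - of_int n + of_int n * d)) + 2 * d * t * of_int n
          - d * (4 - t) * of_int n) * \<delta>) v"
    unfolding EG_def hsum_qs hsum_mult hsum_diag s diag_shift diag_shift2 diag_shift' qs_distribs(1,2)[symmetric] qs_simps(4)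
    by (intro arg_cong2[where f = qs] refl) (simp add: \<delta>_def algebra_simps)
  also have "(- 2 * d * (a - of_int n + of_int n * d + (b - of_int n + of_int n * d)) + 2 * d * t * of_int n
          - d * (4 - t) * of_int n) * \<delta> = 0"
  proof (cases "\<delta> = 0")
    case False
    then have b: "b = of_int n - a" by (auto simp: \<delta>_def diag_def split: if_splits)
    have "- 2 * d * (a - of_int n + of_int n * d + (b - of_int n + of_int n * d)) + 2 * d * t * of_int n
          - d * (4 - t) * of_int n = d * of_int n * (3 * t - 2 - 4 * d)"
      unfolding b by (simp add: algebra_simps)
    then show ?thesis using assms by simp
  qed simp
  finally show ?thesis by simp
qed

end

text \<open>From the two forms of the step. It trades z_1 for z_2 in front of \<open>hsum\<close>,
  which is how the commutators are brought to symmetric form.\<close>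

lemma hsum_move: "hsum n f a (b - 1) = hsum n f (a - 1) b + f a (b - of_int n) - f (a - of_int n) b"
  using hsum_step[of n f a b] hsum_step'[of n f a b] by (simp add: algebra_simps)

context field_pair begin

text \<open>The prefactor combines (z_1 z_2)^\<Delta> z_1^(-1) with (z_2/z_1)^(-\<lambda>). The f in
  the pole term and the shift l - 1 due to z_1^(-1) combine to the symmetric
  \<open>hsum (n + 1)\<close>.\<close>

lemma L_H_f:
  assumes v: "v \<in> V" and f: "theta f = fps_const (l - 1) * f + (1 + geom) * (g + f)"
  shows "L2 n (H f (D - 1 + l) (D - l) a b v) = H f (D - 1 + l) (D - l) a b (L n v)
     + EF D n (\<lambda>a b. H f (D - 1 + l) (D - l) a b v) (\<lambda>a b. H g (D + l) (D - l) a b v) a b"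
proof -
  have "theta f = fps_const (l - 1) * f + (1 + geom) * (g + f) + 0" using f by simp
  note L = L_G_pole[OF v this, of n "a - (D - 1 + l)" "b - (D - l)"]
  have s: "a - (D - 1 + l) - of_int n = a - of_int n - (D - 1 + l)" "b - (D - l) - of_int n = b - of_int n - (D - l)"
    by simp_all
  have hg: "hsum n (\<lambda>a b. G g a b v) (a - (D - 1 + l) - 1) (b - (D - l)) = hsum n (\<lambda>a b. H g (D + l) (D - l) a b v) a b"
    unfolding hsum_H by (simp add: algebra_simps)
  have hf: "hsum n (\<lambda>a b. G f a b v) (a - (D - 1 + l) - 1) (b - (D - l))
      = hsum n (\<lambda>a b. H f (D - 1 + l) (D - l) a b v) (a - 1) b"
    unfolding hsum_H by (simp add: algebra_simps)
  have c: "qs (a - of_int n - (D - 1 + l) + (of_int n + 1) * D + (l - 1)) = qs (a - of_int n + of_int n * D)"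
    "qs (b - of_int n - (D - l) + (of_int n + 1) * D - (l - 1)) = qs (b - of_int n + of_int n * D + 1)"
    by (simp_all add: algebra_simps)
  have G0: "H 0 (D - 1 + l) (D - l) a b v = 0" for a b by (simp add: H_def G_def)
  show ?thesis
    using L unfolding G_add[OF v] hsum_add s hg hf c EF_def H_def[of f, symmetric] H_def[of 0, symmetric] G0 hsum_step[of n _ a b]
    by (simp add: qs_distribs algebra_simps)
qed

text \<open>The regular term with \<open>D * (4 - t)\<close> compensates for moving the
  \<open>hsum\<close> of f to the symmetric position (a - 1, b - 1).\<close>

lemma L_H_g:
  assumes v: "v \<in> V"
    and g: "theta g = fps_const (l + t / 2) * g + (1 + geom) * (fps_const (- t) * g + fps_const (- (D * (4 - t))) * f)
       + (fps_const k * (f - fps_X * f) + fps_const (D * (4 - t)) * f)"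
  shows "L2 n (H g (D + l) (D - l) a b v) = H g (D + l) (D - l) a b (L n v)
     + EG D t k n (\<lambda>a b. H f (D - 1 + l) (D - l) a b v) (\<lambda>a b. H g (D + l) (D - l) a b v) a b"
proof -
  define e where "e = D * (4 - t)"
  note L = L_G_pole[OF v g, of n "a - (D + l)" "b - (D - l)", folded e_def]
  have s: "a - (D + l) - of_int n = a - of_int n - (D + l)" "b - (D - l) - of_int n = b - of_int n - (D - l)"
    "a - (D + l) - 1 = a - 1 - (D + l)"
    by simp_all
  have hf: "hsum n (\<lambda>a b. G f a b v) (a - 1 - (D + l)) (b - (D - l))
      = hsum n (\<lambda>a b. H f (D - 1 + l) (D - l) a b v) (a - 1 - 1) b"
    unfolding hsum_H by (simp add: algebra_simps)
  have Gf: "G f (x - (D + l)) (y - (D - l)) v = H f (D - 1 + l) (D - l) (x - 1) y v" for x y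
    by (simp add: H_def algebra_simps)
  have Gf': "G f (x - (D + l) + 1) (y - (D - l) - 1) v = H f (D - 1 + l) (D - l) x (y - 1) v" for x y
    by (simp add: H_def algebra_simps)
  have c: "qs (a - of_int n - (D + l) + (of_int n + 1) * D + (l + t / 2)) = qs (a - of_int n + of_int n * D + t / 2)"
    "qs (b - of_int n - (D - l) + (of_int n + 1) * D - (l + t / 2)) = qs (b - of_int n + of_int n * D - t / 2)"
    by (simp_all add: algebra_simps)
  have sw: "a - 1 - of_int n = a - of_int n - 1" "b - 1 - of_int n = b - of_int n - 1" by simp_all
  \<comment> \<open>Half of the term stays at a - 1, the other half moves to b - 1; the t/2 in the
    coefficient of g pays for the move.\<close>
  have tt: "qs (- t) x = - qs (t / 2) x - qs (t / 2) x" for x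
  proof -
    have "qs t x = qs (t / 2) x + qs (t / 2) x" by (simp flip: qs_left_distrib)
    then show ?thesis by simp
  qed
  show ?thesis
    using L unfolding G_add[OF v] G_diff[OF v] G_const[OF v] G_X[OF v] hsum_add hsum_qs' s hf hsum_H[of n g, symmetric] Gf Gf' c
      EG_def H_def[of g, symmetric] e_def[symmetric] hsum_move sw unfolding tt
    by (simp add: qs_distribs algebra_simps)
qed

end

text \<open>The equation of Y is rewritten with Y = (1 - z) f and Y z/(1 - z)^2 = f/(1 - z) - f,
  sorted into a simple pole at z = 1 and a regular part as \<open>L_G_pole\<close> requires.\<close>

lemma theta_f_g:
  fixes t :: rat and r s \<sigma> :: int
  assumes \<sigma>: "\<sigma> \<in> {1, - 1}" and \<rho>: "rho t r s \<notin> \<int>"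
    and U: "bpz_rec t (of_int \<sigma> * rho t r s) (- lam t \<sigma> r s - delta21 t) U"
  defines "l \<equiv> lam t \<sigma> r s" and "k \<equiv> (rho t r s / 2)\<^sup>2 - (t / 4)\<^sup>2"
  defines "f \<equiv> one_minus_powr (- 1) * ycheck_fps t \<sigma> r s"
    and "g \<equiv> theta (ycheck_fps t \<sigma> r s) - fps_const (lam t \<sigma> r s) * ycheck_fps t \<sigma> r s"
  shows "theta f = fps_const (l - 1) * f + (1 + geom) * (g + f)"
    and "theta g = fps_const (l + t / 2) * g + (1 + geom) * (fps_const (- t) * g + fps_const (- (delta21 t * (4 - t))) * f)
       + (fps_const k * (f - fps_X * f) + fps_const (delta21 t * (4 - t)) * f)"
proof -
  define Y where "Y = ycheck_fps t \<sigma> r s"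
  have f: "f = (1 + geom) * Y" by (simp add: f_def one_minus_powr_minus_1 Y_def)
  have g: "theta Y = g + fps_const l * Y" by (simp add: g_def l_def Y_def)
  have l1: "fps_const (l - 1) = fps_const l - 1" by (simp only: fps_const_simps_rat fps_const_1_eq_1)
  show "theta f = fps_const (l - 1) * f + (1 + geom) * (g + f)"
    unfolding f theta_mult g l1 by (simp add: theta_geom algebra_simps)
  have Yf: "Y = f - fps_X * f"
    using one_minus_X_geom unfolding f by (metis left_diff_distrib mult.assoc mult_1)
  have Ygf: "Y * geom + Y * (geom * geom) = (1 + geom) * f - f"
    unfolding f by (simp add: algebra_simps)
  have sq: "(of_int \<sigma> * rho t r s / 2)\<^sup>2 - (t / 4)\<^sup>2 = k"
    using \<sigma> by (auto simp: k_def power2_eq_square)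
  have c: "(6 * (t / 4) - 1) * (2 - 2 * (t / 4)) = delta21 t * (4 - t)" "2 * (t / 4) = t / 2"
    by (simp_all add: delta21_def field_simps)
  have "theta g = fps_const l * g - fps_const (t / 2) * (g + 2 * (g * geom)) + fps_const k * Y
      - fps_const (delta21 t * (4 - t)) * (Y * geom + Y * (geom * geom))"
    using ycheck_system(1)[OF \<sigma> \<rho> U] unfolding sq c(1) unfolding c(2) by (simp only: g_def l_def Y_def)
  also have "\<dots> = fps_const l * g - fps_const (t / 2) * (g + 2 * (g * geom)) + fps_const k * (f - fps_X * f)
      - fps_const (delta21 t * (4 - t)) * ((1 + geom) * f - f)"
    unfolding Ygf by (simp only: Yf[symmetric])
  also have "\<dots> = fps_const (l + t / 2) * g + (1 + geom) * (fps_const (- t) * g + fps_const (- (delta21 t * (4 - t))) * f)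
       + (fps_const k * (f - fps_X * f) + fps_const (delta21 t * (4 - t)) * f)"
  proof -
    define T where "T = fps_const (t / 2)"
    define e where "e = fps_const (delta21 t * (4 - t))"
    define c where "c = fps_const k"
    have "fps_const t = fps_const (2 * (t / 2))" by simp
    then have T: "fps_const t = 2 * T" by (simp only: fps_const_simps_rat(3,6) T_def)
    have q: "fps_const (l + t / 2) = fps_const l + T" "fps_const (- t) = - (2 * T)"
      "fps_const (- (delta21 t * (4 - t))) = - e"
      by (simp_all only: fps_const_simps_rat(1,4) T_def[symmetric] e_def[symmetric] T)
    show ?thesis
      unfolding q T_def[symmetric] e_def[symmetric] c_def[symmetric] by (simp add: algebra_simps)
  qed
  finally show "theta g = fps_const (l + t / 2) * g + (1 + geom) * (fps_const (- t) * g + fps_const (- (delta21 t * (4 - t))) * f)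
       + (fps_const k * (f - fps_X * f) + fps_const (delta21 t * (4 - t)) * f)" .
qed

section \<open>The two channels, through r + 1 and r - 1, for generic r\<close>

locale two_pairs = complex_vs scale + P: field_pair scale t h V L w h1 V1 L1 w1 \<phi>1 h V L w \<psi>1 +
    M: field_pair scale t h V L w h3 V3 L3 w3 \<phi>3 h V L w \<psi>3
  for scale :: "complex \<Rightarrow> 'v::ab_group_add \<Rightarrow> 'v" and t h V L w h1 V1 L1 w1 \<phi>1 \<psi>1 h3 V3 L3 w3 \<phi>3 \<psi>3 +
  fixes r s :: int
  assumes \<rho>: "rho t r s \<notin> \<int>"
    and P\<tau>: "2 * (h1 - h - delta21 t) + t - 1 = rho t r s"
    and M\<tau>: "2 * (h3 - h - delta21 t) + t - 1 = - rho t r s"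
begin

abbreviation "D \<equiv> delta21 t"
abbreviation "l \<sigma> \<equiv> lam t \<sigma> r s"

definition f where "f \<sigma> = one_minus_powr (- 1) * ycheck_fps t \<sigma> r s"
definition g where "g \<sigma> = theta (ycheck_fps t \<sigma> r s) - fps_const (lam t \<sigma> r s) * ycheck_fps t \<sigma> r s"

definition HF where
  "HF a b v = P.H (f 1) (D - 1 + l 1) (D - l 1) a b v + M.H (f (-1)) (D - 1 + l (-1)) (D - l (-1)) a b v"

definition HG where
  "HG a b v = P.H (g 1) (D + l 1) (D - l 1) a b v + M.H (g (-1)) (D + l (-1)) (D - l (-1)) a b v"

definition U where "U \<sigma> = Abs_fps (bpz_coeff t (of_int \<sigma> * rho t r s) (- lam t \<sigma> r s - D))"

lemma U: "\<sigma> \<in> {1, - 1} \<Longrightarrow> bpz_rec t (of_int \<sigma> * rho t r s) (- lam t \<sigma> r s - D) (U \<sigma>)"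
  unfolding U_def using \<rho> by (intro bpz_rec_exists) auto

lemma signs: "(1 :: int) \<in> {1, - 1}" "(- 1 :: int) \<in> {1, - 1}"
  by simp_all

lemmas theta_f = theta_f_g(1)[OF _ \<rho> U, folded f_def g_def]
lemmas theta_g = theta_f_g(2)[OF _ \<rho> U, folded f_def g_def]

abbreviation "k \<equiv> (rho t r s / 2)\<^sup>2 - (t / 4)\<^sup>2"

lemma HF_linear: "linear_between scale V V (HF a b)"
  unfolding HF_def[abs_def] by (intro linear_between_plus P.B.S.subspace_V P.H_linear M.H_linear)

lemma HG_linear: "linear_between scale V V (HG a b)"
  unfolding HG_def[abs_def] by (intro linear_between_plus P.B.S.subspace_V P.H_linear M.H_linear)

lemma L_HF:
  assumes v: "v \<in> V"
  shows "L n (HF a b v) = HF a b (L n v) + EF D n (\<lambda>a b. HF a b v) (\<lambda>a b. HG a b v) a b"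
proof -
  have "L n (HF a b v) = L n (P.H (f 1) (D - 1 + l 1) (D - l 1) a b v)
      + L n (M.H (f (-1)) (D - 1 + l (-1)) (D - l (-1)) a b v)"
    unfolding HF_def
    by (intro P.B.S.L_add linear_between_in[OF P.H_linear v] linear_between_in[OF M.H_linear v])
  also have "L n (P.H (f 1) (D - 1 + l 1) (D - l 1) a b v) = P.H (f 1) (D - 1 + l 1) (D - l 1) a b (L n v)
     + EF D n (\<lambda>a b. P.H (f 1) (D - 1 + l 1) (D - l 1) a b v) (\<lambda>a b. P.H (g 1) (D + l 1) (D - l 1) a b v) a b"
    by (rule P.L_H_f[OF v theta_f[OF signs(1) signs(1)]])
  also have "L n (M.H (f (-1)) (D - 1 + l (-1)) (D - l (-1)) a b v) = M.H (f (-1)) (D - 1 + l (-1)) (D - l (-1)) a b (L n v)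
     + EF D n (\<lambda>a b. M.H (f (-1)) (D - 1 + l (-1)) (D - l (-1)) a b v) (\<lambda>a b. M.H (g (-1)) (D + l (-1)) (D - l (-1)) a b v) a b"
    by (rule M.L_H_f[OF v theta_f[OF signs(2) signs(2)]])
  finally show ?thesis
    unfolding HF_def HG_def EF_add by (simp only: add_ac)
qed

lemma L_HG:
  assumes v: "v \<in> V"
  shows "L n (HG a b v) = HG a b (L n v) + EG D t k n (\<lambda>a b. HF a b v) (\<lambda>a b. HG a b v) a b"
proof -
  have "L n (HG a b v) = L n (P.H (g 1) (D + l 1) (D - l 1) a b v)
      + L n (M.H (g (-1)) (D + l (-1)) (D - l (-1)) a b v)"
    unfolding HG_def
    by (intro P.B.S.L_add linear_between_in[OF P.H_linear v] linear_between_in[OF M.H_linear v])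
  also have "L n (P.H (g 1) (D + l 1) (D - l 1) a b v) = P.H (g 1) (D + l 1) (D - l 1) a b (L n v)
     + EG D t k n (\<lambda>a b. P.H (f 1) (D - 1 + l 1) (D - l 1) a b v) (\<lambda>a b. P.H (g 1) (D + l 1) (D - l 1) a b v) a b"
    by (rule P.L_H_g[OF v theta_g[OF signs(1) signs(1)]])
  also have "L n (M.H (g (-1)) (D + l (-1)) (D - l (-1)) a b v) = M.H (g (-1)) (D + l (-1)) (D - l (-1)) a b (L n v)
     + EG D t k n (\<lambda>a b. M.H (f (-1)) (D - 1 + l (-1)) (D - l (-1)) a b v) (\<lambda>a b. M.H (g (-1)) (D + l (-1)) (D - l (-1)) a b v) a b"
    by (rule M.L_H_g[OF v theta_g[OF signs(2) signs(2)]])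
  finally show ?thesis
    unfolding HF_def HG_def EG_add by (simp only: add_ac)
qed

lemma e0: "h1 - h - D = l 1 - D" "h3 - h - D = l (-1) - D"
  using P\<tau> M\<tau> by (simp_all add: lam_def delta21_def field_simps)

lemma U_P: "bpz_rec t P.\<tau> P.\<eta> (U 1)" and U_M: "bpz_rec t M.\<tau> M.\<eta> (U (-1))"
proof -
  have "P.\<eta> = - l 1 - D" "M.\<eta> = - l (-1) - D" using e0 by simp_all
  then show "bpz_rec t P.\<tau> P.\<eta> (U 1)" "bpz_rec t M.\<tau> M.\<eta> (U (-1))"
    using U[of 1] U[of "-1"] unfolding P\<tau> M\<tau> by simp_all
qed

lemma H_top_P: "a + b - \<alpha> - (D - l 1) + 2 * D = 0 \<Longrightarrow>
    P.H y \<alpha> (D - l 1) a b w = qs (if b \<in> \<int> then icoeff (y * U 1) \<lfloor>b\<rfloor> else 0) w"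
  using P.H_top[OF U_P \<rho>[folded P\<tau>], of "D - l 1" 0 a b \<alpha> y] e0 by simp

lemma H_top_M: "a + b - \<alpha> - (D - l (-1)) + 2 * D = 0 \<Longrightarrow>
    M.H y \<alpha> (D - l (-1)) a b w = qs (if b \<in> \<int> then icoeff (y * U (-1)) \<lfloor>b\<rfloor> else 0) w"
proof -
  have "M.\<tau> \<notin> \<int>" unfolding M\<tau> using \<rho> by simp
  note M.H_top[OF U_M this, of "D - l (-1)" 0 a b \<alpha> y]
  moreover assume "a + b - \<alpha> - (D - l (-1)) + 2 * D = 0"
  ultimately show ?thesis using e0 by simp
qed

lemma icoeff_add: "icoeff (x + y) m = icoeff x m + icoeff y m"
  by (simp add: icoeff_def)

text \<open>The factor 1/(1 - z) in f turns the pairing 1 into half of a delta function. The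
  exchanged product supplies the other half, since exactly one of two integers with sum -1 is
  nonnegative.\<close>

lemma HF_top:
  assumes "a + b = - 1"
  shows "HF a b w = qs (if b \<in> \<int> \<and> b \<ge> 0 then 1 else 0) w"
proof -
  have *: "f 1 * U 1 + f (-1) * U (-1) = 1 + geom"
  proof -
    have "f 1 * U 1 + f (-1) * U (-1) = one_minus_powr (- 1) * (\<Sum>\<sigma>\<in>{1,-1}. ycheck_fps t \<sigma> r s * U \<sigma>)"
      by (simp add: f_def algebra_simps)
    then show ?thesis by (simp only: ycheck_pairing(1)[OF \<rho> U] one_minus_powr_minus_1) simp
  qed
  have "HF a b w = qs (if b \<in> \<int> then icoeff (f 1 * U 1 + f (-1) * U (-1)) \<lfloor>b\<rfloor> else 0) w"
    unfolding HF_def using assms by (subst H_top_P, simp, subst H_top_M, simp) (simp add: icoeff_add flip: qs_left_distrib)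
  then show ?thesis unfolding * by (auto simp: icoeff_def geom_nth elim!: Ints_cases)
qed

text \<open>From -\<Delta> (1 + z)/(1 - z). At a = b = 0 both orders contribute -\<Delta>; at other
  integers only one does, with -2 \<Delta>.\<close>

lemma HG_top:
  assumes "a + b = 0"
  shows "HG a b w = qs (if b \<in> \<int> \<and> b \<ge> 0 then - D * (if b = 0 then 1 else 2) else 0) w"
proof -
  define Z where "Z = fps_const (- D) * (1 + 2 * geom)"
  have *: "g 1 * U 1 + g (-1) * U (-1) = Z"
    using ycheck_pairing(2)[OF \<rho> U] by (simp add: g_def Z_def flip: fps_const_neg)
  have n: "fps_nth Z m = - D * (if m = 0 then 1 else 2)" for m
    unfolding Z_def fps_mult_const_double_nth by (simp add: geom_nth)
  have "HG a b w = qs (if b \<in> \<int> then icoeff (g 1 * U 1 + g (-1) * U (-1)) \<lfloor>b\<rfloor> else 0) w"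
    unfolding HG_def using assms by (subst H_top_P, simp, subst H_top_M, simp) (simp add: icoeff_add flip: qs_left_distrib)
  then show ?thesis unfolding * by (auto simp: icoeff_def n elim!: Ints_cases)
qed

lemma H_ws:
  "HF a b w \<in> P.B.S.ws (h + (a + b + 1))" "HG a b w \<in> P.B.S.ws (h + (a + b))"
proof -
  note ws = P.H_ws[OF P.B.S.w_ws] M.H_ws[OF P.B.S.w_ws]
  have e: "a + b - (D - 1 + x) - (D - x) + 2 * D = a + b + 1" "a + b - (D + x) - (D - x) + 2 * D = a + b" for x
    by simp_all
  show "HF a b w \<in> P.B.S.ws (h + (a + b + 1))"
    unfolding HF_def using ws(1)[of "f 1" "D - 1 + l 1" "D - l 1" a b] ws(2)[of "f (-1)" "D - 1 + l (-1)" "D - l (-1)" a b]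
    unfolding e by (rule subspace_add[OF P.B.S.subspace_ws])
  show "HG a b w \<in> P.B.S.ws (h + (a + b))"
    unfolding HG_def using ws(1)[of "g 1" "D + l 1" "D - l 1" a b] ws(2)[of "g (-1)" "D + l (-1)" "D - l (-1)" a b]
    unfolding e by (rule subspace_add[OF P.B.S.subspace_ws])
qed

lemma qs_diag_ws: "qs (diag s' a b * c) w \<in> P.B.S.ws (h + (a + b - s'))"
proof (cases "diag s' a b = 0")
  case False
  then have "a + b = s'" by (auto simp: diag_def split: if_splits)
  then show ?thesis using P.B.S.w_ws by (simp add: subspace_qs[OF P.B.S.subspace_ws])
qed (simp add: subspace_0[OF P.B.S.subspace_ws])

lemma anticommute_bulk:
  assumes v: "v \<in> V"
  shows "HF a b v + HF b a v = qs (diag (- 1) a b) v"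
    and "HG a b v + HG b a v = qs (- 2 * D * diag 0 a b) v"
proof -
  define X where "X = (\<lambda>(i, a, b) v. if i then HF a b v + HF b a v - qs (diag (- 1) a b) v
      else HG a b v + HG b a v - qs (- 2 * D * diag 0 a b) v)"
  \<comment> \<open>The factor z_1^(-1) in f shifts the degree of the first relation by 1.\<close>
  define deg where "deg = (\<lambda>(i, a, b). if i then a + b + 1 else a + b :: rat)"
  have "X i v = 0" for i
  proof (rule P.commuting_family_zero[of X deg])
    show "linear_between scale V V (X i)" for i
    proof -
      obtain j a b where i: "i = (j, a, b)" by (cases i) auto
      show ?thesis
        by (cases j) (auto simp: i X_def intro!: linear_between_intros P.B.S.subspace_V HF_linear HG_linear)
    qed
  next
    fix i
    obtain j :: bool and a b :: rat where i: "i = (j, a, b)" by (cases i) auto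
    show "X i w \<in> P.B.S.ws (h + deg i)"
    proof (cases j)
      case True
      then show ?thesis
        using H_ws(1)[of a b] H_ws(1)[of b a] qs_diag_ws[of "-1" a b 1]
        by (simp add: i X_def deg_def add.left_commute[of b a] add.commute[of b a] subspace_add[OF P.B.S.subspace_ws] subspace_diff[OF P.B.S.subspace_ws])
    next
      case False
      then show ?thesis
        using H_ws(2)[of a b] H_ws(2)[of b a] subspace_diff[OF P.B.S.subspace_ws _ qs_diag_ws[of 0 a b "- 2 * D"]]
        by (simp add: i X_def deg_def add.commute[of b a] subspace_add[OF P.B.S.subspace_ws] mult_ac)
    qed
  next
    fix i n v
    assume v: "v \<in> V" and IH: "\<And>j. deg j = deg i - of_int n \<Longrightarrow> X j v = 0"
    obtain j :: bool and a b :: rat where i: "i = (j, a, b)" by (cases i) auto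
    have in_V: "HF a b v \<in> V" "HG a b v \<in> V" for a b
      by (rule linear_between_in[OF HF_linear v] linear_between_in[OF HG_linear v])+
    have F: "HF a' b' v + HF b' a' v = qs (diag (- 1) a' b') v" if "a' + b' + 1 = deg i - of_int n" for a' b'
      using IH[of "(True, a', b')"] that by (simp add: X_def deg_def)
    have G: "HG a' b' v + HG b' a' v = qs (- 2 * D * diag 0 a' b') v" if "a' + b' = deg i - of_int n" for a' b'
      using IH[of "(False, a', b')"] that by (simp add: X_def deg_def eq_neg_iff_add_eq_0)
    show "L n (X i v) = X i (L n v)"
    proof (cases j)
      case True
      then have deg: "deg i = a + b + 1" by (simp add: deg_def i)
      have "EF D n (\<lambda>a b. HF a b v) (\<lambda>a b. HG a b v) a b + EF D n (\<lambda>a b. HF a b v) (\<lambda>a b. HG a b v) b a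
         = EF D n (\<lambda>a b. HF a b v + HF b a v) (\<lambda>a b. HG a b v + HG b a v) a b"
        unfolding EF_add EF_swap[of D n "\<lambda>a b. HF a b v" "\<lambda>a b. HG a b v"] ..
      also have "\<dots> = EF D n (\<lambda>a b. qs (diag (- 1) a b) v) (\<lambda>a b. qs (- 2 * D * diag 0 a b) v) a b"
        by (rule EF_cong; rule F G; simp add: deg)
      also have "\<dots> = 0" by (rule EF_diag)
      finally have z: "EF D n (\<lambda>a b. HF a b v) (\<lambda>a b. HG a b v) a b + EF D n (\<lambda>a b. HF a b v) (\<lambda>a b. HG a b v) b a = 0" .
      have "L n (X i v) = L n (HF a b v) + L n (HF b a v) - qs (diag (- 1) a b) (L n v)"
        using in_V v True by (simp add: X_def i P.B.S.L_diff P.B.S.L_add P.B.S.L_qs P.B.S.V_closed)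
      also have "\<dots> = X i (L n v) + (EF D n (\<lambda>a b. HF a b v) (\<lambda>a b. HG a b v) a b + EF D n (\<lambda>a b. HF a b v) (\<lambda>a b. HG a b v) b a)"
        unfolding L_HF[OF v] using True by (simp add: X_def i)
      finally show ?thesis unfolding z by simp
    next
      case False
      then have deg: "deg i = a + b" by (simp add: deg_def i)
      have "EG D t k n (\<lambda>a b. HF a b v) (\<lambda>a b. HG a b v) a b + EG D t k n (\<lambda>a b. HF a b v) (\<lambda>a b. HG a b v) b a
         = EG D t k n (\<lambda>a b. HF a b v + HF b a v) (\<lambda>a b. HG a b v + HG b a v) a b"
        unfolding EG_add EG_swap[of D t k n "\<lambda>a b. HF a b v" "\<lambda>a b. HG a b v"] ..
      also have "\<dots> = EG D t k n (\<lambda>a b. qs (diag (- 1) a b) v) (\<lambda>a b. qs (- 2 * D * diag 0 a b) v) a b"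
        by (rule EG_cong; rule F G; simp add: deg)
      also have "\<dots> = 0" by (rule EG_diag) (simp add: delta21_def)
      finally have z: "EG D t k n (\<lambda>a b. HF a b v) (\<lambda>a b. HG a b v) a b + EG D t k n (\<lambda>a b. HF a b v) (\<lambda>a b. HG a b v) b a = 0" .
      have "L n (X i v) = L n (HG a b v) + L n (HG b a v) - qs (- 2 * D * diag 0 a b) (L n v)"
        using in_V v False by (simp add: X_def i P.B.S.L_diff P.B.S.L_add P.B.S.L_qs P.B.S.V_closed del: qs_simps)
      also have "\<dots> = X i (L n v) + (EG D t k n (\<lambda>a b. HF a b v) (\<lambda>a b. HG a b v) a b + EG D t k n (\<lambda>a b. HF a b v) (\<lambda>a b. HG a b v) b a)"
        unfolding L_HG[OF v] using False by (simp add: X_def i)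
      finally show ?thesis unfolding z by simp
    qed
  next
    fix i assume deg: "deg i = h - h"
    obtain j :: bool and a b :: rat where i: "i = (j, a, b)" by (cases i) auto
    show "X i w = 0"
    proof (cases j)
      case True
      then have a: "a = - 1 - b" using deg by (simp add: deg_def i)
      have "a \<in> \<int> \<longleftrightarrow> b \<in> \<int>" unfolding a by (metis Ints_1 Ints_diff Ints_minus diff_diff_eq2 add_diff_cancel_left' diff_minus_eq_add add.commute)
      moreover have "a \<ge> 0 \<longleftrightarrow> \<not> b \<ge> 0" if "b \<in> \<int>"
        using that by (auto simp: a elim!: Ints_cases)
      ultimately show ?thesis
        using True HF_top[of a b] HF_top[of b a] by (auto simp: X_def i diag_def a simp flip: qs_left_distrib)
    next
      case False
      then have a: "a = - b" using deg by (simp add: deg_def i)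
      then show ?thesis
        using False HG_top[of a b] HG_top[of b a] by (auto simp: X_def i diag_def simp flip: qs_left_distrib)
    qed
  qed (rule v)
  from this[of "(True, a, b)"] this[of "(False, a, b)"]
  show "HF a b v + HF b a v = qs (diag (- 1) a b) v" "HG a b v + HG b a v = qs (- 2 * D * diag 0 a b) v"
    by (simp_all add: X_def eq_neg_iff_add_eq_0)
qed

end

section \<open>The relations\<close>

lemma field_pairI:
  assumes "vector_space scale"
    and "irreducible_highest_weight_module scale (central_charge t) h V L w"
    and "irreducible_highest_weight_module scale (central_charge t) h1 V1 L1 w1"
    and "irreducible_highest_weight_module scale (central_charge t) h2 V2 L2 w2"
    and "primary_field scale (delta21 t) h V L w h1 V1 L1 w1 \<phi>"
    and "primary_field scale (delta21 t) h1 V1 L1 w1 h2 V2 L2 w2 \<psi>"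
    and "t \<noteq> 0" and "(h1 - h - delta21 t)\<^sup>2 + (t - 1) * (h1 - h - delta21 t) = t * h"
  shows "field_pair scale t h V L w h1 V1 L1 w1 \<phi> h2 V2 L2 w2 \<psi>"
proof -
  interpret complex_vs scale using assms(1) by (rule complex_vs.intro)
  have "irr_hw scale (central_charge t) h V L w" "irr_hw scale (central_charge t) h1 V1 L1 w1"
     "irr_hw scale (central_charge t) h2 V2 L2 w2"
    by (unfold_locales; fact)+
  then show ?thesis
    using assms(5-8) complex_vs_axioms
    by (intro field_pair.intro field21.intro field.intro hw_pair.intro field_axioms.intro field21_axioms.intro)
qed

lemma euler_op_shifted_fps: "euler_op (shifted_fps \<mu> f) = shifted_fps \<mu> (theta f + fps_const \<mu> * f)"
proof
  fix e
  show "euler_op (shifted_fps \<mu> f) e = shifted_fps \<mu> (theta f + fps_const \<mu> * f) e"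
  proof (cases "e - \<mu> \<in> \<nat>")
    case True
    then obtain k :: nat where "e - \<mu> = of_nat k" by (auto elim: Nats_cases)
    then have "e = of_nat k + \<mu>" by simp
    then show ?thesis by (simp add: euler_op_def shifted_fps_def algebra_simps)
  qed (simp add: euler_op_def shifted_fps_def)
qed

lemma series_times_swap:
  "series_times scale (swap_vars F) (swap_vars \<Phi>) a b v = series_times scale F \<Phi> b a v"
  unfolding series_times_def
proof (rule Sum_any.reindex_cong[of prod.swap])
  show "bij prod.swap" by (rule bij_swap)
qed (auto simp: swap_vars_def fun_eq_iff)

lemma monom_mult_delta_series:
  "monom_mult (- 1 + of_int k) 0 delta_series a b = diag (of_int k - 1) a b"
proof -
  have "a \<in> \<int> \<longleftrightarrow> b \<in> \<int>" if "a + b = of_int k - 1"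
  proof -
    have a: "a = of_int (k - 1) - b" "b = of_int (k - 1) - a" using that by simp_all
    show ?thesis by (metis a Ints_diff Ints_of_int)
  qed
  then show ?thesis
    by (auto simp: monom_mult_def delta_series_def ratio_series_def diag_def algebra_simps)
qed

lemma delta_series_diag: "delta_series a b = diag 0 a b"
  by (auto simp: delta_series_def ratio_series_def diag_def simp flip: eq_neg_iff_add_eq_0)

lemma tparam_mult_Ints:
  assumes "p > 0" and "coprime p q" and "of_int k * tparam p q \<in> \<int>"
  shows "p dvd k"
proof -
  from assms(3) obtain m where "of_int k * tparam p q = of_int m" by (auto elim: Ints_cases)
  then have "of_int (k * q) = (of_int (m * p) :: rat)"
    using assms(1) by (simp add: tparam_def field_simps)
  then have "k * q = m * p" by (simp only: of_int_eq_iff)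
  then have "p dvd k * q" by simp
  then show ?thesis using assms(2) by (simp add: coprime_dvd_mult_left_iff)
qed

lemma rho_notin_Ints:
  assumes "p > 0" and "coprime p q" and "1 \<le> r" and "r \<le> p - 1"
  shows "rho (tparam p q) r s \<notin> \<int>"
proof
  assume "rho (tparam p q) r s \<in> \<int>"
  then have "rho (tparam p q) r s + of_int s \<in> \<int>" by (intro Ints_add) auto
  then have "of_int r * tparam p q \<in> \<int>" by (simp add: rho_def)
  then have "p dvd r" by (rule tparam_mult_Ints[OF assms(1,2)])
  then show False using assms zdvd_imp_le by fastforce
qed

text \<open>For e = h' - h - \<Delta>, completing the square in e^2 + (t - 1) e = t h gives (2e + t
  - 1)^2 = \<rho>^2; the two shifts of r correspond to its two roots.\<close>

lemma kac_weight_shift: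
  assumes "t \<noteq> 0" and "\<sigma> \<in> {1, - 1}"
  shows "2 * (kac_weight t (r + \<sigma>) s - kac_weight t r s - delta21 t) + t - 1 = of_int \<sigma> * rho t r s"
    and "(kac_weight t (r + \<sigma>) s - kac_weight t r s - delta21 t)\<^sup>2
       + (t - 1) * (kac_weight t (r + \<sigma>) s - kac_weight t r s - delta21 t) = t * kac_weight t r s"
proof -
  define e where "e = kac_weight t (r + \<sigma>) s - kac_weight t r s - delta21 t"
  have k: "4 * t * kac_weight t r s = (rho t r s)\<^sup>2 - (t - 1)\<^sup>2" for r
    using assms(1) by (simp add: kac_weight_def rho_def)
  have "rho t (r + \<sigma>) s = rho t r s + of_int \<sigma> * t" by (simp add: rho_def algebra_simps)
  then have "4 * t * (kac_weight t (r + \<sigma>) s - kac_weight t r s) = t * (2 * of_int \<sigma> * rho t r s + t)"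
    unfolding right_diff_distrib k using assms(2) by (auto simp: power2_eq_square algebra_simps)
  then have "4 * (kac_weight t (r + \<sigma>) s - kac_weight t r s) = 2 * of_int \<sigma> * rho t r s + t"
  proof -
    assume *: "4 * t * (kac_weight t (r + \<sigma>) s - kac_weight t r s) = t * (2 * of_int \<sigma> * rho t r s + t)"
    have "t * (4 * (kac_weight t (r + \<sigma>) s - kac_weight t r s)) = t * (2 * of_int \<sigma> * rho t r s + t)"
      unfolding *[symmetric] by simp
    then show ?thesis using assms(1) by (simp only: mult_cancel_left) simp
  qed
  then have e: "2 * e + t - 1 = of_int \<sigma> * rho t r s"
    by (simp add: e_def delta21_def field_simps)
  then show "2 * (kac_weight t (r + \<sigma>) s - kac_weight t r s - delta21 t) + t - 1 = of_int \<sigma> * rho t r s"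
    by (simp add: e_def)
  have "4 * (e\<^sup>2 + (t - 1) * e) = (2 * e + t - 1)\<^sup>2 - (t - 1)\<^sup>2"
    by (simp add: power2_eq_square algebra_simps)
  also have "\<dots> = 4 * t * kac_weight t r s"
    unfolding e k using assms(2) by (auto simp: power2_eq_square)
  finally show "(kac_weight t (r + \<sigma>) s - kac_weight t r s - delta21 t)\<^sup>2
       + (t - 1) * (kac_weight t (r + \<sigma>) s - kac_weight t r s - delta21 t) = t * kac_weight t r s"
    by (simp add: e_def)
qed

lemma (in field_pair) series_times_H:
  assumes "v \<in> V"
  shows "series_times scale (monom_mult \<alpha> \<beta> (ratio_series (shifted_fps \<mu> f))) (op_product A B) a b v
    = H f (\<alpha> - \<mu>) (\<beta> + \<mu>) a b v"
  unfolding series_times_G[OF assms] H_def by (simp add: algebra_simps)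

theorem proposition2p4:
  fixes scale :: "complex \<Rightarrow> 'v::ab_group_add \<Rightarrow> 'v"
    and p q :: int
    and M :: "int \<Rightarrow> int \<Rightarrow> 'v set"
    and L :: "int \<Rightarrow> int \<Rightarrow> int \<Rightarrow> 'v \<Rightarrow> 'v"
    and vac :: "int \<Rightarrow> int \<Rightarrow> 'v"
    and \<phi> :: "int \<Rightarrow> int \<Rightarrow> int \<Rightarrow> rat \<Rightarrow> 'v \<Rightarrow> 'v"
    and r s :: int
  defines "t \<equiv> tparam p q"
  defines "\<Phi> \<equiv> (\<lambda>\<sigma> r s. field_series (delta21 t) (\<phi> \<sigma> r s))"
  assumes "vector_space scale"
    and "p \<ge> 3" and "q > 0" and "coprime p q"
    and modules: "\<And>r s. 1 \<le> r \<Longrightarrow> r \<le> p - 1 \<Longrightarrow> 1 \<le> s \<Longrightarrow> s \<le> q - 1 \<Longrightarrow>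
      irreducible_highest_weight_module scale (central_charge t) (kac_weight t r s)
        (M r s) (L r s) (vac r s)"
    and fields: "\<And>\<sigma> r s. \<sigma> \<in> {1, - 1} \<Longrightarrow> 1 \<le> r \<Longrightarrow> r \<le> p - 1 \<Longrightarrow>
      1 \<le> r + \<sigma> \<Longrightarrow> r + \<sigma> \<le> p - 1 \<Longrightarrow> 1 \<le> s \<Longrightarrow> s \<le> q - 1 \<Longrightarrow>
      primary_field scale (delta21 t)
        (kac_weight t r s) (M r s) (L r s) (vac r s)
        (kac_weight t (r + \<sigma>) s) (M (r + \<sigma>) s) (L (r + \<sigma>) s) (vac (r + \<sigma>) s)
        (\<phi> \<sigma> r s)"
    and "1 \<le> r" and "r \<le> p - 1" and "1 \<le> s" and "s \<le> q - 1"
  shows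
    "(\<forall>v \<in> M r s. \<forall>a b.
        (\<Sum>\<sigma> \<in> channels p r.
           series_times scale (fcoeff p q \<sigma> r s)
             (op_product (\<Phi> (- \<sigma>) (r + \<sigma>) s) (\<Phi> \<sigma> r s)) a b v) +
        (\<Sum>\<sigma> \<in> channels p r.
           series_times scale (swap_vars (fcoeff p q \<sigma> r s))
             (swap_vars (op_product (\<Phi> (- \<sigma>) (r + \<sigma>) s) (\<Phi> \<sigma> r s))) a b v) =
        scale (of_rat (monom_mult
          (- 1 + (if 2 \<le> r \<and> r \<le> p - 2 then 0
                  else if r = 1 then of_int (s - 1)
                  else of_int (q - s - 1))) 0
          delta_series a b)) v)
     \<and>
     (2 \<le> r \<and> r \<le> p - 2 \<longrightarrow>
      (\<forall>v \<in> M r s. \<forall>a b.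
        (\<Sum>\<sigma> \<in> channels p r.
           series_times scale (gcoeff p q \<sigma> r s)
             (op_product (\<Phi> (- \<sigma>) (r + \<sigma>) s) (\<Phi> \<sigma> r s)) a b v) +
        (\<Sum>\<sigma> \<in> channels p r.
           series_times scale (swap_vars (gcoeff p q \<sigma> r s))
             (swap_vars (op_product (\<Phi> (- \<sigma>) (r + \<sigma>) s) (\<Phi> \<sigma> r s))) a b v) =
        scale (of_rat (- 2 * delta21 t * delta_series a b)) v))
     \<and>
     (\<forall>\<sigma> \<in> {1, - 1}. 1 \<le> r + 2 * \<sigma> \<and> r + 2 * \<sigma> \<le> p - 1 \<longrightarrow>
      (\<forall>v \<in> M r s. \<forall>a b.
        series_times scale (hcoeff p q \<sigma> r s)
          (op_product (\<Phi> \<sigma> (r + \<sigma>) s) (\<Phi> \<sigma> r s)) a b v =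
        series_times scale (swap_vars (hcoeff p q \<sigma> r s))
          (swap_vars (op_product (\<Phi> \<sigma> (r + \<sigma>) s) (\<Phi> \<sigma> r s))) a b v))"
proof -
  note p = \<open>p \<ge> 3\<close> and q = \<open>q > 0\<close> and coprime = \<open>coprime p q\<close>
  note r = \<open>1 \<le> r\<close> \<open>r \<le> p - 1\<close> and s = \<open>1 \<le> s\<close> \<open>s \<le> q - 1\<close>
  have t0: "t \<noteq> 0" using p q by (simp add: t_def tparam_def)
  have pq: "of_int p * t = of_int q" using p by (simp add: t_def tparam_def)
  \<comment> \<open>This is where p \<ge> 3 enters: p divides neither 1 nor 2.\<close>
  have t_int: "t \<notin> \<int>" "2 * t \<notin> \<int>"
  proof -
    show "t \<notin> \<int>"
      using tparam_mult_Ints[of p q 1] p coprime zdvd_imp_le[of p 1] by (auto simp: t_def)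
    show "2 * t \<notin> \<int>"
      using tparam_mult_Ints[of p q 2] p coprime zdvd_imp_le[of p 2] by (auto simp: t_def)
  qed
  have \<rho>: "rho t r s \<notin> \<int>"
    unfolding t_def using rho_notin_Ints p coprime r by simp
  interpret complex_vs scale using \<open>vector_space scale\<close> by (rule complex_vs.intro)
  have pair: "field_pair scale t (kac_weight t r s) (M r s) (L r s) (vac r s)
      (kac_weight t (r + \<sigma>) s) (M (r + \<sigma>) s) (L (r + \<sigma>) s) (vac (r + \<sigma>) s) (\<phi> \<sigma> r s)
      (kac_weight t (r + \<sigma> + \<sigma>') s) (M (r + \<sigma> + \<sigma>') s) (L (r + \<sigma> + \<sigma>') s) (vac (r + \<sigma> + \<sigma>') s) (\<phi> \<sigma>' (r + \<sigma>) s)"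
    if "\<sigma> \<in> {1, - 1}" "\<sigma>' \<in> {1, - 1}" "1 \<le> r + \<sigma>" "r + \<sigma> \<le> p - 1" "1 \<le> r + \<sigma> + \<sigma>'" "r + \<sigma> + \<sigma>' \<le> p - 1" for \<sigma> \<sigma>'
    using that r s t0
    by (intro field_pairI modules fields \<open>vector_space scale\<close> kac_weight_shift(2)) auto
  have pair': "field_pair scale t (kac_weight t r s) (M r s) (L r s) (vac r s)
      (kac_weight t (r + \<sigma>) s) (M (r + \<sigma>) s) (L (r + \<sigma>) s) (vac (r + \<sigma>) s) (\<phi> \<sigma> r s)
      (kac_weight t r s) (M r s) (L r s) (vac r s) (\<phi> (- \<sigma>) (r + \<sigma>) s)"
    if "\<sigma> \<in> {1, - 1}" "1 \<le> r + \<sigma>" "r + \<sigma> \<le> p - 1" for \<sigma>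
    using pair[of \<sigma> "- \<sigma>"] that r by auto
  have sum1: "(\<Sum>\<sigma>\<in>{\<sigma>0}. X \<sigma>) = X \<sigma>0" for X :: "int \<Rightarrow> 'v" and \<sigma>0
    by simp
  have sum2: "(\<Sum>\<sigma>\<in>{1, - 1 :: int}. X \<sigma>) = X 1 + X (- 1)" for X :: "int \<Rightarrow> 'v"
    by simp
  have two_pairs: "two_pairs scale t (kac_weight t r s) (M r s) (L r s) (vac r s)
      (kac_weight t (r + 1) s) (M (r + 1) s) (L (r + 1) s) (vac (r + 1) s) (\<phi> 1 r s) (\<phi> (- 1) (r + 1) s)
      (kac_weight t (r + - 1) s) (M (r + - 1) s) (L (r + - 1) s) (vac (r + - 1) s) (\<phi> (- 1) r s) (\<phi> (- (- 1)) (r + - 1) s)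
      r s"
    and channels_bulk: "channels p r = {1, - 1}" if "2 \<le> r \<and> r \<le> p - 2"
  proof -
    show "channels p r = {1, - 1}" using that by (auto simp: channels_def)
    show "two_pairs scale t (kac_weight t r s) (M r s) (L r s) (vac r s)
      (kac_weight t (r + 1) s) (M (r + 1) s) (L (r + 1) s) (vac (r + 1) s) (\<phi> 1 r s) (\<phi> (- 1) (r + 1) s)
      (kac_weight t (r + - 1) s) (M (r + - 1) s) (L (r + - 1) s) (vac (r + - 1) s) (\<phi> (- 1) r s) (\<phi> (- (- 1)) (r + - 1) s)
      r s"
    proof (intro two_pairs.intro two_pairs_axioms.intro \<rho> complex_vs_axioms)
      show "2 * (kac_weight t (r + 1) s - kac_weight t r s - delta21 t) + t - 1 = rho t r s"
        using kac_weight_shift(1)[OF t0, of 1 r s] by simp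
      show "2 * (kac_weight t (r + - 1) s - kac_weight t r s - delta21 t) + t - 1 = - rho t r s"
        using kac_weight_shift(1)[OF t0, of "- 1" r s] by simp
    qed (rule pair'; use that in simp)+
  qed
  show ?thesis
    \<comment> \<open>The exchanged sums are the original ones at (b, a), so products are evaluated
      in one order only.\<close>
    unfolding series_times_swap qs_def[symmetric]
  proof (intro conjI ballI allI impI)
    fix v a b assume v: "v \<in> M r s"
    consider (bulk) "2 \<le> r \<and> r \<le> p - 2" | (left) "r = 1" | (right) "r = p - 1" "r \<noteq> 1"
      using r p by linarith
    then show "(\<Sum>\<sigma> \<in> channels p r. series_times scale (fcoeff p q \<sigma> r s)
             (op_product (\<Phi> (- \<sigma>) (r + \<sigma>) s) (\<Phi> \<sigma> r s)) a b v) +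
        (\<Sum>\<sigma> \<in> channels p r. series_times scale (fcoeff p q \<sigma> r s)
             (op_product (\<Phi> (- \<sigma>) (r + \<sigma>) s) (\<Phi> \<sigma> r s)) b a v) =
        qs (monom_mult (- 1 + (if 2 \<le> r \<and> r \<le> p - 2 then 0
                  else if r = 1 then of_int (s - 1) else of_int (q - s - 1))) 0 delta_series a b) v"
    proof cases
      case bulk
      interpret two_pairs scale t "kac_weight t r s" "M r s" "L r s" "vac r s"
        "kac_weight t (r + 1) s" "M (r + 1) s" "L (r + 1) s" "vac (r + 1) s" "\<phi> 1 r s" "\<phi> (- 1) (r + 1) s"
        "kac_weight t (r + - 1) s" "M (r + - 1) s" "L (r + - 1) s" "vac (r + - 1) s" "\<phi> (- 1) r s" "\<phi> (- (- 1)) (r + - 1) s"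
        r s
        using bulk by (rule two_pairs)
      have fc: "fcoeff p q \<sigma> r s = monom_mult (delta21 t - 1) (delta21 t)
          (ratio_series (shifted_fps (- lam t \<sigma> r s) (f \<sigma>)))" for \<sigma>
        using bulk by (simp add: fcoeff_def Let_def f_def flip: t_def)
      show ?thesis
        unfolding channels_bulk[OF bulk] sum2 \<Phi>_def fc P.series_times_H[OF v] M.series_times_H[OF v]
        using anticommute_bulk(1)[OF v, of a b] bulk monom_mult_delta_series[of 0 a b]
        unfolding HF_def by (simp add: add_ac)
    next
      case left
      have ch: "channels p r = {1}" using left p by (auto simp: channels_def)
      interpret field_pair scale t "kac_weight t r s" "M r s" "L r s" "vac r s"
        "kac_weight t (r + 1) s" "M (r + 1) s" "L (r + 1) s" "vac (r + 1) s" "\<phi> 1 r s"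
        "kac_weight t r s" "M r s" "L r s" "vac r s" "\<phi> (- 1) (r + 1) s"
        by (rule pair'[of 1]) (use left p in auto)
      \<comment> \<open>For r = 1, \<tau> = \<rho> = t - s = t - 1 - N.\<close>
      define N where "N = nat (s - 1)"
      have N: "of_nat N = (of_int s - 1 :: rat)" "of_int (s - 1) = (of_nat N :: rat)" using s by (simp_all add: N_def)
      have fc: "fcoeff p q 1 r s = monom_mult (of_nat N / 2 + (3 * t / 2 - 2)) (of_nat N / 2)
          (ratio_series (shifted_fps 0 (fps_const (Kcoeff (1 - t) N) * one_minus_powr (3 * t / 2 - 2))))"
      proof -
        have e: "of_nat N / 2 + (3 * t / 2 - 2) = 3 * (t - 1) / 2 + of_int s / 2 - 1" "of_nat N / 2 = ((of_int s - 1) / 2 :: rat)"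
          "3 * t / 2 - 2 = - 2 + 3 * t / 2"
          by (simp_all add: N field_simps)
        show ?thesis
          unfolding e(1) unfolding e(2,3) unfolding N_def using left p by (simp add: fcoeff_def Let_def flip: t_def)
      qed
      have \<tau>: "2 * (kac_weight t (r + 1) s - kac_weight t r s - delta21 t) + t - 1 = t - 1 - of_nat N"
        using kac_weight_shift(1)[OF t0, of 1 r s] left by (simp add: N rho_def)
      have "monom_mult (- 1 + of_int (s - 1)) 0 delta_series a b = diag (of_nat N - 1) a b"
        using monom_mult_delta_series[of "s - 1" a b] by (simp only: N(2))
      then have rhs: "monom_mult (- 1 + (if 2 \<le> r \<and> r \<le> p - 2 then 0 else if r = 1 then of_int (s - 1)
          else of_int (q - s - 1))) 0 delta_series a b = diag (of_nat N - 1) a b"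
        using left by simp
      show ?thesis
        unfolding ch sum1 \<Phi>_def fc series_times_H[OF v] rhs
        using anticommute_boundary[OF refl refl refl refl \<tau> t_int v, of a b] by simp
    next
      case right
      have ch: "channels p r = {- 1}" using right p by (auto simp: channels_def)
      interpret field_pair scale t "kac_weight t r s" "M r s" "L r s" "vac r s"
        "kac_weight t (r + - 1) s" "M (r + - 1) s" "L (r + - 1) s" "vac (r + - 1) s" "\<phi> (- 1) r s"
        "kac_weight t r s" "M r s" "L r s" "vac r s" "\<phi> (- (- 1)) (r + - 1) s"
        by (rule pair'[of "- 1"]) (use right p in auto)
      \<comment> \<open>For r = p - 1, \<tau> = -\<rho> = t - q + s = t - 1 - N, using p t =
        q.\<close>
      define N where "N = nat (q - s - 1)"
      have N: "of_nat N = (of_int q - of_int s - 1 :: rat)" "of_int (q - s - 1) = (of_nat N :: rat)"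
        using s by (simp_all add: N_def)
      have fc: "fcoeff p q (- 1) r s = monom_mult (of_nat N / 2 + (3 * t / 2 - 2)) (of_nat N / 2)
          (ratio_series (shifted_fps 0 (fps_const (Kcoeff (1 - t) N) * one_minus_powr (3 * t / 2 - 2))))"
      proof -
        have e: "of_nat N / 2 + (3 * t / 2 - 2) = 3 * (t - 1) / 2 + of_int (q - s) / 2 - 1" "of_nat N / 2 = (of_int (q - s - 1) / 2 :: rat)"
          "3 * t / 2 - 2 = - 2 + 3 * t / 2"
          by (simp_all add: N field_simps)
        show ?thesis
          unfolding e(1) unfolding e(2,3) unfolding N_def using right p by (simp add: fcoeff_def Let_def flip: t_def)
      qed
      have \<tau>: "2 * (kac_weight t (r + - 1) s - kac_weight t r s - delta21 t) + t - 1 = t - 1 - of_nat N"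
      proof -
        have "of_int (- 1) * rho t r s = t - 1 - of_nat N"
          using pq by (simp add: right(1) N rho_def algebra_simps)
        moreover have "(- 1 :: int) \<in> {1, - 1}" by simp
        ultimately show ?thesis
          using kac_weight_shift(1)[OF t0, of "- 1" r s] by (simp only:)
      qed
      have "monom_mult (- 1 + of_int (q - s - 1)) 0 delta_series a b = diag (of_nat N - 1) a b"
        using monom_mult_delta_series[of "q - s - 1" a b] by (simp only: N(2))
      then have rhs: "monom_mult (- 1 + (if 2 \<le> r \<and> r \<le> p - 2 then 0 else if r = 1 then of_int (s - 1)
          else of_int (q - s - 1))) 0 delta_series a b = diag (of_nat N - 1) a b"
        using right by simp
      show ?thesis
        unfolding ch sum1 \<Phi>_def fc series_times_H[OF v] rhs
        using anticommute_boundary[OF refl refl refl refl \<tau> t_int v, of a b] by simp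
    qed
  next
    fix v a b assume bulk: "2 \<le> r \<and> r \<le> p - 2" and v: "v \<in> M r s"
    interpret two_pairs scale t "kac_weight t r s" "M r s" "L r s" "vac r s"
      "kac_weight t (r + 1) s" "M (r + 1) s" "L (r + 1) s" "vac (r + 1) s" "\<phi> 1 r s" "\<phi> (- 1) (r + 1) s"
      "kac_weight t (r + - 1) s" "M (r + - 1) s" "L (r + - 1) s" "vac (r + - 1) s" "\<phi> (- 1) r s" "\<phi> (- (- 1)) (r + - 1) s"
      r s
      using bulk by (rule two_pairs)
    have gc: "gcoeff p q \<sigma> r s = monom_mult (delta21 t) (delta21 t)
        (ratio_series (shifted_fps (- lam t \<sigma> r s) (g \<sigma>)))" for \<sigma>
      using bulk by (simp add: gcoeff_def Let_def ycheck_def euler_op_shifted_fps g_def flip: t_def fps_const_neg)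
    show "(\<Sum>\<sigma> \<in> channels p r. series_times scale (gcoeff p q \<sigma> r s)
             (op_product (\<Phi> (- \<sigma>) (r + \<sigma>) s) (\<Phi> \<sigma> r s)) a b v) +
        (\<Sum>\<sigma> \<in> channels p r. series_times scale (gcoeff p q \<sigma> r s)
             (op_product (\<Phi> (- \<sigma>) (r + \<sigma>) s) (\<Phi> \<sigma> r s)) b a v) =
        qs (- 2 * delta21 t * delta_series a b) v"
      unfolding channels_bulk[OF bulk] sum2 \<Phi>_def gc P.series_times_H[OF v] M.series_times_H[OF v]
      using anticommute_bulk(2)[OF v, of a b]
      unfolding HG_def by (simp add: add_ac delta_series_diag)
  next
    fix \<sigma> v a b assume \<sigma>: "\<sigma> \<in> {1, - 1}" and range: "1 \<le> r + 2 * \<sigma> \<and> r + 2 * \<sigma> \<le> p - 1" and v: "v \<in> M r s"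
    interpret field_pair scale t "kac_weight t r s" "M r s" "L r s" "vac r s"
      "kac_weight t (r + \<sigma>) s" "M (r + \<sigma>) s" "L (r + \<sigma>) s" "vac (r + \<sigma>) s" "\<phi> \<sigma> r s"
      "kac_weight t (r + \<sigma> + \<sigma>) s" "M (r + \<sigma> + \<sigma>) s" "L (r + \<sigma> + \<sigma>) s" "vac (r + \<sigma> + \<sigma>) s" "\<phi> \<sigma> (r + \<sigma>) s"
      by (rule pair) (use \<sigma> range r in auto)
    define \<tau>' where "\<tau>' = of_int \<sigma> * rho t r s"
    have \<tau>: "2 * (kac_weight t (r + \<sigma>) s - kac_weight t r s - delta21 t) + t - 1 = \<tau>'"
      unfolding \<tau>'_def by (rule kac_weight_shift(1)[OF t0 \<sigma>])
    have "of_int \<sigma> * rho t (r + \<sigma>) s = \<tau>' + t"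
      using \<sigma> by (auto simp: \<tau>'_def rho_def algebra_simps)
    then have "2 * (kac_weight t (r + \<sigma> + \<sigma>) s - kac_weight t (r + \<sigma>) s - delta21 t) + t - 1 = \<tau>' + t"
      using kac_weight_shift(1)[OF t0 \<sigma>, of "r + \<sigma>" s] by simp
    then have \<eta>: "kac_weight t (r + \<sigma> + \<sigma>) s - kac_weight t (r + \<sigma>) s - delta21 t = (\<tau>' + 1) / 2"
      by simp
    have "\<tau>' \<notin> \<int>" using \<sigma> \<rho> by (auto simp: \<tau>'_def)
    note comm = commute_same_sign[unfolded \<tau>, OF \<eta> this v, of a b]
    have hc: "hcoeff p q \<sigma> r s = monom_mult ((t - 1) / 2 - \<tau>' / 2 - t / 2) ((t - 1) / 2 - \<tau>' / 2)
        (ratio_series (shifted_fps 0 (one_minus_powr (- t / 2))))"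
      by (simp add: hcoeff_def \<tau>'_def Let_def flip: t_def)
    show "series_times scale (hcoeff p q \<sigma> r s) (op_product (\<Phi> \<sigma> (r + \<sigma>) s) (\<Phi> \<sigma> r s)) a b v =
        series_times scale (hcoeff p q \<sigma> r s) (op_product (\<Phi> \<sigma> (r + \<sigma>) s) (\<Phi> \<sigma> r s)) b a v"
      unfolding \<Phi>_def hc series_times_H[OF v] using comm by simp
  qed
qed

end
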